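(* Let $\mathbf k$ be a field, let $n\ge 1$ be an integer, and let $A_n=\mathbf k\overrightarrow{\mathbb A}_n$ be the path algebra of the linearly oriented quiver $\overrightarrow{\mathbb A}_n$: $1\xrightarrow{a_1}2\xrightarrow{a_2}\cdots\xrightarrow{a_{n-1}}n$. Then $$\mathrm{OSpec}(A_n)=\{0,1,2,\dots,n-1\}.$$
   Context: $\mathrm{mod}\,A_n$ is the category of finitely generated right $A_n$-modules; $\mathbb N$ includes $0$. For an Abelian category $\mathcal A$ and a subclass $\mathcal U$, $\mathrm{add}\,\mathcal U$ is the full subcategory of direct summands of finite direct sums of objects of $\mathcal U$. For subcategories $\mathcal U_1,\mathcal U_2$, put $\mathcal U_1\bullet\mathcal U_2=\mathrm{add}\{X\in\mathcal A\mid \text{there is an exact sequence } 0\to U_1\to X\to U_2\to 0 \text{ with } U_1\in\mathcal U_1,\ U_2\in\mathcal U_2\}$. For an object $X$ put $[X]_0=0$, $[X]_1=\mathrm{add}\,X$, $[X]_n=[X]_1\bullet[X]_{n-1}$ for $n\ge2$. The generation time of $X$ is $\inf\{n\in\mathbb N\mid \mathcal A=[X]_{n+1}\}$ if $[X]_t=\mathcal A$ for some $t\in\mathbb N$, and $+\infty$ otherwise; $X$ is a strong generator if its generation time is finite. $\mathrm{OSpec}(\mathcal A)$ is the set of generation times of all strong generators of $\mathcal A$, and $\mathrm{OSpec}(A_n):=\mathrm{OSpec}(\mathrm{mod}\,A_n)$. *)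

theory Defs
  imports
    "HOL-Algebra.Ring"
    "HOL-Library.Extended_Nat"
    "Graph_Theory.Arc_Walk"
begin

text \<open>The adjacency arrow of digraphs clashes with the arrow of function sets.\<close>

no_notation dominates (\<open>_ \<rightarrow>\<index> _\<close> [100,100] 40)

section \<open>Right modules over a ring\<close>

text \<open>
  As in HOL-Algebra's record for modules over a commutative ring, the additive group of a module
  is stored in a ring record whose multiplication and unit are ignored.
\<close>

record ('a, 'b) rmodule = "'b ring" +
  ract :: "'b \<Rightarrow> 'a \<Rightarrow> 'b"  (infixl \<open>\<cdot>\<index>\<close> 70)

locale right_module = R?: ring R + M?: abelian_group M
  for R (structure) and M (structure) +
  assumes ract_closed:
      "\<lbrakk>x \<in> carrier M; a \<in> carrier R\<rbrakk> \<Longrightarrow> x \<cdot>\<^bsub>M\<^esub> a \<in> carrier M"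
    and ract_add_left:
      "\<lbrakk>x \<in> carrier M; y \<in> carrier M; a \<in> carrier R\<rbrakk>
        \<Longrightarrow> (x \<oplus>\<^bsub>M\<^esub> y) \<cdot>\<^bsub>M\<^esub> a = x \<cdot>\<^bsub>M\<^esub> a \<oplus>\<^bsub>M\<^esub> y \<cdot>\<^bsub>M\<^esub> a"
    and ract_add_right:
      "\<lbrakk>x \<in> carrier M; a \<in> carrier R; b \<in> carrier R\<rbrakk>
        \<Longrightarrow> x \<cdot>\<^bsub>M\<^esub> (a \<oplus>\<^bsub>R\<^esub> b) = x \<cdot>\<^bsub>M\<^esub> a \<oplus>\<^bsub>M\<^esub> x \<cdot>\<^bsub>M\<^esub> b"
    and ract_mult:
      "\<lbrakk>x \<in> carrier M; a \<in> carrier R; b \<in> carrier R\<rbrakk>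
        \<Longrightarrow> x \<cdot>\<^bsub>M\<^esub> (a \<otimes>\<^bsub>R\<^esub> b) = (x \<cdot>\<^bsub>M\<^esub> a) \<cdot>\<^bsub>M\<^esub> b"
    and ract_one: "x \<in> carrier M \<Longrightarrow> x \<cdot>\<^bsub>M\<^esub> \<one>\<^bsub>R\<^esub> = x"

definition finitely_generated ::
  "('a, 'r) ring_scheme \<Rightarrow> ('a, 'b, 'm) rmodule_scheme \<Rightarrow> bool" where
  "finitely_generated R M \<longleftrightarrow>
    (\<exists>S. finite S \<and> S \<subseteq> carrier M \<and>
      (\<forall>x \<in> carrier M. \<exists>c \<in> S \<rightarrow> carrier R. x = (\<Oplus>\<^bsub>M\<^esub>s\<in>S. s \<cdot>\<^bsub>M\<^esub> c s)))"

definition rmod_hom ::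
  "('a, 'r) ring_scheme \<Rightarrow> ('a, 'b, 'm) rmodule_scheme \<Rightarrow> ('a, 'c, 'n) rmodule_scheme
    \<Rightarrow> ('b \<Rightarrow> 'c) set" where
  "rmod_hom R M N = {f \<in> carrier M \<rightarrow> carrier N.
    (\<forall>x \<in> carrier M. \<forall>y \<in> carrier M. f (x \<oplus>\<^bsub>M\<^esub> y) = f x \<oplus>\<^bsub>N\<^esub> f y) \<and>
    (\<forall>x \<in> carrier M. \<forall>a \<in> carrier R. f (x \<cdot>\<^bsub>M\<^esub> a) = f x \<cdot>\<^bsub>N\<^esub> a)}"

definition rmod_isomorphic ::
  "('a, 'r) ring_scheme \<Rightarrow> ('a, 'b, 'm) rmodule_scheme \<Rightarrow> ('a, 'c, 'n) rmodule_scheme \<Rightarrow> bool" where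
  "rmod_isomorphic R M N \<longleftrightarrow> (\<exists>f \<in> rmod_hom R M N. bij_betw f (carrier M) (carrier N))"

definition short_exact ::
  "('a, 'r) ring_scheme \<Rightarrow> ('a, 'b, 'l) rmodule_scheme \<Rightarrow> ('a, 'c, 'm) rmodule_scheme
    \<Rightarrow> ('a, 'd, 'n) rmodule_scheme \<Rightarrow> bool" where
  "short_exact R L M N \<longleftrightarrow>
    (\<exists>f \<in> rmod_hom R L M. \<exists>g \<in> rmod_hom R M N.
      inj_on f (carrier L) \<and>
      f ` carrier L = {x \<in> carrier M. g x = \<zero>\<^bsub>N\<^esub>} \<and>
      g ` carrier M = carrier N)"

text \<open>The external direct sum of the modules in a list; the empty list yields the zero module.\<close>

definition direct_sum :: "('a, 'b) rmodule list \<Rightarrow> ('a, 'b list) rmodule" where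
  "direct_sum Ms = \<lparr>
     carrier = {xs. list_all2 (\<lambda>x M. x \<in> carrier M) xs Ms},
     mult = undefined,
     one = undefined,
     zero = map zero Ms,
     add = (\<lambda>xs ys. map (\<lambda>i. xs ! i \<oplus>\<^bsub>Ms ! i\<^esub> ys ! i) [0..<length Ms]),
     ract = (\<lambda>xs a. map (\<lambda>i. xs ! i \<cdot>\<^bsub>Ms ! i\<^esub> a) [0..<length Ms]) \<rparr>"

lemma right_module_direct_sum:
  assumes R: "ring R" and Ms: "\<And>M. M \<in> set Ms \<Longrightarrow> right_module R M"
  shows "right_module R (direct_sum Ms)"
proof -
  interpret R: ring R by fact
  have m: "right_module R (Ms ! i)" if "i < length Ms" for i using Ms that by simp
  have ag: "abelian_group (Ms ! i)" if "i < length Ms" for i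
    using m[OF that] by (simp add: right_module_def)
  note g = ag[THEN abelian_group.axioms(1)] 
  have "abelian_group (direct_sum Ms)"
  proof (rule abelian_groupI)
    fix x assume x: "x \<in> carrier (direct_sum Ms)"
    show "\<exists>y\<in>carrier (direct_sum Ms). y \<oplus>\<^bsub>direct_sum Ms\<^esub> x = \<zero>\<^bsub>direct_sum Ms\<^esub>"
      by (rule bexI[of _ "map (\<lambda>i. \<ominus>\<^bsub>Ms ! i\<^esub> (x ! i)) [0..<length Ms]"])
         (use x in \<open>auto simp: direct_sum_def list_all2_conv_all_nth abelian_group.l_neg[OF ag]
            abelian_group.a_inv_closed[OF ag] intro!: nth_equalityI\<close>)
  qed (auto simp: direct_sum_def list_all2_conv_all_nth abelian_monoid.a_closed[OF g]
        abelian_monoid.zero_closed[OF g] abelian_monoid.l_zero[OF g] abelian_monoid.a_assoc[OF g]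
        abelian_monoid.r_zero[OF g] abelian_monoid.a_lcomm[OF g] abelian_monoid.a_comm[OF g] intro!: nth_equalityI)
  then show ?thesis
    by (intro right_module.intro right_module_axioms.intro R)
       (auto simp: direct_sum_def list_all2_conv_all_nth 
         right_module.ract_closed[OF m] right_module.ract_add_left[OF m] right_module.ract_mult[OF m]
         right_module.ract_add_right[OF m] right_module.ract_one[OF m] intro!: nth_equalityI)
qed

section \<open>The category of finitely generated right modules\<close>

text \<open>
  The objects live in the fixed universe of lists over the underlying type of the ring. This loses
  nothing: a module generated by \<open>m\<close> elements is in bijection with a set of coefficient
  lists of length \<open>m\<close>, so every finitely generated right module, on whatever type, is isomorphic to
  an object (proved below as \<open>fg_right_module_isomorphic_mod\<close>).
\<close>

definition mod_cat :: "('a, 'r) ring_scheme \<Rightarrow> ('a, 'a list) rmodule set" where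
  "mod_cat R = {M. right_module R M \<and> finitely_generated R M}"

lemma right_module_iso_transfer:
  fixes M :: "('a, 'b, 'm) rmodule_scheme" and N :: "('a, 'c) rmodule"
  assumes M: "right_module R M" and N: "carrier N = f ` carrier M" and inj: "inj_on f (carrier M)"
    and z: "\<zero>\<^bsub>N\<^esub> = f \<zero>\<^bsub>M\<^esub>"
    and a: "\<And>x y. x \<in> carrier M \<Longrightarrow> y \<in> carrier M \<Longrightarrow> f x \<oplus>\<^bsub>N\<^esub> f y = f (x \<oplus>\<^bsub>M\<^esub> y)"
    and s: "\<And>x c. x \<in> carrier M \<Longrightarrow> c \<in> carrier R \<Longrightarrow> f x \<cdot>\<^bsub>N\<^esub> c = f (x \<cdot>\<^bsub>M\<^esub> c)"
  shows "right_module R N"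
proof -
  interpret right_module R M by fact
  have "abelian_group N"
  proof (rule abelian_groupI)
    fix x assume "x \<in> carrier N"
    then obtain x' where x': "x' \<in> carrier M" "x = f x'" by (auto simp: N)
    then show "\<exists>y\<in>carrier N. y \<oplus>\<^bsub>N\<^esub> x = \<zero>\<^bsub>N\<^esub>"
      by (intro bexI[of _ "f (\<ominus>\<^bsub>M\<^esub> x')"]) (auto simp: N z a M.l_neg)
  qed (auto simp: N z a M.a_ac)
  then show ?thesis
    by (intro right_module.intro right_module_axioms.intro)
       (auto simp: N a s R.ring_axioms ract_closed ract_add_left ract_add_right ract_mult ract_one)
qed

lemma fg_right_module_isomorphic_mod:
  fixes R :: "('a, 'r) ring_scheme" and M :: "('a, 'b) rmodule"
  assumes M: "right_module R M" and fg: "finitely_generated R M"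
  shows "\<exists>N \<in> mod_cat R. rmod_isomorphic R M N"
proof -
  interpret right_module R M by fact
  from fg obtain S where S: "finite S" "S \<subseteq> carrier M"
    and gen: "\<And>x. x \<in> carrier M \<Longrightarrow> \<exists>c \<in> S \<rightarrow> carrier R. x = (\<Oplus>\<^bsub>M\<^esub>s\<in>S. s \<cdot>\<^bsub>M\<^esub> c s)"
    unfolding finitely_generated_def by blast
  from gen obtain c where c: "\<And>x. x \<in> carrier M \<Longrightarrow> x = (\<Oplus>\<^bsub>M\<^esub>s\<in>S. s \<cdot>\<^bsub>M\<^esub> c x s)"
      "\<And>x. x \<in> carrier M \<Longrightarrow> c x \<in> S \<rightarrow> carrier R"
    by metis
  obtain xs where xs: "set xs = S" using S(1) finite_list by blast
  define f where "f x = map (c x) xs" for x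
  have inj: "inj_on f (carrier M)"
  proof (rule inj_onI)
    fix x y assume x: "x \<in> carrier M" and y: "y \<in> carrier M" and "f x = f y"
    then have eq: "c x s = c y s" if "s \<in> S" for s
      using that by (auto simp: f_def xs)
    have "x = (\<Oplus>\<^bsub>M\<^esub>s\<in>S. s \<cdot>\<^bsub>M\<^esub> c x s)" by (rule c(1)[OF x])
    also have "\<dots> = (\<Oplus>\<^bsub>M\<^esub>s\<in>S. s \<cdot>\<^bsub>M\<^esub> c y s)"
      by (rule M.finsum_cong') (use S c(2)[OF y] eq in \<open>auto intro!: ract_closed\<close>)
    also have "\<dots> = y" by (rule c(1)[OF y, symmetric])
    finally show "x = y" .
  qed
  define g where "g = the_inv_into (carrier M) f"
  have gf: "g (f x) = x" if "x \<in> carrier M" for x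
    using the_inv_into_f_f[OF inj that] by (simp add: g_def)
  define N :: "('a, 'a list) rmodule" where
    "N = \<lparr>carrier = f ` carrier M, mult = undefined, one = undefined, zero = f \<zero>\<^bsub>M\<^esub>,
          add = (\<lambda>x y. f (g x \<oplus>\<^bsub>M\<^esub> g y)), ract = (\<lambda>x a. f (g x \<cdot>\<^bsub>M\<^esub> a))\<rparr>"
  have Nadd: "f x \<oplus>\<^bsub>N\<^esub> f y = f (x \<oplus>\<^bsub>M\<^esub> y)" if "x \<in> carrier M" "y \<in> carrier M" for x y
    using that by (simp add: N_def gf)
  have Nact: "f x \<cdot>\<^bsub>N\<^esub> a = f (x \<cdot>\<^bsub>M\<^esub> a)" if "x \<in> carrier M" for x a
    using that by (simp add: N_def gf)
  have rN: "right_module R N"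
    by (rule right_module_iso_transfer[OF M _ inj]) (auto simp: Nadd Nact, auto simp: N_def)
  interpret N: right_module R N by fact
  have hom: "f \<in> rmod_hom R M N"
    by (auto simp: rmod_hom_def Nadd Nact) (simp add: N_def)
  have sum: "f (\<Oplus>\<^bsub>M\<^esub>s\<in>T. h s) = (\<Oplus>\<^bsub>N\<^esub>s\<in>T. f (h s))"
    if "finite T" "h \<in> T \<rightarrow> carrier M" for T and h :: "'b \<Rightarrow> 'b"
    using that
  proof (induction T rule: finite_induct)
    case empty
    have "\<zero>\<^bsub>N\<^esub> = f \<zero>\<^bsub>M\<^esub>" by (simp add: N_def)
    then show ?case by simp
  next
    case (insert s T)
    have "(\<lambda>s. f (h s)) \<in> T \<rightarrow> carrier N" "f (h s) \<in> carrier N"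
      using insert.prems by (auto simp: N_def)
    with insert show ?case by (simp add: Nadd[symmetric] Pi_def)
  qed
  have "finitely_generated R N"
    unfolding finitely_generated_def
  proof (intro exI[of _ "f ` S"] conjI ballI)
    show "finite (f ` S)" "f ` S \<subseteq> carrier N" using S by (auto simp: N_def)
    fix y assume "y \<in> carrier N"
    then obtain x where x: "x \<in> carrier M" "y = f x" by (auto simp: N_def)
    have injS: "inj_on f S" using inj S(2) inj_on_subset by blast
    have gS: "g (f s) = s" if "s \<in> S" for s using that S(2) gf by blast
    have cl: "(\<lambda>s. s \<cdot>\<^bsub>M\<^esub> c x s) \<in> S \<rightarrow> carrier M"
      using S(2) c(2)[OF x(1)] by (auto intro!: ract_closed)
    have "y = f (\<Oplus>\<^bsub>M\<^esub>s\<in>S. s \<cdot>\<^bsub>M\<^esub> c x s)" using c(1)[OF x(1)] x(2) by simp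
    also have "\<dots> = (\<Oplus>\<^bsub>N\<^esub>s\<in>S. f (s \<cdot>\<^bsub>M\<^esub> c x s))" by (rule sum[OF S(1) cl])
    also have "\<dots> = (\<Oplus>\<^bsub>N\<^esub>s\<in>S. f s \<cdot>\<^bsub>N\<^esub> c x (g (f s)))"
      by (rule N.finsum_cong') (use cl S(2) gS in \<open>auto simp: Nact N_def Pi_def gf subset_iff\<close>)
    also have "\<dots> = (\<Oplus>\<^bsub>N\<^esub>t\<in>f ` S. t \<cdot>\<^bsub>N\<^esub> c x (g t))"
      by (rule N.finsum_reindex[symmetric])
         (use cl S(2) injS gS in \<open>auto simp: N_def Pi_def gf subset_iff\<close>)
    finally show "\<exists>d\<in>f ` S \<rightarrow> carrier R. y = (\<Oplus>\<^bsub>N\<^esub>s\<in>f ` S. s \<cdot>\<^bsub>N\<^esub> d s)"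
      using c(2)[OF x(1)] gS by (intro bexI[of _ "\<lambda>t. c x (g t)"]) auto
  qed
  with rN have "N \<in> mod_cat R" by (simp add: mod_cat_def)
  moreover have "rmod_isomorphic R M N"
    using hom inj by (auto simp: rmod_isomorphic_def bij_betw_def N_def)
  ultimately show ?thesis by blast
qed

definition add_closure ::
  "('a, 'r) ring_scheme \<Rightarrow> ('a, 'a list) rmodule set \<Rightarrow> ('a, 'a list) rmodule set" where
  "add_closure R \<U> = {X \<in> mod_cat R. \<exists>Y \<in> mod_cat R. \<exists>Us. set Us \<subseteq> \<U> \<and>
     rmod_isomorphic R (direct_sum [X, Y]) (direct_sum Us)}"

definition ext_product ::
  "('a, 'r) ring_scheme \<Rightarrow> ('a, 'a list) rmodule set \<Rightarrow> ('a, 'a list) rmodule set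
    \<Rightarrow> ('a, 'a list) rmodule set" where
  "ext_product R \<U> \<V> =
     add_closure R {X \<in> mod_cat R. \<exists>U \<in> \<U>. \<exists>V \<in> \<V>. short_exact R U X V}"

fun gen_layer ::
  "('a, 'r) ring_scheme \<Rightarrow> ('a, 'a list) rmodule \<Rightarrow> nat \<Rightarrow> ('a, 'a list) rmodule set" where
  "gen_layer R X 0 = {M \<in> mod_cat R. carrier M = {\<zero>\<^bsub>M\<^esub>}}"
| "gen_layer R X (Suc 0) = add_closure R {X}"
| "gen_layer R X (Suc (Suc n)) =
     ext_product R (gen_layer R X (Suc 0)) (gen_layer R X (Suc n))"

definition generation_time :: "('a, 'r) ring_scheme \<Rightarrow> ('a, 'a list) rmodule \<Rightarrow> enat" where
  "generation_time R X =
     (if \<exists>t. gen_layer R X t = mod_cat R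
      then Inf {enat n | n. mod_cat R = gen_layer R X (n + 1)}
      else \<infinity>)"

definition strong_generator :: "('a, 'r) ring_scheme \<Rightarrow> ('a, 'a list) rmodule \<Rightarrow> bool" where
  "strong_generator R X \<longleftrightarrow> X \<in> mod_cat R \<and> generation_time R X < \<infinity>"

definition OSpec :: "('a, 'r) ring_scheme \<Rightarrow> enat set" where
  "OSpec R = {generation_time R X | X. strong_generator R X}"

section \<open>Path algebras\<close>

text \<open>
  A quiver is a directed multigraph. A path is recorded together with its start and end vertex, so
  that each vertex has its own path of length \<open>0\<close>.
\<close>

type_synonym ('v, 'e) path = "'v \<times> 'e list \<times> 'v"

definition paths :: "('v, 'e) pre_digraph \<Rightarrow> ('v, 'e) path set" where
  "paths Q = {(u, p, v). pre_digraph.awalk Q u p v}"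

text \<open>
  The product of two paths is their concatenation read from left to right, and \<open>0\<close> if they do not
  compose. With this order, right modules are the covariant representations of the quiver. The sum
  defining the product of \<open>f\<close> and \<open>g\<close> at a path \<open>(u, p, w)\<close> runs over the finitely many ways of
  cutting that path in two.
\<close>

definition path_algebra :: "('v, 'e) pre_digraph \<Rightarrow> (('v, 'e) path \<Rightarrow> 'k::field) ring" where
  "path_algebra Q = \<lparr>
     carrier = {f. finite {r. f r \<noteq> 0} \<and> {r. f r \<noteq> 0} \<subseteq> paths Q},
     mult = (\<lambda>f g (u, p, w).
       \<Sum>(q, v, q') \<in> {(q, v, q'). q @ q' = p \<and> (u, q, v) \<in> paths Q \<and> (v, q', w) \<in> paths Q}.
         f (u, q, v) * g (v, q', w)),
     one = (\<lambda>(u, p, v). if u \<in> verts Q \<and> p = [] \<and> u = v then 1 else 0),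
     zero = (\<lambda>r. 0),
     add = (\<lambda>f g r. f r + g r) \<rparr>"

context wf_digraph
begin

definition cuts :: "'a \<Rightarrow> 'b list \<Rightarrow> 'a \<Rightarrow> ('b list \<times> 'a \<times> 'b list) set" where
  "cuts u p w = {(q, v, q'). q @ q' = p \<and> (u, q, v) \<in> paths G \<and> (v, q', w) \<in> paths G}"

lemma finite_cuts: "finite (cuts u p w)"
proof (rule finite_subset)
  show "cuts u p w \<subseteq> (\<lambda>i. (take i p, awlast u (take i p), drop i p)) ` {..length p}"
  proof
    fix t assume "t \<in> cuts u p w"
    then obtain q v q' where t: "t = (q, v, q')" "q @ q' = p" "awalk u q v"
      by (auto simp: cuts_def paths_def)
    then have "t = (\<lambda>i. (take i p, awlast u (take i p), drop i p)) (length q)"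
      by auto
    then show "t \<in> (\<lambda>i. (take i p, awlast u (take i p), drop i p)) ` {..length p}"
      using t(2) by (intro image_eqI) auto
  qed
qed simp

lemma mult_path_algebra:
  "(f \<otimes>\<^bsub>path_algebra G\<^esub> g) (u, p, w) = (\<Sum>(q, v, q') \<in> cuts u p w. f (u, q, v) * g (v, q', w))"
  by (simp add: path_algebra_def cuts_def)

lemma paths_append: "(u, q, v) \<in> paths G \<Longrightarrow> (v, q', w) \<in> paths G \<Longrightarrow> (u, q @ q', w) \<in> paths G"
  by (auto simp: paths_def)

lemma path_algebra_assoc:
  "((f \<otimes>\<^bsub>path_algebra G\<^esub> g) \<otimes>\<^bsub>path_algebra G\<^esub> h) = (f \<otimes>\<^bsub>path_algebra G\<^esub> (g \<otimes>\<^bsub>path_algebra G\<^esub> h))"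
proof
  fix r :: "('a, 'b) path"
  obtain u p w where r: "r = (u, p, w)" by (cases r)
  let ?L = "SIGMA c:cuts u p w. cuts u (fst c) (fst (snd c))"
  let ?R = "SIGMA c:cuts u p w. cuts (fst (snd c)) (snd (snd c)) w"
  have "((f \<otimes>\<^bsub>path_algebra G\<^esub> g) \<otimes>\<^bsub>path_algebra G\<^esub> h) (u, p, w)
     = (\<Sum>c\<in>cuts u p w. \<Sum>d\<in>cuts u (fst c) (fst (snd c)).
          f (u, fst d, fst (snd d)) * g (fst (snd d), snd (snd d), fst (snd c)) * h (fst (snd c), snd (snd c), w))"
    by (simp add: mult_path_algebra sum_distrib_right case_prod_beta)
  also have "\<dots> = (\<Sum>(c, d)\<in>?L. 
          f (u, fst d, fst (snd d)) * g (fst (snd d), snd (snd d), fst (snd c)) * h (fst (snd c), snd (snd c), w))"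
    by (rule sum.Sigma) (auto simp: finite_cuts)
  also have "\<dots> = (\<Sum>(c, d)\<in>?R. 
          f (u, fst c, fst (snd c)) * g (fst (snd c), fst d, fst (snd d)) * h (fst (snd d), snd (snd d), w))"
    by (rule sum.reindex_bij_witness[of _
         "\<lambda>((a, x, _), (b, y, c)). ((a @ b, y, c), (a, x, b))"
         "\<lambda>((_, y, c), (a, x, b)). ((a, x, b @ c), (b, y, c))"])
       (auto simp: cuts_def intro: paths_append)
  also have "\<dots> = (\<Sum>c\<in>cuts u p w. \<Sum>d\<in>cuts (fst (snd c)) (snd (snd c)) w.
          f (u, fst c, fst (snd c)) * g (fst (snd c), fst d, fst (snd d)) * h (fst (snd d), snd (snd d), w))"
    by (rule sum.Sigma[symmetric]) (auto simp: finite_cuts)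
  also have "\<dots> = (f \<otimes>\<^bsub>path_algebra G\<^esub> (g \<otimes>\<^bsub>path_algebra G\<^esub> h)) (u, p, w)"
    by (simp add: mult_path_algebra sum_distrib_left case_prod_beta mult.assoc)
  finally show "((f \<otimes>\<^bsub>path_algebra G\<^esub> g) \<otimes>\<^bsub>path_algebra G\<^esub> h) r = (f \<otimes>\<^bsub>path_algebra G\<^esub> (g \<otimes>\<^bsub>path_algebra G\<^esub> h)) r"
    by (simp add: r)
qed

lemma path_algebra_mult_closed:
  assumes "f \<in> carrier (path_algebra G)" "g \<in> carrier (path_algebra G)"
  shows "f \<otimes>\<^bsub>path_algebra G\<^esub> g \<in> carrier (path_algebra G)"
proof -
  let ?S = "(\<lambda>((u, q, _), (_, q', w)). (u, q @ q', w)) ` ({r. f r \<noteq> 0} \<times> {r. g r \<noteq> 0})"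
  have *: "r \<in> ?S \<inter> paths G" if "(f \<otimes>\<^bsub>path_algebra G\<^esub> g) r \<noteq> 0" for r
  proof -
    obtain u p w where r: "r = (u, p, w)" by (cases r)
    from that obtain c where "c \<in> cuts u p w" "(case c of (q, v, q') \<Rightarrow> f (u, q, v) * g (v, q', w)) \<noteq> 0"
      unfolding r mult_path_algebra by (meson sum.neutral)
    then obtain q v q' where "(q, v, q') \<in> cuts u p w" "f (u, q, v) \<noteq> 0" "g (v, q', w) \<noteq> 0"
      by (cases c) auto
    then show ?thesis
      by (force simp: r cuts_def intro: paths_append)
  qed
  have "finite ?S" using assms by (auto simp: path_algebra_def)
  then have "finite {r. (f \<otimes>\<^bsub>path_algebra G\<^esub> g) r \<noteq> 0}"
    by (rule finite_subset[rotated]) (use * in blast)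
  moreover have "{r. (f \<otimes>\<^bsub>path_algebra G\<^esub> g) r \<noteq> 0} \<subseteq> paths G" using * by blast
  ultimately show ?thesis by (simp add: path_algebra_def)
qed

lemma path_algebra_l_one:
  assumes "f \<in> carrier (path_algebra G)"
  shows "\<one>\<^bsub>path_algebra G\<^esub> \<otimes>\<^bsub>path_algebra G\<^esub> f = f"
proof
  fix r :: "('a, 'b) path"
  obtain u p w where r: "r = (u, p, w)" by (cases r)
  have "(\<one>\<^bsub>path_algebra G\<^esub> \<otimes>\<^bsub>path_algebra G\<^esub> f) r =
     (\<Sum>c \<in> cuts u p w. if c = ([], u, p) then f (u, p, w) else 0)"
    unfolding r mult_path_algebra
    by (rule sum.cong) (auto simp: path_algebra_def cuts_def paths_def awalk_Nil_iff split: if_splits)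
  also have "\<dots> = f r"
  proof -
    have "([], u, p) \<in> cuts u p w" if "f (u, p, w) \<noteq> 0"
      using assms that by (auto simp: path_algebra_def cuts_def paths_def awalk_Nil_iff)
    then show ?thesis
      by (auto simp: sum.delta[OF finite_cuts] r)
  qed
  finally show "(\<one>\<^bsub>path_algebra G\<^esub> \<otimes>\<^bsub>path_algebra G\<^esub> f) r = f r" .
qed

lemma path_algebra_r_one:
  assumes "f \<in> carrier (path_algebra G)"
  shows "f \<otimes>\<^bsub>path_algebra G\<^esub> \<one>\<^bsub>path_algebra G\<^esub> = f"
proof
  fix r :: "('a, 'b) path"
  obtain u p w where r: "r = (u, p, w)" by (cases r)
  have "(f \<otimes>\<^bsub>path_algebra G\<^esub> \<one>\<^bsub>path_algebra G\<^esub>) r =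
     (\<Sum>c \<in> cuts u p w. if c = (p, w, []) then f (u, p, w) else 0)"
    unfolding r mult_path_algebra
    by (rule sum.cong) (auto simp: path_algebra_def cuts_def paths_def awalk_Nil_iff split: if_splits)
  also have "\<dots> = f r"
  proof -
    have "(p, w, []) \<in> cuts u p w" if "f (u, p, w) \<noteq> 0"
      using assms that by (auto simp: path_algebra_def cuts_def paths_def awalk_Nil_iff)
    then show ?thesis
      by (auto simp: sum.delta[OF finite_cuts] r)
  qed
  finally show "(f \<otimes>\<^bsub>path_algebra G\<^esub> \<one>\<^bsub>path_algebra G\<^esub>) r = f r" .
qed

end

lemma (in fin_digraph) ring_path_algebra:
  "ring (path_algebra G :: (('a, 'b) path \<Rightarrow> 'k::field) ring)"
proof (intro ringI abelian_groupI monoidI)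
  fix f g h :: "('a, 'b) path \<Rightarrow> 'k"
  let ?A = "path_algebra G :: (('a, 'b) path \<Rightarrow> 'k) ring"
  assume f: "f \<in> carrier ?A"
  have fin: "finite {r. f' r \<noteq> 0}" "{r. f' r \<noteq> 0} \<subseteq> paths G" if "f' \<in> carrier ?A" for f'
    using that by (auto simp: path_algebra_def)
  { assume g: "g \<in> carrier ?A"
    have "{r. f r + g r \<noteq> 0} \<subseteq> {r. f r \<noteq> 0} \<union> {r. g r \<noteq> 0}" by auto
    then have "finite {r. f r + g r \<noteq> 0}" "{r. f r + g r \<noteq> 0} \<subseteq> paths G"
      using fin[OF f] fin[OF g] by (meson finite_UnI finite_subset, blast)
    then show "f \<oplus>\<^bsub>?A\<^esub> g \<in> carrier ?A"
      by (simp add: path_algebra_def) }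
  show "\<exists>y\<in>carrier ?A. y \<oplus>\<^bsub>?A\<^esub> f = \<zero>\<^bsub>?A\<^esub>"
    by (rule bexI[of _ "\<lambda>r. - f r"]) (use f in \<open>auto simp: path_algebra_def\<close>)
  show "(f \<oplus>\<^bsub>?A\<^esub> g) \<otimes>\<^bsub>?A\<^esub> h = f \<otimes>\<^bsub>?A\<^esub> h \<oplus>\<^bsub>?A\<^esub> g \<otimes>\<^bsub>?A\<^esub> h"
    by (simp add: path_algebra_def fun_eq_iff sum.distrib case_prod_beta distrib_right)
  show "h \<otimes>\<^bsub>?A\<^esub> (f \<oplus>\<^bsub>?A\<^esub> g) = h \<otimes>\<^bsub>?A\<^esub> f \<oplus>\<^bsub>?A\<^esub> h \<otimes>\<^bsub>?A\<^esub> g"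
    by (simp add: path_algebra_def fun_eq_iff sum.distrib case_prod_beta distrib_left)
next
  let ?A = "path_algebra G :: (('a, 'b) path \<Rightarrow> 'k) ring"
  let ?T = "(\<lambda>u. (u, [] :: 'b list, u)) ` verts G"
  have "{r. \<one>\<^bsub>?A\<^esub> r \<noteq> 0} \<subseteq> ?T"
    by (auto simp: path_algebra_def split: if_splits)
  moreover have "finite ?T" "?T \<subseteq> paths G" by (auto simp: paths_def awalk_Nil_iff)
  ultimately have "finite {r. \<one>\<^bsub>?A\<^esub> r \<noteq> 0} \<and> {r. \<one>\<^bsub>?A\<^esub> r \<noteq> 0} \<subseteq> paths G"
    by (meson finite_subset subset_trans)
  then show "\<one>\<^bsub>?A\<^esub> \<in> carrier ?A"
    by (simp add: path_algebra_def)
qed (simp_all add: path_algebra_assoc path_algebra_l_one path_algebra_r_one path_algebra_mult_closed,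
     auto simp: path_algebra_def)

text \<open>The arc \<open>i\<close> is the arrow from \<open>i\<close> to \<open>i + 1\<close>.\<close>

definition linear_quiver :: "nat \<Rightarrow> (nat, nat) pre_digraph" where
  "linear_quiver n = \<lparr>verts = {1..n}, arcs = {1..<n}, tail = (\<lambda>i. i), head = (\<lambda>i. i + 1)\<rparr>"

lemma fin_digraph_linear_quiver: "fin_digraph (linear_quiver n)"
  by unfold_locales (auto simp: linear_quiver_def)

end

theory Submission
  imports Defs
begin

text \<open>
  Every module over \<open>A\<^sub>n\<close> is a direct sum of interval modules \<open>[a, b]\<close>. If \<open>X\<close> is a strong generator then
  for every vertex \<open>i\<close> the simple module at \<open>i\<close> embeds in \<open>X\<close> and is a quotient of \<open>X\<close>, because having
  no such embedding (quotient) passes from \<open>X\<close> to all layers; hence \<open>X\<close> has a summand that ends at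
  \<open>i\<close> and one that starts at \<open>i\<close>. Given summands \<open>[g, b]\<close> and \<open>[b, d]\<close>, the interval \<open>[a, b]\<close> is an extension
  of \<open>[a, g - 1]\<close> by \<open>[g, b]\<close> if \<open>a \<le> g\<close>, and a summand of an extension of \<open>[g, b] \<oplus> [a, b - 1]\<close> by
  \<open>[b, d]\<close> if \<open>g < a\<close>. Induction on \<open>b\<close> puts \<open>[1, b]\<close> into layer \<open>b\<close> and \<open>[a, b]\<close> into layer \<open>b - a + 2\<close> for \<open>a > 1\<close>,
  so \<open>n\<close> layers suffice.

  The time \<open>n - m\<close> is attained by the sum of the simple modules and all \<open>[a, b]\<close> with \<open>b \<le> m\<close>: adding
  the vertices after \<open>m\<close> one at a time shows that \<open>n - m + 1\<close> layers suffice, and fewer do not, since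
  paths of length \<open>t\<close> starting at or after \<open>m\<close> annihilate layer \<open>t\<close> but not \<open>[1, n]\<close>.
\<close>

section \<open>Homomorphisms, submodules and finite generation\<close>

text \<open>The order of the factors in \<open>ext_product\<close> shapes the upper bound: every new
  layer glues a summand of copies of \<open>X\<close> on as a submodule. Arrows increase the vertex,
  so the submodules of an interval are its end pieces, and \<open>[a, b]\<close> can be built
  directly only on a summand of \<open>X\<close> that ends at \<open>b\<close>. If that summand is
  longer than \<open>[a, b]\<close>, it is no submodule of it; then the summand starting at
  \<open>b\<close> becomes the submodule, and \<open>[a, b]\<close> appears as one of two summands
  of the middle term. This detour costs one extra layer, which is affordable because it never
  happens for \<open>a = 1\<close>.

  The decomposition into intervals is an elimination: generators placed at single vertices give maps
  from intervals to the module, and each relation allows one interval to be shortened. The sum of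
  the end points decreases, so the process stops at an isomorphism.

  Layers live on one fixed type, whereas intervals and direct sums live on others. Therefore
  summands are treated as retracts, which compare modules on different types.\<close>

lemma rmod_homI:
  assumes "\<And>x. x \<in> carrier M \<Longrightarrow> f x \<in> carrier N"
    and "\<And>x y. x \<in> carrier M \<Longrightarrow> y \<in> carrier M \<Longrightarrow> f (x \<oplus>\<^bsub>M\<^esub> y) = f x \<oplus>\<^bsub>N\<^esub> f y"
    and "\<And>x a. x \<in> carrier M \<Longrightarrow> a \<in> carrier R \<Longrightarrow> f (x \<cdot>\<^bsub>M\<^esub> a) = f x \<cdot>\<^bsub>N\<^esub> a"
  shows "f \<in> rmod_hom R M N"
  using assms by (auto simp: rmod_hom_def)

lemma
  assumes "f \<in> rmod_hom R M N"
  shows rmod_hom_closed: "x \<in> carrier M \<Longrightarrow> f x \<in> carrier N"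
    and rmod_hom_add: "x \<in> carrier M \<Longrightarrow> y \<in> carrier M \<Longrightarrow> f (x \<oplus>\<^bsub>M\<^esub> y) = f x \<oplus>\<^bsub>N\<^esub> f y"
    and rmod_hom_ract: "x \<in> carrier M \<Longrightarrow> a \<in> carrier R \<Longrightarrow> f (x \<cdot>\<^bsub>M\<^esub> a) = f x \<cdot>\<^bsub>N\<^esub> a"
  using assms by (auto simp: rmod_hom_def)

context right_module
begin

lemma zero_ract: "a \<in> carrier R \<Longrightarrow> \<zero>\<^bsub>M\<^esub> \<cdot>\<^bsub>M\<^esub> a = \<zero>\<^bsub>M\<^esub>"
  by (metis M.add.r_cancel_one M.add.one_closed M.l_zero ract_add_left ract_closed)

lemma ract_zero: "x \<in> carrier M \<Longrightarrow> x \<cdot>\<^bsub>M\<^esub> \<zero>\<^bsub>R\<^esub> = \<zero>\<^bsub>M\<^esub>"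
  by (metis M.add.r_cancel_one R.zero_closed R.l_zero ract_add_right ract_closed)

text \<open>Homomorphisms and submodules are defined through sums and the action alone; writing
  negation as the action of -1 makes them respect differences too.\<close>

lemma minus_eq_ract: "x \<in> carrier M \<Longrightarrow> \<ominus>\<^bsub>M\<^esub> x = x \<cdot>\<^bsub>M\<^esub> (\<ominus>\<^bsub>R\<^esub> \<one>\<^bsub>R\<^esub>)"
  by (metis M.minus_equality R.a_inv_closed R.l_neg R.one_closed ract_add_right ract_closed
      ract_one ract_zero)

lemma finsum_ract:
  assumes "finite A" "f \<in> A \<rightarrow> carrier M" "a \<in> carrier R"
  shows "(\<Oplus>\<^bsub>M\<^esub>i\<in>A. f i) \<cdot>\<^bsub>M\<^esub> a = (\<Oplus>\<^bsub>M\<^esub>i\<in>A. f i \<cdot>\<^bsub>M\<^esub> a)"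
  using assms by (induction A rule: finite_induct)
    (auto simp: zero_ract ract_add_left ract_closed Pi_iff)

end

lemma rmod_hom_zero:
  assumes "right_module R M" "right_module R N" "f \<in> rmod_hom R M N"
  shows "f \<zero>\<^bsub>M\<^esub> = \<zero>\<^bsub>N\<^esub>"
proof -
  interpret M: right_module R M by fact
  interpret N: right_module R N by fact
  have "f \<zero>\<^bsub>M\<^esub> = f (\<zero>\<^bsub>M\<^esub> \<cdot>\<^bsub>M\<^esub> \<zero>\<^bsub>R\<^esub>)" by (simp add: M.ract_zero)
  then show ?thesis
    using rmod_hom_closed[OF assms(3)] by (simp add: rmod_hom_ract[OF assms(3)] N.ract_zero)
qed

lemma rmod_hom_minus:
  assumes "right_module R M" "right_module R N" "f \<in> rmod_hom R M N"
    and "x \<in> carrier M" "y \<in> carrier M"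
  shows "f (x \<ominus>\<^bsub>M\<^esub> y) = f x \<ominus>\<^bsub>N\<^esub> f y"
proof -
  interpret M: right_module R M by fact
  interpret N: right_module R N by fact
  have "f (\<ominus>\<^bsub>M\<^esub> y) = \<ominus>\<^bsub>N\<^esub> f y"
    using assms by (simp add: M.minus_eq_ract N.minus_eq_ract rmod_hom_ract[OF assms(3)]
        rmod_hom_closed[OF assms(3)])
  then show ?thesis
    using assms by (simp add: a_minus_def rmod_hom_add[OF assms(3)])
qed

lemma rmod_hom_id: "(\<lambda>x. x) \<in> rmod_hom R M M"
  by (simp add: rmod_hom_def)

lemma rmod_hom_comp:
  "f \<in> rmod_hom R L M \<Longrightarrow> g \<in> rmod_hom R M N \<Longrightarrow> (\<lambda>x. g (f x)) \<in> rmod_hom R L N"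
  by (auto simp: rmod_hom_def Pi_iff)

lemma rmod_hom_inv_into:
  assumes M: "right_module R M" and f: "f \<in> rmod_hom R M N"
    and bij: "bij_betw f (carrier M) (carrier N)"
  shows "inv_into (carrier M) f \<in> rmod_hom R N M"
proof -
  interpret M: right_module R M by fact
  let ?g = "inv_into (carrier M) f"
  have g: "?g y \<in> carrier M" "f (?g y) = y" if "y \<in> carrier N" for y
    using bij that by (metis bij_betw_imp_surj_on inv_into_into, metis bij_betw_inv_into_right)
  have gf: "?g (f x) = x" if "x \<in> carrier M" for x
    using bij that by (rule bij_betw_inv_into_left)
  show ?thesis
  proof (rule rmod_homI)
    fix x y assume "x \<in> carrier N" "y \<in> carrier N"
    then show "?g (x \<oplus>\<^bsub>N\<^esub> y) = ?g x \<oplus>\<^bsub>M\<^esub> ?g y"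
      using gf[of "?g x \<oplus>\<^bsub>M\<^esub> ?g y"] g by (simp add: rmod_hom_add[OF f])
  next
    fix x a assume "x \<in> carrier N" "a \<in> carrier R"
    then show "?g (x \<cdot>\<^bsub>N\<^esub> a) = ?g x \<cdot>\<^bsub>M\<^esub> a"
      using gf[of "?g x \<cdot>\<^bsub>M\<^esub> a"] g by (simp add: rmod_hom_ract[OF f] M.ract_closed)
  qed (rule g)
qed

text \<open>Closure under negation comes from the action of -1, see
  \<open>rsubmodule_minus\<close>.\<close>

definition rsubmodule :: "('a, 'r) ring_scheme \<Rightarrow> ('a, 'b) rmodule \<Rightarrow> 'b set \<Rightarrow> bool" where
  "rsubmodule R M T \<longleftrightarrow> T \<subseteq> carrier M \<and> \<zero>\<^bsub>M\<^esub> \<in> T \<and>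
    (\<forall>x\<in>T. \<forall>y\<in>T. x \<oplus>\<^bsub>M\<^esub> y \<in> T) \<and> (\<forall>x\<in>T. \<forall>a\<in>carrier R. x \<cdot>\<^bsub>M\<^esub> a \<in> T)"

lemma rsubmodule_finsum:
  assumes "right_module R M" "rsubmodule R M T" "finite A" "f \<in> A \<rightarrow> T"
  shows "(\<Oplus>\<^bsub>M\<^esub>i\<in>A. f i) \<in> T"
proof -
  interpret M: right_module R M by fact
  show ?thesis
    using assms(3,4,2)
  proof (induction A rule: finite_induct)
    case empty then show ?case by (simp add: rsubmodule_def)
  next
    case (insert i A)
    then have "f i \<in> carrier M" "f \<in> A \<rightarrow> carrier M" by (auto simp: rsubmodule_def)
    with insert show ?case by (simp add: rsubmodule_def)
  qed
qed

lemma rsubmodule_minus: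
  assumes "right_module R M" "rsubmodule R M T" "x \<in> T" "y \<in> T"
  shows "x \<ominus>\<^bsub>M\<^esub> y \<in> T"
proof -
  interpret M: right_module R M by fact
  have "\<ominus>\<^bsub>M\<^esub> y = y \<cdot>\<^bsub>M\<^esub> (\<ominus>\<^bsub>R\<^esub> \<one>\<^bsub>R\<^esub>)"
    using assms by (intro M.minus_eq_ract) (auto simp: rsubmodule_def)
  then show ?thesis
    using assms by (simp add: a_minus_def rsubmodule_def)
qed

lemma rsubmodule_vimage:
  assumes M: "right_module R M" and N: "right_module R N" and f: "f \<in> rmod_hom R M N"
    and T: "rsubmodule R N T"
  shows "rsubmodule R M {x \<in> carrier M. f x \<in> T}"
proof -
  interpret M: right_module R M by fact
  show ?thesis
    using T by (auto simp: rsubmodule_def rmod_hom_zero[OF M N f] rmod_hom_add[OF f]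
        rmod_hom_ract[OF f] M.ract_closed)
qed

lemma rsubmodule_image:
  assumes M: "right_module R M" and N: "right_module R N" and f: "f \<in> rmod_hom R M N"
  shows "rsubmodule R N (f ` carrier M)"
proof -
  interpret M: right_module R M by fact
  show ?thesis
    unfolding rsubmodule_def
    by (auto simp: rmod_hom_closed[OF f] rmod_hom_add[OF f, symmetric]
        rmod_hom_ract[OF f, symmetric] rmod_hom_zero[OF M N f, symmetric] M.ract_closed)
qed

text \<open>This form avoids linear combinations: later arguments only pull a submodule back along a
  homomorphism and ask whether it contains the generators.\<close>

lemma finitely_generated_iff:
  fixes M :: "('a, 'b) rmodule"
  assumes M: "right_module R M"
  shows "finitely_generated R M \<longleftrightarrow>
    (\<exists>S. finite S \<and> S \<subseteq> carrier M \<and> (\<forall>T. rsubmodule R M T \<longrightarrow> S \<subseteq> T \<longrightarrow> carrier M \<subseteq> T))"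
    (is "?L \<longleftrightarrow> ?Q")
proof
  interpret M: right_module R M by fact
  assume ?L
  then obtain S where S: "finite S" "S \<subseteq> carrier M"
    and gen: "\<forall>x \<in> carrier M. \<exists>c \<in> S \<rightarrow> carrier R. x = (\<Oplus>\<^bsub>M\<^esub>s\<in>S. s \<cdot>\<^bsub>M\<^esub> c s)"
    unfolding finitely_generated_def by blast
  have "carrier M \<subseteq> T" if T: "rsubmodule R M T" "S \<subseteq> T" for T
  proof
    fix x assume "x \<in> carrier M"
    then obtain c where c: "c \<in> S \<rightarrow> carrier R" "x = (\<Oplus>\<^bsub>M\<^esub>s\<in>S. s \<cdot>\<^bsub>M\<^esub> c s)" using gen by blast
    have "(\<lambda>s. s \<cdot>\<^bsub>M\<^esub> c s) \<in> S \<rightarrow> T" using T c(1) by (auto simp: rsubmodule_def Pi_iff subset_iff)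
    then show "x \<in> T" using rsubmodule_finsum[OF M T(1) S(1)] c(2) by simp
  qed
  with S show ?Q by blast
next
  interpret M: right_module R M by fact
  assume ?Q
  then obtain S where S: "finite S" "S \<subseteq> carrier M"
    and gen: "\<And>T. rsubmodule R M T \<Longrightarrow> S \<subseteq> T \<Longrightarrow> carrier M \<subseteq> T" by blast
  \<comment> \<open>The set of all linear combinations is itself a submodule containing
    \<open>S\<close>, hence everything.\<close>
  define T where "T = {(\<Oplus>\<^bsub>M\<^esub>s\<in>S. s \<cdot>\<^bsub>M\<^esub> c s) | c. c \<in> S \<rightarrow> carrier R}"
  have cl: "(\<lambda>s. s \<cdot>\<^bsub>M\<^esub> c s) \<in> S \<rightarrow> carrier M" if "c \<in> S \<rightarrow> carrier R" for c
    using S that by (auto intro!: M.ract_closed)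
  have "rsubmodule R M T"
    unfolding rsubmodule_def
  proof (intro conjI ballI subsetI)
    fix x assume "x \<in> T" then show "x \<in> carrier M"
      using cl by (auto simp: T_def)
  next
    have "(\<Oplus>\<^bsub>M\<^esub>s\<in>S. s \<cdot>\<^bsub>M\<^esub> \<zero>\<^bsub>R\<^esub>) = (\<Oplus>\<^bsub>M\<^esub>s\<in>S. \<zero>\<^bsub>M\<^esub>)"
      by (rule M.M.finsum_cong') (use S in \<open>auto simp: M.ract_zero\<close>)
    then show "\<zero>\<^bsub>M\<^esub> \<in> T"
      unfolding T_def by (auto intro!: exI[of _ "\<lambda>_. \<zero>\<^bsub>R\<^esub>"])
  next
    fix x y assume "x \<in> T" "y \<in> T"
    then obtain c d where c: "c \<in> S \<rightarrow> carrier R" "x = (\<Oplus>\<^bsub>M\<^esub>s\<in>S. s \<cdot>\<^bsub>M\<^esub> c s)"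
      and d: "d \<in> S \<rightarrow> carrier R" "y = (\<Oplus>\<^bsub>M\<^esub>s\<in>S. s \<cdot>\<^bsub>M\<^esub> d s)" by (auto simp: T_def)
    have "x \<oplus>\<^bsub>M\<^esub> y = (\<Oplus>\<^bsub>M\<^esub>s\<in>S. s \<cdot>\<^bsub>M\<^esub> c s \<oplus>\<^bsub>M\<^esub> s \<cdot>\<^bsub>M\<^esub> d s)"
      by (simp add: c d cl)
    also have "\<dots> = (\<Oplus>\<^bsub>M\<^esub>s\<in>S. s \<cdot>\<^bsub>M\<^esub> (c s \<oplus>\<^bsub>R\<^esub> d s))"
      by (rule M.M.finsum_cong') (use S c d in \<open>auto simp: M.ract_add_right Pi_iff intro!: M.ract_closed\<close>)
    finally show "x \<oplus>\<^bsub>M\<^esub> y \<in> T"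
      using c d unfolding T_def by (auto intro!: exI[of _ "\<lambda>s. c s \<oplus>\<^bsub>R\<^esub> d s"])
  next
    fix x a assume "x \<in> T" and a: "a \<in> carrier R"
    then obtain c where c: "c \<in> S \<rightarrow> carrier R" "x = (\<Oplus>\<^bsub>M\<^esub>s\<in>S. s \<cdot>\<^bsub>M\<^esub> c s)" by (auto simp: T_def)
    have "x \<cdot>\<^bsub>M\<^esub> a = (\<Oplus>\<^bsub>M\<^esub>s\<in>S. s \<cdot>\<^bsub>M\<^esub> c s \<cdot>\<^bsub>M\<^esub> a)"
      by (simp add: c M.finsum_ract S cl a)
    also have "\<dots> = (\<Oplus>\<^bsub>M\<^esub>s\<in>S. s \<cdot>\<^bsub>M\<^esub> (c s \<otimes>\<^bsub>R\<^esub> a))"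
      by (rule M.M.finsum_cong') (use S c a in \<open>auto simp: M.ract_mult Pi_iff subset_iff intro!: M.ract_closed\<close>)
    finally show "x \<cdot>\<^bsub>M\<^esub> a \<in> T"
      using c a unfolding T_def by (auto intro!: exI[of _ "\<lambda>s. c s \<otimes>\<^bsub>R\<^esub> a"])
  qed
  moreover have "S \<subseteq> T"
  proof
    fix s assume s: "s \<in> S"
    \<comment> \<open>The coefficients of the trivial combination that yields
      \<open>s\<close>.\<close>
    let ?c = "\<lambda>t. if t = s then \<one>\<^bsub>R\<^esub> else \<zero>\<^bsub>R\<^esub>"
    have "(\<Oplus>\<^bsub>M\<^esub>t\<in>S. t \<cdot>\<^bsub>M\<^esub> ?c t) = (\<Oplus>\<^bsub>M\<^esub>t\<in>S. if s = t then t else \<zero>\<^bsub>M\<^esub>)"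
      by (rule M.M.finsum_cong') (use S in \<open>auto simp: M.ract_zero M.ract_one subset_iff\<close>)
    also have "\<dots> = s"
      using M.M.finsum_singleton[OF s S(1), of "\<lambda>t. t"] S by auto
    finally show "s \<in> T"
      unfolding T_def by (auto intro!: exI[of _ ?c])
  qed
  ultimately have "carrier M \<subseteq> T" by (rule gen)
  with S show ?L unfolding finitely_generated_def T_def by (intro exI[of _ S]) auto
qed

lemma finitely_generated_surj:
  fixes M :: "('a, 'b) rmodule" and N :: "('a, 'c) rmodule"
  assumes M: "right_module R M" and N: "right_module R N" and f: "f \<in> rmod_hom R M N"
    and surj: "f ` carrier M = carrier N" and fg: "finitely_generated R M"
  shows "finitely_generated R N"
proof -
  obtain S where S: "finite S" "S \<subseteq> carrier M"
    and gen: "\<And>T. rsubmodule R M T \<Longrightarrow> S \<subseteq> T \<Longrightarrow> carrier M \<subseteq> T"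
    using fg unfolding finitely_generated_iff[OF M] by blast
  have "carrier N \<subseteq> T" if T: "rsubmodule R N T" "f ` S \<subseteq> T" for T
  proof -
    have "carrier M \<subseteq> {x \<in> carrier M. f x \<in> T}"
      by (rule gen[OF rsubmodule_vimage[OF M N f T(1)]]) (use S(2) T(2) in auto)
    then show ?thesis unfolding surj[symmetric] by auto
  qed
  moreover have "f ` S \<subseteq> carrier N" using S(2) surj by blast
  ultimately show ?thesis
    unfolding finitely_generated_iff[OF N] using S(1) by (intro exI[of _ "f ` S"]) blast
qed

section \<open>Direct sums and retracts\<close>

lemma direct_sum_Nil:
  "carrier (direct_sum []) = {[]}" "\<zero>\<^bsub>direct_sum []\<^esub> = []"
  by (auto simp: direct_sum_def)

lemma zero_direct_sum_Cons: "\<zero>\<^bsub>direct_sum (M # Ms)\<^esub> = \<zero>\<^bsub>M\<^esub> # \<zero>\<^bsub>direct_sum Ms\<^esub>"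
  by (simp add: direct_sum_def)

lemma carrier_direct_sum_Cons:
  "carrier (direct_sum (M # Ms)) = {x # xs | x xs. x \<in> carrier M \<and> xs \<in> carrier (direct_sum Ms)}"
  by (auto simp: direct_sum_def list_all2_Cons2)

lemma add_direct_sum_Cons:
  "(x # xs) \<oplus>\<^bsub>direct_sum (M # Ms)\<^esub> (y # ys) = (x \<oplus>\<^bsub>M\<^esub> y) # (xs \<oplus>\<^bsub>direct_sum Ms\<^esub> ys)"
  by (auto simp: direct_sum_def upt_conv_Cons map_Suc_upt[symmetric] simp del: upt_Suc)

lemma ract_direct_sum_Cons:
  "(x # xs) \<cdot>\<^bsub>direct_sum (M # Ms)\<^esub> a = (x \<cdot>\<^bsub>M\<^esub> a) # (xs \<cdot>\<^bsub>direct_sum Ms\<^esub> a)"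
  by (auto simp: direct_sum_def upt_conv_Cons map_Suc_upt[symmetric] simp del: upt_Suc)

lemmas direct_sum_Cons =
  zero_direct_sum_Cons carrier_direct_sum_Cons add_direct_sum_Cons ract_direct_sum_Cons

lemma length_direct_sum: "xs \<in> carrier (direct_sum Ms) \<Longrightarrow> length xs = length Ms"
  by (auto simp: direct_sum_def list_all2_lengthD)

lemma add_direct_sum_Nil: "xs \<oplus>\<^bsub>direct_sum []\<^esub> ys = []"
  by (simp add: direct_sum_def)

lemma ract_direct_sum_Nil: "xs \<cdot>\<^bsub>direct_sum []\<^esub> a = []"
  by (simp add: direct_sum_def)

lemma append_in_direct_sum:
  "length xs = length Ms \<Longrightarrow> xs @ ys \<in> carrier (direct_sum (Ms @ Ns)) \<longleftrightarrow>
    xs \<in> carrier (direct_sum Ms) \<and> ys \<in> carrier (direct_sum Ns)"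
  by (auto simp: direct_sum_def list_all2_append)

lemma add_direct_sum_append:
  assumes "length xs = length ys" "length ys = length Ms"
  shows "(xs @ xs') \<oplus>\<^bsub>direct_sum (Ms @ Ns)\<^esub> (ys @ ys') =
    (xs \<oplus>\<^bsub>direct_sum Ms\<^esub> ys) @ (xs' \<oplus>\<^bsub>direct_sum Ns\<^esub> ys')"
  using assms by (induction xs ys Ms rule: list_induct3)
    (auto simp: add_direct_sum_Cons add_direct_sum_Nil)

lemma ract_direct_sum_append:
  assumes "length xs = length Ms"
  shows "(xs @ xs') \<cdot>\<^bsub>direct_sum (Ms @ Ns)\<^esub> a =
    (xs \<cdot>\<^bsub>direct_sum Ms\<^esub> a) @ (xs' \<cdot>\<^bsub>direct_sum Ns\<^esub> a)"
  using assms by (induction xs Ms rule: list_induct2)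
    (auto simp: ract_direct_sum_Cons ract_direct_sum_Nil)

text \<open>The generators of the head and of the tail, padded by zero, suffice: a submodule
  containing them pulls back along the two injections to the whole of each part.\<close>

lemma finitely_generated_direct_sum:
  assumes R: "ring R" and Ms: "\<And>M. M \<in> set Ms \<Longrightarrow> right_module R M \<and> finitely_generated R M"
  shows "finitely_generated R (direct_sum Ms)"
  using Ms
proof (induction Ms)
  case Nil
  have "right_module R (direct_sum [])" by (rule right_module_direct_sum) (use R in auto)
  then show ?case
    by (subst finitely_generated_iff) (auto simp: direct_sum_Nil rsubmodule_def intro!: exI[of _ "{}"])
next
  case (Cons M Ms)
  have M: "right_module R M" "finitely_generated R M" using Cons.prems by auto
  have D: "right_module R (direct_sum Ms)" by (rule right_module_direct_sum) (use R Cons.prems in auto)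
  have D': "right_module R (direct_sum (M # Ms))"
    by (rule right_module_direct_sum) (use R Cons.prems in auto)
  have IH: "finitely_generated R (direct_sum Ms)" using Cons by simp
  interpret M: right_module R M by (rule M)
  interpret D: right_module R "direct_sum Ms" by (rule D)
  have h1: "(\<lambda>x. x # \<zero>\<^bsub>direct_sum Ms\<^esub>) \<in> rmod_hom R M (direct_sum (M # Ms))"
    by (rule rmod_homI) (auto simp: direct_sum_Cons D.zero_ract)
  have h2: "(\<lambda>xs. \<zero>\<^bsub>M\<^esub> # xs) \<in> rmod_hom R (direct_sum Ms) (direct_sum (M # Ms))"
    by (rule rmod_homI) (auto simp: direct_sum_Cons M.zero_ract)
  obtain S where S: "finite S" "S \<subseteq> carrier M"
    and genS: "\<And>T. rsubmodule R M T \<Longrightarrow> S \<subseteq> T \<Longrightarrow> carrier M \<subseteq> T"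
    using M(2) unfolding finitely_generated_iff[OF M(1)] by blast
  obtain S' where S': "finite S'" "S' \<subseteq> carrier (direct_sum Ms)"
    and genS': "\<And>T. rsubmodule R (direct_sum Ms) T \<Longrightarrow> S' \<subseteq> T \<Longrightarrow> carrier (direct_sum Ms) \<subseteq> T"
    using IH unfolding finitely_generated_iff[OF D] by blast
  let ?S = "(\<lambda>x. x # \<zero>\<^bsub>direct_sum Ms\<^esub>) ` S \<union> (\<lambda>xs. \<zero>\<^bsub>M\<^esub> # xs) ` S'"
  have "carrier (direct_sum (M # Ms)) \<subseteq> T"
    if T: "rsubmodule R (direct_sum (M # Ms)) T" "?S \<subseteq> T" for T
  proof
    fix z assume "z \<in> carrier (direct_sum (M # Ms))"
    then obtain x xs where z: "z = x # xs" "x \<in> carrier M" "xs \<in> carrier (direct_sum Ms)"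
      by (auto simp: direct_sum_Cons)
    have "x # \<zero>\<^bsub>direct_sum Ms\<^esub> \<in> T"
    proof -
      have "carrier M \<subseteq> {x \<in> carrier M. x # \<zero>\<^bsub>direct_sum Ms\<^esub> \<in> T}"
        by (rule genS[OF rsubmodule_vimage[OF M(1) D' h1 T(1)]]) (use S(2) T(2) in auto)
      then show ?thesis using z(2) by auto
    qed
    moreover have "\<zero>\<^bsub>M\<^esub> # xs \<in> T"
    proof -
      have "carrier (direct_sum Ms) \<subseteq> {xs \<in> carrier (direct_sum Ms). \<zero>\<^bsub>M\<^esub> # xs \<in> T}"
        by (rule genS'[OF rsubmodule_vimage[OF D D' h2 T(1)]]) (use S'(2) T(2) in auto)
      then show ?thesis using z(3) by auto
    qed
    moreover have "z = (x # \<zero>\<^bsub>direct_sum Ms\<^esub>) \<oplus>\<^bsub>direct_sum (M # Ms)\<^esub> (\<zero>\<^bsub>M\<^esub> # xs)"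
      using z by (simp add: direct_sum_Cons)
    ultimately show "z \<in> T" using T(1) by (auto simp: rsubmodule_def)
  qed
  moreover have "?S \<subseteq> carrier (direct_sum (M # Ms))"
    using S S' by (auto simp: direct_sum_Cons)
  ultimately show ?case
    unfolding finitely_generated_iff[OF D'] using S(1) S'(1) by (intro exI[of _ ?S]) blast
qed

text \<open>Being a direct summand without naming a complement. The two modules may have different
  types, and the relation composes, unlike the isomorphism in \<open>add_closure\<close>.\<close>

definition rmod_retract ::
  "('a, 'r) ring_scheme \<Rightarrow> ('a, 'b) rmodule \<Rightarrow> ('a, 'c) rmodule \<Rightarrow> bool" where
  "rmod_retract R M N \<longleftrightarrow>
    (\<exists>i \<in> rmod_hom R M N. \<exists>p \<in> rmod_hom R N M. \<forall>x \<in> carrier M. p (i x) = x)"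

lemma rmod_retract_refl: "rmod_retract R M M"
  unfolding rmod_retract_def using rmod_hom_id by fastforce

lemma rmod_retract_trans:
  assumes "rmod_retract R L M" "rmod_retract R M N" shows "rmod_retract R L N"
proof -
  obtain i p where i: "i \<in> rmod_hom R L M" "p \<in> rmod_hom R M L" "\<forall>x \<in> carrier L. p (i x) = x"
    using assms(1) by (auto simp: rmod_retract_def)
  obtain j q where j: "j \<in> rmod_hom R M N" "q \<in> rmod_hom R N M" "\<forall>x \<in> carrier M. q (j x) = x"
    using assms(2) by (auto simp: rmod_retract_def)
  show ?thesis
    unfolding rmod_retract_def
    by (intro bexI[OF _ rmod_hom_comp[OF i(1) j(1)]] bexI[OF _ rmod_hom_comp[OF j(2) i(2)]])
      (use i j rmod_hom_closed[OF i(1)] in auto)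
qed

lemma rmod_isomorphic_imp_retract:
  assumes M: "right_module R M" and iso: "rmod_isomorphic R M N"
  shows "rmod_retract R M N" "rmod_retract R N M"
proof -
  obtain f where f: "f \<in> rmod_hom R M N" "bij_betw f (carrier M) (carrier N)"
    using iso by (auto simp: rmod_isomorphic_def)
  note g = rmod_hom_inv_into[OF M f]
  show "rmod_retract R M N"
    unfolding rmod_retract_def using f g bij_betw_inv_into_left[OF f(2)] by blast
  show "rmod_retract R N M"
    unfolding rmod_retract_def using f g bij_betw_inv_into_right[OF f(2)] by blast
qed

lemma rmod_retract_finitely_generated:
  assumes "right_module R M" "right_module R N" "rmod_retract R M N" "finitely_generated R N"
  shows "finitely_generated R M"
proof -
  obtain i p where i: "i \<in> rmod_hom R M N" "p \<in> rmod_hom R N M" "\<forall>x \<in> carrier M. p (i x) = x"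
    using assms(3) by (auto simp: rmod_retract_def)
  have "p ` carrier N = carrier M"
    using rmod_hom_closed[OF i(1)] rmod_hom_closed[OF i(2)] i(3) by (force simp: image_def)
  then show ?thesis using finitely_generated_surj[OF assms(2,1) i(2)] assms(4) by blast
qed

lemma rmod_retract_direct_sum_member:
  assumes R: "ring R" and Ms: "\<And>M. M \<in> set Ms \<Longrightarrow> right_module R M" and M: "M \<in> set Ms"
  shows "rmod_retract R M (direct_sum Ms)"
  using Ms M
proof (induction Ms)
  case (Cons N Ms)
  have N: "right_module R N" using Cons.prems by auto
  have D: "right_module R (direct_sum Ms)" by (rule right_module_direct_sum) (use R Cons.prems in auto)
  interpret N: right_module R N by (rule N)
  interpret D: right_module R "direct_sum Ms" by (rule D)
  have h1: "(\<lambda>x. x # \<zero>\<^bsub>direct_sum Ms\<^esub>) \<in> rmod_hom R N (direct_sum (N # Ms))"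
    by (rule rmod_homI) (auto simp: direct_sum_Cons D.zero_ract)
  have h2: "(\<lambda>xs. \<zero>\<^bsub>N\<^esub> # xs) \<in> rmod_hom R (direct_sum Ms) (direct_sum (N # Ms))"
    by (rule rmod_homI) (auto simp: direct_sum_Cons N.zero_ract)
  have p1: "hd \<in> rmod_hom R (direct_sum (N # Ms)) N"
    by (rule rmod_homI) (auto simp: direct_sum_Cons)
  have p2: "tl \<in> rmod_hom R (direct_sum (N # Ms)) (direct_sum Ms)"
    by (rule rmod_homI) (auto simp: direct_sum_Cons)
  show ?case
  proof (cases "M = N")
    case True
    then show ?thesis unfolding rmod_retract_def by (auto intro!: bexI[OF _ h1] bexI[OF _ p1])
  next
    case False
    then have "rmod_retract R M (direct_sum Ms)" using Cons by auto
    moreover have "rmod_retract R (direct_sum Ms) (direct_sum (N # Ms))"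
      unfolding rmod_retract_def by (auto intro!: bexI[OF _ h2] bexI[OF _ p2])
    ultimately show ?thesis by (rule rmod_retract_trans)
  qed
qed simp

text \<open>This makes additive closures closed under finite direct sums. The embeddings and the
  retractions are combined block by block, cutting a list after \<open>length Us\<close>
  entries.\<close>

lemma rmod_retract_direct_sum_concat:
  assumes R: "ring R"
    and "\<And>M. M \<in> set Ms \<Longrightarrow> right_module R M \<and> (\<exists>Us. set Us \<subseteq> W \<and> rmod_retract R M (direct_sum Us))"
  shows "\<exists>Us. set Us \<subseteq> W \<and> rmod_retract R (direct_sum Ms) (direct_sum Us)"
  using assms(2)
proof (induction Ms)
  case Nil
  have "rmod_retract R (direct_sum []) (direct_sum [])"
    unfolding rmod_retract_def
    by (rule bexI[of _ "\<lambda>_. []"], rule bexI[of _ "\<lambda>_. []"])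
      (auto intro!: rmod_homI simp: direct_sum_Nil add_direct_sum_Nil ract_direct_sum_Nil)
  then show ?case by (intro exI[of _ "[]"]) auto
next
  case (Cons M Ms)
  obtain Us Vs where U: "set Us \<subseteq> W" "rmod_retract R M (direct_sum Us)"
    and V: "set Vs \<subseteq> W" "rmod_retract R (direct_sum Ms) (direct_sum Vs)"
    using Cons by (metis list.set_intros(1,2))
  obtain i p where i: "i \<in> rmod_hom R M (direct_sum Us)" "p \<in> rmod_hom R (direct_sum Us) M"
      "\<forall>x \<in> carrier M. p (i x) = x"
    using U(2) by (auto simp: rmod_retract_def)
  obtain j q where j: "j \<in> rmod_hom R (direct_sum Ms) (direct_sum Vs)"
      "q \<in> rmod_hom R (direct_sum Vs) (direct_sum Ms)" "\<forall>x \<in> carrier (direct_sum Ms). q (j x) = x"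
    using V(2) by (auto simp: rmod_retract_def)
  note cl = rmod_hom_closed[OF i(1)] rmod_hom_closed[OF i(2)] rmod_hom_closed[OF j(1)]
    rmod_hom_closed[OF j(2)]
  note len = length_direct_sum[OF cl(1)]
  define k where "k = (\<lambda>xs. i (hd xs) @ j (tl xs))"
  define r where "r = (\<lambda>zs. p (take (length Us) zs) # q (drop (length Us) zs))"
  have k: "k \<in> rmod_hom R (direct_sum (M # Ms)) (direct_sum (Us @ Vs))"
    by (rule rmod_homI)
      (auto simp: k_def direct_sum_Cons append_in_direct_sum len cl rmod_hom_add[OF i(1)]
        rmod_hom_add[OF j(1)] rmod_hom_ract[OF i(1)] rmod_hom_ract[OF j(1)]
        add_direct_sum_append ract_direct_sum_append)
  have decomp: "\<exists>xs ys. zs = xs @ ys \<and> xs \<in> carrier (direct_sum Us) \<and> ys \<in> carrier (direct_sum Vs)"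
    if "zs \<in> carrier (direct_sum (Us @ Vs))" for zs
  proof -
    have "length zs = length Us + length Vs" using length_direct_sum[OF that] by simp
    then show ?thesis
      using that append_in_direct_sum[of "take (length Us) zs" Us "drop (length Us) zs" Vs]
      by (intro exI[of _ "take (length Us) zs"] exI[of _ "drop (length Us) zs"]) auto
  qed
  have DU: "length (xs \<oplus>\<^bsub>direct_sum Us\<^esub> ys) = length Us" "length (xs \<cdot>\<^bsub>direct_sum Us\<^esub> a) = length Us" for xs ys a
    by (auto simp: direct_sum_def)
  have r: "r \<in> rmod_hom R (direct_sum (Us @ Vs)) (direct_sum (M # Ms))"
    by (rule rmod_homI)
      (auto dest!: decomp simp: r_def direct_sum_Cons length_direct_sum cl rmod_hom_add[OF i(2)]
        rmod_hom_add[OF j(2)] rmod_hom_ract[OF i(2)] rmod_hom_ract[OF j(2)] DU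
        add_direct_sum_append ract_direct_sum_append)
  have "\<forall>x \<in> carrier (direct_sum (M # Ms)). r (k x) = x"
    using i(3) j(3) by (auto simp: r_def k_def direct_sum_Cons len)
  then have "rmod_retract R (direct_sum (M # Ms)) (direct_sum (Us @ Vs))"
    unfolding rmod_retract_def using k r by blast
  then show ?case using U(1) V(1) by (intro exI[of _ "Us @ Vs"]) auto
qed

section \<open>Layers\<close>

lemma right_module_submodule:
  assumes M: "right_module R M" and T: "rsubmodule R M T"
  shows "right_module R (M\<lparr>carrier := T\<rparr>)"
proof -
  interpret M: right_module R M by fact
  have T': "x \<in> T \<Longrightarrow> x \<in> carrier M" for x using T by (auto simp: rsubmodule_def)
  have "abelian_group (M\<lparr>carrier := T\<rparr>)"
  proof (rule abelian_groupI)
    fix x assume "x \<in> carrier (M\<lparr>carrier := T\<rparr>)"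
    then show "\<exists>y\<in>carrier (M\<lparr>carrier := T\<rparr>). y \<oplus>\<^bsub>M\<lparr>carrier := T\<rparr>\<^esub> x = \<zero>\<^bsub>M\<lparr>carrier := T\<rparr>\<^esub>"
      using T by (intro bexI[of _ "\<ominus>\<^bsub>M\<^esub> x"])
        (auto simp: M.M.l_neg T' M.minus_eq_ract rsubmodule_def, simp add: M.minus_eq_ract[symmetric] T' M.M.l_neg subset_iff)
  qed (use T in \<open>auto simp: rsubmodule_def T' M.M.a_ac\<close>)
  then show ?thesis
    by (intro right_module.intro right_module_axioms.intro M.R.ring_axioms)
      (use T in \<open>auto simp: rsubmodule_def T' M.ract_add_left M.ract_add_right M.ract_mult M.ract_one\<close>)
qed

lemma carrier_direct_sum_pair:
  "carrier (direct_sum [M, N]) = {[x, y] | x y. x \<in> carrier M \<and> y \<in> carrier N}"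
  by (auto simp: direct_sum_Cons direct_sum_Nil)

lemma direct_sum_pair:
  "[x, y] \<oplus>\<^bsub>direct_sum [M, N]\<^esub> [x', y'] = [x \<oplus>\<^bsub>M\<^esub> x', y \<oplus>\<^bsub>N\<^esub> y']"
  "[x, y] \<cdot>\<^bsub>direct_sum [M, N]\<^esub> a = [x \<cdot>\<^bsub>M\<^esub> a, y \<cdot>\<^bsub>N\<^esub> a]"
  "\<zero>\<^bsub>direct_sum [M, N]\<^esub> = [\<zero>\<^bsub>M\<^esub>, \<zero>\<^bsub>N\<^esub>]"
  by (auto simp: direct_sum_Cons direct_sum_Nil add_direct_sum_Nil ract_direct_sum_Nil)

text \<open>The complement of a retract is the kernel of the retraction.\<close>

lemma retract_imp_summand:
  fixes X :: "('a, 'a list) rmodule" and D :: "('a, 'b) rmodule"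
  assumes X: "right_module R X" and D: "right_module R D" and fg: "finitely_generated R D"
    and ret: "rmod_retract R X D"
  shows "\<exists>Y \<in> mod_cat R. rmod_isomorphic R (direct_sum [X, Y]) D"
proof -
  interpret X: right_module R X by fact
  interpret D: right_module R D by fact
  obtain i p where i: "i \<in> rmod_hom R X D" and p: "p \<in> rmod_hom R D X"
    and pi: "\<And>x. x \<in> carrier X \<Longrightarrow> p (i x) = x"
    using ret by (auto simp: rmod_retract_def)
  note cl = rmod_hom_closed[OF i] rmod_hom_closed[OF p]
  let ?T = "{u \<in> carrier D. p u = \<zero>\<^bsub>X\<^esub>}"
  define K where "K = D\<lparr>carrier := ?T\<rparr>"
  have T: "rsubmodule R D ?T"
    by (auto simp: rsubmodule_def rmod_hom_zero[OF D X p] rmod_hom_add[OF p] rmod_hom_ract[OF p]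
        X.zero_ract D.ract_closed)
  have K: "right_module R K" unfolding K_def by (rule right_module_submodule[OF D T])
  interpret K: right_module R K by (rule K)
  \<comment> \<open>The projection onto the kernel of \<open>p\<close> along the image of
    \<open>i\<close>. As an image of \<open>D\<close>, the kernel is finitely generated.\<close>
  define q where "q u = u \<ominus>\<^bsub>D\<^esub> i (p u)" for u
  have q_closed: "q u \<in> ?T" if "u \<in> carrier D" for u
    using that by (simp add: q_def cl rmod_hom_minus[OF D X p] pi)
      (simp add: a_minus_def X.M.r_neg cl)
  have q_id: "q u = u" if "u \<in> ?T" for u
    using that by (simp add: q_def rmod_hom_zero[OF X D i] a_minus_def)
  have q: "q \<in> rmod_hom R D K"
  proof (rule rmod_homI)
    fix u v assume "u \<in> carrier D" "v \<in> carrier D"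
    then show "q (u \<oplus>\<^bsub>D\<^esub> v) = q u \<oplus>\<^bsub>K\<^esub> q v"
      by (simp add: q_def K_def cl rmod_hom_add[OF p] rmod_hom_add[OF i] a_minus_def D.M.minus_add D.M.a_ac)
  next
    fix u a assume u: "u \<in> carrier D" and a: "a \<in> carrier R"
    have "(u \<oplus>\<^bsub>D\<^esub> (i (p u)) \<cdot>\<^bsub>D\<^esub> (\<ominus>\<^bsub>R\<^esub> \<one>\<^bsub>R\<^esub>)) \<cdot>\<^bsub>D\<^esub> a
        = u \<cdot>\<^bsub>D\<^esub> a \<oplus>\<^bsub>D\<^esub> (i (p u)) \<cdot>\<^bsub>D\<^esub> a \<cdot>\<^bsub>D\<^esub> (\<ominus>\<^bsub>R\<^esub> \<one>\<^bsub>R\<^esub>)"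
      using u a by (simp add: D.ract_add_left D.ract_closed cl D.ract_mult[symmetric] X.R.l_minus X.R.r_minus)
    then show "q (u \<cdot>\<^bsub>D\<^esub> a) = q u \<cdot>\<^bsub>K\<^esub> a"
      using u a by (simp add: q_def K_def cl rmod_hom_ract[OF p] rmod_hom_ract[OF i] a_minus_def
          D.minus_eq_ract D.ract_closed)
  qed (use q_closed in \<open>auto simp: K_def\<close>)
  have "q ` carrier D = carrier K"
    using q_closed q_id unfolding K_def by (auto simp: image_iff) metis
  then have "finitely_generated R K" by (rule finitely_generated_surj[OF D K q _ fg])
  \<comment> \<open>The kernel has the type of \<open>D\<close>; the complement required by
    \<open>add_closure\<close> must be a copy inside \<open>mod_cat\<close>.\<close>
  from fg_right_module_isomorphic_mod[OF K this] obtain Y k where Y: "Y \<in> mod_cat R"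
    and k: "k \<in> rmod_hom R K Y" "bij_betw k (carrier K) (carrier Y)"
    by (auto simp: rmod_isomorphic_def)
  have Y': "right_module R Y" using Y by (simp add: mod_cat_def)
  define g where "g = inv_into (carrier K) k"
  have g: "g \<in> rmod_hom R Y K" unfolding g_def by (rule rmod_hom_inv_into[OF K k])
  have gk: "g (k u) = u" if "u \<in> carrier K" for u
    unfolding g_def using k(2) that by (rule bij_betw_inv_into_left)
  have kg: "k (g y) = y" if "y \<in> carrier Y" for y
    unfolding g_def using k(2) that by (rule bij_betw_inv_into_right)
  have gD: "g y \<in> carrier D" "p (g y) = \<zero>\<^bsub>X\<^esub>" if "y \<in> carrier Y" for y
    using rmod_hom_closed[OF g that] by (auto simp: K_def)
  have gadd: "g (y \<oplus>\<^bsub>Y\<^esub> y') = g y \<oplus>\<^bsub>D\<^esub> g y'" if "y \<in> carrier Y" "y' \<in> carrier Y" for y y'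
    using rmod_hom_add[OF g that] by (simp add: K_def)
  have gract: "g (y \<cdot>\<^bsub>Y\<^esub> a) = g y \<cdot>\<^bsub>D\<^esub> a" if "y \<in> carrier Y" "a \<in> carrier R" for y a
    using rmod_hom_ract[OF g that] by (simp add: K_def)
  define h where "h zs = i (zs ! 0) \<oplus>\<^bsub>D\<^esub> g (zs ! 1)" for zs
  have h: "h \<in> rmod_hom R (direct_sum [X, Y]) D"
    by (rule rmod_homI) (auto simp: h_def carrier_direct_sum_pair direct_sum_pair cl gD gadd gract
        rmod_hom_add[OF i] rmod_hom_ract[OF i] D.M.a_ac D.ract_add_left D.ract_closed)
  have ph: "p (h [x, y]) = x" if "x \<in> carrier X" "y \<in> carrier Y" for x y
    using that by (simp add: h_def rmod_hom_add[OF p] cl gD pi)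
  have "inj_on h (carrier (direct_sum [X, Y]))"
  proof (rule inj_onI)
    fix z z' assume z: "z \<in> carrier (direct_sum [X, Y])" "z' \<in> carrier (direct_sum [X, Y])" "h z = h z'"
    then obtain x y x' y' where e: "z = [x, y]" "z' = [x', y']" "x \<in> carrier X" "y \<in> carrier Y"
      "x' \<in> carrier X" "y' \<in> carrier Y" by (auto simp: carrier_direct_sum_pair)
    have x: "x = x'" using z(3) ph e by metis
    with z(3) e have "g y = g y'" by (simp add: h_def cl gD)
    then have "y = y'" using kg e by metis
    with x e show "z = z'" by simp
  qed
  moreover have "h ` carrier (direct_sum [X, Y]) = carrier D"
  proof
    show "h ` carrier (direct_sum [X, Y]) \<subseteq> carrier D" using rmod_hom_closed[OF h] by auto
    show "carrier D \<subseteq> h ` carrier (direct_sum [X, Y])"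
    proof
      fix u assume u: "u \<in> carrier D"
      have qu: "q u \<in> carrier K" using q_closed[OF u] by (simp add: K_def)
      have "h [p u, k (q u)] = u"
        using u by (simp add: h_def gk[OF qu])
          (simp add: q_def cl a_minus_def D.M.a_lcomm[of "i (p u)" u] D.M.r_neg)
      moreover have "[p u, k (q u)] \<in> carrier (direct_sum [X, Y])"
        using u qu rmod_hom_closed[OF k(1)] by (auto simp: carrier_direct_sum_pair cl)
      ultimately show "u \<in> h ` carrier (direct_sum [X, Y])" by force
    qed
  qed
  ultimately show ?thesis using Y h by (auto simp: rmod_isomorphic_def bij_betw_def)
qed

text \<open>From here on additive closures are handled through retracts, with no complement to carry
  along.\<close>

lemma add_closure_eq_retracts:
  assumes R: "ring R" and W: "W \<subseteq> mod_cat R"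
  shows "add_closure R W =
    {X \<in> mod_cat R. \<exists>Us. set Us \<subseteq> W \<and> rmod_retract R X (direct_sum Us)}"
proof (rule equalityI; rule subsetI)
  fix X assume "X \<in> add_closure R W"
  then obtain Y Us where XY: "X \<in> mod_cat R" "Y \<in> mod_cat R" "set Us \<subseteq> W"
    and iso: "rmod_isomorphic R (direct_sum [X, Y]) (direct_sum Us)"
    by (auto simp: add_closure_def)
  have XY': "right_module R X" "right_module R Y" using XY by (auto simp: mod_cat_def)
  have "rmod_retract R (direct_sum [X, Y]) (direct_sum Us)"
    by (rule rmod_isomorphic_imp_retract[OF _ iso], rule right_module_direct_sum) (use R XY' in auto)
  moreover have "rmod_retract R X (direct_sum [X, Y])"
    by (rule rmod_retract_direct_sum_member) (use R XY' in auto)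
  ultimately show "X \<in> {X \<in> mod_cat R. \<exists>Us. set Us \<subseteq> W \<and> rmod_retract R X (direct_sum Us)}"
    using XY rmod_retract_trans by blast
next
  fix X assume "X \<in> {X \<in> mod_cat R. \<exists>Us. set Us \<subseteq> W \<and> rmod_retract R X (direct_sum Us)}"
  then obtain Us where X: "X \<in> mod_cat R" "set Us \<subseteq> W" "rmod_retract R X (direct_sum Us)" by auto
  have "\<exists>Y \<in> mod_cat R. rmod_isomorphic R (direct_sum [X, Y]) (direct_sum Us)"
    by (rule retract_imp_summand[OF _ right_module_direct_sum finitely_generated_direct_sum X(3)])
      (use R X W in \<open>auto simp: mod_cat_def\<close>)
  then show "X \<in> add_closure R W" using X by (auto simp: add_closure_def)
qed

text \<open>Layer 1 and the later layers have different defining equations; this common shape lets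
  closure properties of additive closures apply to all of them at once.\<close>

lemma gen_layer_Suc_eq:
  assumes "X \<in> mod_cat R"
  obtains W where "W \<subseteq> mod_cat R" "gen_layer R X (Suc t) = add_closure R W"
proof (cases t)
  case 0
  with assms show ?thesis by (intro that[of "{X}"]) auto
next
  case (Suc s)
  let ?W = "{E \<in> mod_cat R. \<exists>U \<in> gen_layer R X (Suc 0). \<exists>V \<in> gen_layer R X (Suc s). short_exact R U E V}"
  from Suc show ?thesis by (intro that[of ?W]) (auto simp only: gen_layer.simps ext_product_def)
qed

lemma gen_layer_subset: "gen_layer R X t \<subseteq> mod_cat R"
  by (induction R X t rule: gen_layer.induct) (auto simp: ext_product_def add_closure_def)

lemma subset_add_closure:
  assumes "ring R" "W \<subseteq> mod_cat R" shows "W \<subseteq> add_closure R W"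
proof
  fix X assume X: "X \<in> W"
  have "rmod_retract R X (direct_sum [X])"
    by (rule rmod_retract_direct_sum_member) (use assms X in \<open>auto simp: mod_cat_def\<close>)
  then show "X \<in> add_closure R W"
    using assms X by (auto simp: add_closure_eq_retracts intro!: exI[of _ "[X]"])
qed

text \<open>Allows exact sequences of intervals and of their direct sums to be moved to copies in
  \<open>mod_cat\<close>, where the layers are defined.\<close>

lemma short_exact_isomorphic:
  assumes L: "right_module R L" and M: "right_module R M" and N: "right_module R N"
    and N': "right_module R N'"
    and LL: "rmod_isomorphic R L L'" and MM: "rmod_isomorphic R M M'" and NN: "rmod_isomorphic R N N'"
    and ex: "short_exact R L M N"
  shows "short_exact R L' M' N'"
proof -
  obtain l where l: "l \<in> rmod_hom R L L'" "bij_betw l (carrier L) (carrier L')"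
    using LL by (auto simp: rmod_isomorphic_def)
  obtain m where m: "m \<in> rmod_hom R M M'" "bij_betw m (carrier M) (carrier M')"
    using MM by (auto simp: rmod_isomorphic_def)
  obtain k where k: "k \<in> rmod_hom R N N'" "bij_betw k (carrier N) (carrier N')"
    using NN by (auto simp: rmod_isomorphic_def)
  obtain f g where f: "f \<in> rmod_hom R L M" and g: "g \<in> rmod_hom R M N" and inj: "inj_on f (carrier L)"
    and im: "f ` carrier L = {x \<in> carrier M. g x = \<zero>\<^bsub>N\<^esub>}" and surj: "g ` carrier M = carrier N"
    using ex by (auto simp: short_exact_def)
  let ?l = "inv_into (carrier L) l" and ?m = "inv_into (carrier M) m"
  note hl = rmod_hom_inv_into[OF L l] and hm = rmod_hom_inv_into[OF M m]
  have lim: "?l ` carrier L' = carrier L" and mim: "?m ` carrier M' = carrier M"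
    using bij_betw_inv_into[OF l(2)] bij_betw_inv_into[OF m(2)] by (auto simp: bij_betw_def)
  have f': "(\<lambda>x. m (f (?l x))) \<in> rmod_hom R L' M'"
    using rmod_hom_comp[OF rmod_hom_comp[OF hl f] m(1)] .
  have g': "(\<lambda>x. k (g (?m x))) \<in> rmod_hom R M' N'"
    using rmod_hom_comp[OF rmod_hom_comp[OF hm g] k(1)] .
  have fc: "f x \<in> carrier M" if "x \<in> carrier L" for x using rmod_hom_closed[OF f that] .
  have gc: "g x \<in> carrier N" if "x \<in> carrier M" for x using rmod_hom_closed[OF g that] .
  have mm: "?m (m x) = x" if "x \<in> carrier M" for x using m(2) that by (rule bij_betw_inv_into_left)
  have mm': "m (?m x) = x" if "x \<in> carrier M'" for x using m(2) that by (rule bij_betw_inv_into_right)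
  have k0: "k y = \<zero>\<^bsub>N'\<^esub> \<longleftrightarrow> y = \<zero>\<^bsub>N\<^esub>" if "y \<in> carrier N" for y
  proof -
    interpret N: right_module R N by fact
    show ?thesis
      using rmod_hom_zero[OF N N' k(1)] k(2) that
      by (metis N.M.zero_closed bij_betw_imp_inj_on inj_onD)
  qed
  have "inj_on (\<lambda>x. m (f (?l x))) (carrier L')"
  proof (rule inj_onI)
    fix x y assume x: "x \<in> carrier L'" and y: "y \<in> carrier L'" and e: "m (f (?l x)) = m (f (?l y))"
    have xy: "?l x \<in> carrier L" "?l y \<in> carrier L" using lim x y by auto
    then have "f (?l x) = f (?l y)" using e mm fc by metis
    then have "?l x = ?l y" using inj xy by (auto dest: inj_onD)
    then show "x = y" using l(2) x y by (metis bij_betw_inv_into_right)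
  qed
  moreover have "(\<lambda>x. m (f (?l x))) ` carrier L' = {x \<in> carrier M'. k (g (?m x)) = \<zero>\<^bsub>N'\<^esub>}"
  proof -
    have "(\<lambda>x. m (f (?l x))) ` carrier L' = m ` f ` ?l ` carrier L'"
      by (simp only: image_image)
    also have "\<dots> = m ` f ` carrier L" by (simp only: lim)
    also have "\<dots> = {x \<in> carrier M'. k (g (?m x)) = \<zero>\<^bsub>N'\<^esub>}"
      unfolding im
    proof (rule equalityI; rule subsetI)
      fix x assume "x \<in> m ` {x \<in> carrier M. g x = \<zero>\<^bsub>N\<^esub>}"
      then show "x \<in> {x \<in> carrier M'. k (g (?m x)) = \<zero>\<^bsub>N'\<^esub>}"
        by (auto simp: mm rmod_hom_zero[OF N N' k(1)] rmod_hom_closed[OF m(1)])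
    next
      fix x assume x: "x \<in> {x \<in> carrier M'. k (g (?m x)) = \<zero>\<^bsub>N'\<^esub>}"
      have c: "?m x \<in> carrier M" using mim x by auto
      then show "x \<in> m ` {x \<in> carrier M. g x = \<zero>\<^bsub>N\<^esub>}"
        using x by (intro image_eqI[of _ _ "?m x"]) (auto simp: mm' k0 gc)
    qed
    finally show ?thesis .
  qed
  moreover have "(\<lambda>x. k (g (?m x))) ` carrier M' = carrier N'"
  proof -
    have "(\<lambda>x. k (g (?m x))) ` carrier M' = k ` g ` ?m ` carrier M'" by (simp add: image_image)
    also have "\<dots> = carrier N'" unfolding mim surj using k(2) by (simp add: bij_betw_def)
    finally show ?thesis .
  qed
  ultimately show ?thesis unfolding short_exact_def by (intro bexI[OF _ f'] bexI[OF _ g'] conjI)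
qed

text \<open>The index is shifted: \<open>in_layer R X t\<close> refers to \<open>[X]\<^sub>t\<^sub>+\<^sub>1\<close>. Passing to retracts frees \<open>M\<close> from the
  fixed universe of \<open>mod_cat\<close>.\<close>

definition in_layer ::
  "('a, 'r) ring_scheme \<Rightarrow> ('a, 'a list) rmodule \<Rightarrow> nat \<Rightarrow> ('a, 'b) rmodule \<Rightarrow> bool" where
  "in_layer R X t M \<longleftrightarrow> right_module R M \<and> (\<exists>N \<in> gen_layer R X (Suc t). rmod_retract R M N)"

lemma in_layer_retract:
  "in_layer R X t N \<Longrightarrow> right_module R M \<Longrightarrow> rmod_retract R M N \<Longrightarrow> in_layer R X t M"
  unfolding in_layer_def using rmod_retract_trans by blast

lemma in_layer_finitely_generated:
  assumes "in_layer R X t M" shows "right_module R M" "finitely_generated R M"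
proof -
  obtain N where N: "N \<in> gen_layer R X (Suc t)" "rmod_retract R M N" and M: "right_module R M"
    using assms by (auto simp: in_layer_def)
  have "N \<in> mod_cat R" using N(1) gen_layer_subset by blast
  then have "right_module R N" "finitely_generated R N" by (auto simp: mod_cat_def)
  then show "finitely_generated R M" by (rule rmod_retract_finitely_generated[OF M _ N(2)])
  show "right_module R M" by (rule M)
qed

context
  fixes R :: "('a, 'r) ring_scheme" and X :: "('a, 'a list) rmodule"
  assumes R: "ring R" and X: "X \<in> mod_cat R"
begin

lemma in_layerD:
  assumes W: "W \<subseteq> mod_cat R" "gen_layer R X (Suc t) = add_closure R W" and M: "in_layer R X t M"
  shows "\<exists>Us. set Us \<subseteq> W \<and> rmod_retract R M (direct_sum Us)"
proof -
  obtain N where N: "N \<in> gen_layer R X (Suc t)" "rmod_retract R M N"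
    using M by (auto simp: in_layer_def)
  then obtain Us where "set Us \<subseteq> W" "rmod_retract R N (direct_sum Us)"
    using W by (auto simp: add_closure_eq_retracts[OF R])
  then show ?thesis using N(2) rmod_retract_trans by blast
qed

lemma in_layerI:
  fixes M :: "('a, 'b) rmodule"
  assumes W: "W \<subseteq> mod_cat R" "gen_layer R X (Suc t) = add_closure R W" and M: "right_module R M"
    and Us: "set Us \<subseteq> W" "rmod_retract R M (direct_sum Us)"
  shows "in_layer R X t M"
proof -
  have rD: "right_module R (direct_sum Us)"
    by (rule right_module_direct_sum) (use R W Us in \<open>auto simp: mod_cat_def\<close>)
  have fD: "finitely_generated R (direct_sum Us)"
    by (rule finitely_generated_direct_sum) (use R W Us in \<open>auto simp: mod_cat_def\<close>)
  have "finitely_generated R M" by (rule rmod_retract_finitely_generated[OF M rD Us(2) fD])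
  \<comment> \<open>\<open>M\<close> may have any type, so its copy in \<open>mod_cat\<close> is the
    one shown to be a member of the layer.\<close>
  from fg_right_module_isomorphic_mod[OF M this] obtain N where N: "N \<in> mod_cat R"
    "rmod_isomorphic R M N" by blast
  note ret = rmod_isomorphic_imp_retract[OF M N(2)]
  have "N \<in> gen_layer R X (Suc t)"
    using W N Us rmod_retract_trans[OF ret(2) Us(2)] by (auto simp: add_closure_eq_retracts[OF R])
  then show ?thesis using M ret(1) by (auto simp: in_layer_def)
qed

lemma in_layer_mod_cat:
  assumes "M \<in> mod_cat R" "in_layer R X t M" shows "M \<in> gen_layer R X (Suc t)"
proof -
  obtain W where W: "W \<subseteq> mod_cat R" "gen_layer R X (Suc t) = add_closure R W"
    using gen_layer_Suc_eq[OF X] .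
  show ?thesis using in_layerD[OF W assms(2)] assms(1) W by (auto simp: add_closure_eq_retracts[OF R])
qed

lemma in_layer_direct_sum:
  assumes "\<And>M. M \<in> set Ms \<Longrightarrow> in_layer R X t M" shows "in_layer R X t (direct_sum Ms)"
proof -
  obtain W where W: "W \<subseteq> mod_cat R" "gen_layer R X (Suc t) = add_closure R W"
    using gen_layer_Suc_eq[OF X] .
  have Ms: "right_module R M \<and> (\<exists>Us. set Us \<subseteq> W \<and> rmod_retract R M (direct_sum Us))"
    if "M \<in> set Ms" for M
    using in_layerD[OF W assms[OF that]] assms[OF that] by (auto simp: in_layer_def)
  obtain Us where "set Us \<subseteq> W" "rmod_retract R (direct_sum Ms) (direct_sum Us)"
    using rmod_retract_direct_sum_concat[OF R Ms] by blast
  moreover have "right_module R (direct_sum Ms)" by (rule right_module_direct_sum) (use R Ms in auto)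
  ultimately show ?thesis using in_layerI[OF W] by blast
qed

lemma in_layer_isomorphic_gen_layer:
  assumes "in_layer R X t M"
  shows "\<exists>N \<in> gen_layer R X (Suc t). rmod_isomorphic R M N"
proof -
  note M = in_layer_finitely_generated[OF assms]
  obtain N where N: "N \<in> mod_cat R" "rmod_isomorphic R M N"
    using fg_right_module_isomorphic_mod[OF M] by blast
  have "in_layer R X t N"
    using N rmod_isomorphic_imp_retract(2)[OF M(1) N(2)] in_layer_retract[OF assms]
    by (auto simp: mod_cat_def)
  then show ?thesis using N in_layer_mod_cat by blast
qed

lemma in_layer_ext:
  assumes U: "in_layer R X 0 U" and V: "in_layer R X t V"
    and E: "right_module R E" "finitely_generated R E" and ex: "short_exact R U E V"
  shows "in_layer R X (Suc t) E"
proof -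
  obtain U' where U': "U' \<in> gen_layer R X (Suc 0)" "rmod_isomorphic R U U'"
    using in_layer_isomorphic_gen_layer[OF U] by blast
  obtain V' where V': "V' \<in> gen_layer R X (Suc t)" "rmod_isomorphic R V V'"
    using in_layer_isomorphic_gen_layer[OF V] by blast
  obtain E' where E': "E' \<in> mod_cat R" "rmod_isomorphic R E E'"
    using fg_right_module_isomorphic_mod[OF E] by blast
  have "V' \<in> mod_cat R" using V' gen_layer_subset by blast
  then have "short_exact R U' E' V'"
    by (intro short_exact_isomorphic[OF in_layer_finitely_generated(1)[OF U] E(1)
          in_layer_finitely_generated(1)[OF V] _ U'(2) E'(2) V'(2) ex]) (simp add: mod_cat_def)
  then have "E' \<in> {E \<in> mod_cat R. \<exists>U \<in> gen_layer R X (Suc 0). \<exists>V \<in> gen_layer R X (Suc t). short_exact R U E V}"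
    using U' V' E' by blast
  then have "E' \<in> gen_layer R X (Suc (Suc t))"
    unfolding gen_layer.simps ext_product_def
    by (rule subsetD[OF subset_add_closure[OF R], rotated]) auto
  then show ?thesis
    using E rmod_isomorphic_imp_retract(1)[OF E(1) E'(2)] by (auto simp: in_layer_def)
qed

text \<open>The layers increase: take the zero module as the submodule in the extension. It is the
  empty direct sum, hence in the first layer.\<close>

lemma in_layer_Suc:
  fixes M :: "('a, 'b) rmodule"
  assumes "in_layer R X t M" shows "in_layer R X (Suc t) M"
proof (rule in_layer_ext[OF in_layer_direct_sum assms])
  note M = in_layer_finitely_generated[OF assms]
  show "right_module R M" "finitely_generated R M" by (rule M)+
  interpret M: right_module R M by (rule M)
  let ?Z = "direct_sum [] :: ('a, 'b list) rmodule"
  have "(\<lambda>_. \<zero>\<^bsub>M\<^esub>) \<in> rmod_hom R ?Z M"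
    by (rule rmod_homI) (auto simp: M.zero_ract)
  then show "short_exact R ?Z M M"
    unfolding short_exact_def
    by (intro bexI[of _ "\<lambda>_. \<zero>\<^bsub>M\<^esub>"] bexI[OF _ rmod_hom_id]) (auto simp: direct_sum_Nil)
qed simp

lemma in_layer_mono:
  assumes "s \<le> t" "in_layer R X s M" shows "in_layer R X t M"
  using assms by (induction t rule: dec_induct) (auto intro: in_layer_Suc)

lemma in_layer_self: "in_layer R X 0 X"
  using subset_add_closure[OF R, of "{X}"] X rmod_retract_refl
  by (auto simp: in_layer_def mod_cat_def)

text \<open>The induction behind the lower bound and behind the search for summands of a generator.
  The index \<open>t\<close> belongs to layer \<open>t + 1\<close>, so a property may weaken from
  layer to layer; the submodule \<open>U\<close> comes from the first layer and therefore enters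
  with \<open>P 0\<close>.\<close>

lemma gen_layer_invariant:
  assumes base: "P 0 X"
    and sum: "\<And>t M Us. M \<in> mod_cat R \<Longrightarrow> (\<And>U. U \<in> set Us \<Longrightarrow> U \<in> mod_cat R \<and> P t U) \<Longrightarrow>
      rmod_retract R M (direct_sum Us) \<Longrightarrow> P t M"
    and ext: "\<And>t U E V. U \<in> mod_cat R \<Longrightarrow> E \<in> mod_cat R \<Longrightarrow> V \<in> mod_cat R \<Longrightarrow> P 0 U \<Longrightarrow> P t V \<Longrightarrow>
      short_exact R U E V \<Longrightarrow> P (Suc t) E"
  shows "M \<in> gen_layer R X (Suc t) \<Longrightarrow> P t M"
proof (induction t arbitrary: M)
  case 0
  then obtain Us where "M \<in> mod_cat R" "set Us \<subseteq> {X}" "rmod_retract R M (direct_sum Us)"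
    using X by (auto simp: add_closure_eq_retracts[OF R])
  then show ?case using sum[of M Us 0] base X by auto
next
  case (Suc t)
  have one: "P 0 U" if "U \<in> gen_layer R X (Suc 0)" for U
  proof -
    from that obtain Us where "U \<in> mod_cat R" "set Us \<subseteq> {X}" "rmod_retract R U (direct_sum Us)"
      using X by (auto simp: add_closure_eq_retracts[OF R])
    then show ?thesis using sum[of U Us 0] base X by auto
  qed
  let ?W = "{E \<in> mod_cat R. \<exists>U \<in> gen_layer R X (Suc 0). \<exists>V \<in> gen_layer R X (Suc t). short_exact R U E V}"
  have W: "?W \<subseteq> mod_cat R" by auto
  have "M \<in> add_closure R ?W" using Suc.prems by (simp only: gen_layer.simps(3) ext_product_def)
  then obtain Us where Us: "M \<in> mod_cat R" "set Us \<subseteq> ?W" "rmod_retract R M (direct_sum Us)"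
    unfolding add_closure_eq_retracts[OF R W] by blast
  have "P (Suc t) E" if "E \<in> ?W" for E
    using that ext Suc.IH one gen_layer_subset by blast
  then show ?case using sum[OF Us(1) _ Us(3)] Us(2) by blast
qed

end

section \<open>The path algebra of the linear quiver\<close>

abbreviation lin_algebra :: "nat \<Rightarrow> ((nat, nat) path \<Rightarrow> 'k::field) ring" where
  "lin_algebra n \<equiv> path_algebra (linear_quiver n)"

lemma ring_lin_algebra: "ring (lin_algebra n)"
  by (rule fin_digraph.ring_path_algebra[OF fin_digraph_linear_quiver])

lemma wf_digraph_linear_quiver: "wf_digraph (linear_quiver n)"
  using fin_digraph_linear_quiver by (simp add: fin_digraph_def)

lemmas lin_algebra_mult_closed = wf_digraph.path_algebra_mult_closed[OF wf_digraph_linear_quiver]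

lemma paths_linear_quiver:
  "(u, p, w) \<in> paths (linear_quiver n) \<longleftrightarrow> 1 \<le> u \<and> u \<le> w \<and> w \<le> n \<and> p = [u..<w]"
proof -
  interpret wf_digraph "linear_quiver n" by (rule wf_digraph_linear_quiver)
  have "awalk u p w \<longleftrightarrow> 1 \<le> u \<and> u \<le> w \<and> w \<le> n \<and> p = [u..<w]" for u
  proof (induction p arbitrary: u)
    case Nil
    have "verts (linear_quiver n) = {1..n}" by (simp add: linear_quiver_def)
    then show ?case by (auto simp: awalk_Nil_iff eq_commute[of "[]"])
  next
    case (Cons e p)
    have "arcs (linear_quiver n) = {1..<n}" "tail (linear_quiver n) e = e" "head (linear_quiver n) e = Suc e"
      by (simp_all add: linear_quiver_def)
    moreover have "e # p = [u..<w] \<longleftrightarrow> u < w \<and> e = u \<and> p = [Suc u..<w]"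
      by (cases "u < w") (auto simp: upt_conv_Cons)
    ultimately show ?case by (auto simp: awalk_Cons_iff Cons.IH)
  qed
  then show ?thesis by (simp add: paths_def)
qed

text \<open>By \<open>paths_linear_quiver\<close> there is at most one path between two vertices, so
  the algebra is that of upper triangular matrices and this is a matrix entry.\<close>

definition entry :: "((nat, nat) path \<Rightarrow> 'k::field) \<Rightarrow> nat \<Rightarrow> nat \<Rightarrow> 'k" where
  "entry \<alpha> u w = \<alpha> (u, [u..<w], w)"

text \<open>The matrices supported in row \<open>a\<close> form the right ideal generated by the
  idempotent at \<open>a\<close>, the projective module at that vertex. If \<open>x\<close> is fixed
  by this idempotent, acting with \<open>row n a f\<close> on \<open>x\<close> is the homomorphism
  from that projective determined by \<open>x\<close>.\<close>

definition row :: "nat \<Rightarrow> nat \<Rightarrow> (nat \<Rightarrow> 'k) \<Rightarrow> (nat, nat) path \<Rightarrow> 'k::field" where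
  "row n a f = (\<lambda>(u, p, w). if u = a \<and> 1 \<le> a \<and> a \<le> w \<and> w \<le> n \<and> p = [a..<w] then f w else 0)"

text \<open>The path from \<open>u\<close> to \<open>w\<close>, which is \<open>0\<close> unless \<open>1 \<le> u \<le> w \<le> n\<close>.\<close>

definition lpath :: "nat \<Rightarrow> nat \<Rightarrow> nat \<Rightarrow> (nat, nat) path \<Rightarrow> 'k::field" where
  "lpath n u w = row n u (\<lambda>v. if v = w then 1 else 0)"

lemma carrier_lin_algebra:
  "\<alpha> \<in> carrier (lin_algebra n) \<longleftrightarrow>
    (\<forall>u p w. \<alpha> (u, p, w) \<noteq> 0 \<longrightarrow> 1 \<le> u \<and> u \<le> w \<and> w \<le> n \<and> p = [u..<w])"
proof -
  have fin: "finite (paths (linear_quiver n))"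
  proof (rule finite_subset)
    show "paths (linear_quiver n) \<subseteq> (\<lambda>(u, w). (u, [u..<w], w)) ` ({..n} \<times> {..n})"
      by (auto simp: paths_linear_quiver image_iff)
  qed simp
  have "\<alpha> \<in> carrier (lin_algebra n) \<longleftrightarrow> {r. \<alpha> r \<noteq> 0} \<subseteq> paths (linear_quiver n)"
    using finite_subset[OF _ fin] by (auto simp: path_algebra_def)
  then show ?thesis by (auto simp: subset_iff paths_linear_quiver)
qed

lemma entry_eq_0: "\<alpha> \<in> carrier (lin_algebra n) \<Longrightarrow> w < u \<Longrightarrow> entry \<alpha> u w = 0"
  by (auto simp: carrier_lin_algebra entry_def) (metis leD)

lemma lin_algebra_eqI:
  assumes "\<alpha> \<in> carrier (lin_algebra n)" "\<beta> \<in> carrier (lin_algebra n)"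
    and "\<And>u w. 1 \<le> u \<Longrightarrow> u \<le> w \<Longrightarrow> w \<le> n \<Longrightarrow> entry \<alpha> u w = entry \<beta> u w"
  shows "\<alpha> = \<beta>"
proof
  fix r :: "(nat, nat) path"
  obtain u p w where r: "r = (u, p, w)" by (cases r)
  show "\<alpha> r = \<beta> r"
  proof (cases "1 \<le> u \<and> u \<le> w \<and> w \<le> n \<and> p = [u..<w]")
    case True then show ?thesis using assms(3)[of u w] by (simp add: r entry_def)
  next
    case False
    then have "\<alpha> r = 0" "\<beta> r = 0" using assms(1,2) unfolding carrier_lin_algebra r by blast+
    then show ?thesis by simp
  qed
qed

text \<open>Cutting a path in two amounts to choosing the vertex \<open>v\<close> between
  \<open>u\<close> and \<open>w\<close>. The terms with \<open>v < u\<close> vanish by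
  triangularity, and outside the range of the quiver both sides are 0.\<close>

lemma entry_mult:
  assumes \<alpha>: "\<alpha> \<in> carrier (lin_algebra n)" and \<beta>: "\<beta> \<in> carrier (lin_algebra n)"
  shows "entry (\<alpha> \<otimes>\<^bsub>lin_algebra n\<^esub> \<beta>) u w = (\<Sum>v\<le>w. entry \<alpha> u v * entry \<beta> v w)"
proof (cases "1 \<le> u \<and> u \<le> w \<and> w \<le> n")
  case True
  interpret wf_digraph "linear_quiver n" by (rule wf_digraph_linear_quiver)
  have cuts: "cuts u [u..<w] w = (\<lambda>v. ([u..<v], v, [v..<w])) ` {u..w}"
    using True by (auto simp: cuts_def paths_linear_quiver image_iff upt_add_eq_append[symmetric])
      (metis le_add_diff_inverse upt_add_eq_append)
  have "entry (\<alpha> \<otimes>\<^bsub>lin_algebra n\<^esub> \<beta>) u w = (\<Sum>v\<in>{u..w}. entry \<alpha> u v * entry \<beta> v w)"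
    unfolding entry_def mult_path_algebra cuts by (subst sum.reindex) (auto simp: inj_on_def)
  also have "\<dots> = (\<Sum>v\<le>w. entry \<alpha> u v * entry \<beta> v w)"
    by (rule sum.mono_neutral_left) (auto simp: entry_eq_0[OF \<alpha>])
  finally show ?thesis .
next
  case False
  have "\<alpha> \<otimes>\<^bsub>lin_algebra n\<^esub> \<beta> \<in> carrier (lin_algebra n)"
    by (rule lin_algebra_mult_closed[OF \<alpha> \<beta>])
  then have "entry (\<alpha> \<otimes>\<^bsub>lin_algebra n\<^esub> \<beta>) u w = 0"
    using False by (auto simp: carrier_lin_algebra entry_def)
  moreover have "entry \<alpha> u v * entry \<beta> v w = 0" for v
    using \<alpha> \<beta> False unfolding carrier_lin_algebra entry_def by (metis le_trans mult_eq_0_iff)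
  ultimately show ?thesis by (simp only: sum.neutral_const)
qed

lemma entry_add: "entry (\<alpha> \<oplus>\<^bsub>lin_algebra n\<^esub> \<beta>) u w = entry \<alpha> u w + entry \<beta> u w"
  by (simp add: entry_def path_algebra_def)

lemma entry_zero: "entry \<zero>\<^bsub>lin_algebra n\<^esub> u w = 0"
  by (simp add: entry_def path_algebra_def)

lemma entry_one: "entry \<one>\<^bsub>lin_algebra n\<^esub> u w = (if 1 \<le> u \<and> u \<le> n \<and> u = w then 1 else 0)"
  by (auto simp: entry_def path_algebra_def linear_quiver_def)

lemma entry_row: "entry (row n a f) u w = (if u = a \<and> 1 \<le> a \<and> a \<le> w \<and> w \<le> n then f w else 0)"
  by (simp add: entry_def row_def)

lemma row_closed: "row n a f \<in> carrier (lin_algebra n)"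
  by (simp add: carrier_lin_algebra row_def)

lemma lpath_closed: "lpath n u w \<in> carrier (lin_algebra n)"
  by (simp add: lpath_def row_closed)

lemma row_cong: "(\<And>w. a \<le> w \<Longrightarrow> w \<le> n \<Longrightarrow> f w = g w) \<Longrightarrow> row n a f = row n a g"
  by (auto simp: row_def fun_eq_iff)

lemma row_mult:
  assumes "\<alpha> \<in> carrier (lin_algebra n)"
  shows "row n a f \<otimes>\<^bsub>lin_algebra n\<^esub> \<alpha> = row n a (\<lambda>w. \<Sum>v=a..w. f v * entry \<alpha> v w)"
proof (rule lin_algebra_eqI)
  show "row n a f \<otimes>\<^bsub>lin_algebra n\<^esub> \<alpha> \<in> carrier (lin_algebra n)"
    by (rule lin_algebra_mult_closed[OF row_closed assms])
  fix u w assume uw: "1 \<le> u" "u \<le> w" "w \<le> n"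
  have "(\<Sum>v\<le>w. entry (row n a f) u v * entry \<alpha> v w) = (\<Sum>v=a..w. entry (row n a f) u v * entry \<alpha> v w)"
    by (rule sum.mono_neutral_right) (auto simp: entry_row)
  also have "\<dots> = entry (row n a (\<lambda>w. \<Sum>v=a..w. f v * entry \<alpha> v w)) u w"
    using uw by (auto simp: entry_row intro!: sum.cong sum.neutral)
  finally show "entry (row n a f \<otimes>\<^bsub>lin_algebra n\<^esub> \<alpha>) u w =
      entry (row n a (\<lambda>w. \<Sum>v=a..w. f v * entry \<alpha> v w)) u w"
    using assms by (simp add: entry_mult row_closed)
qed (rule row_closed)

lemma row_add: "row n a f \<oplus>\<^bsub>lin_algebra n\<^esub> row n a g = row n a (\<lambda>w. f w + g w)"
  by (auto simp: row_def path_algebra_def fun_eq_iff)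

lemma row_zero: "row n a (\<lambda>_. 0) = \<zero>\<^bsub>lin_algebra n\<^esub>"
  by (auto simp: row_def path_algebra_def fun_eq_iff)

lemma row_mult_row:
  assumes "1 \<le> v" "v \<le> n" "u \<le> v"
  shows "row n u f \<otimes>\<^bsub>lin_algebra n\<^esub> row n v g = row n u (\<lambda>w. if v \<le> w then f v * g w else 0)"
proof -
  have "(\<Sum>x=u..w. f x * entry (row n v g) x w) = (if v \<le> w then f v * g w else 0)" if "w \<le> n" for w
  proof -
    have "(\<Sum>x=u..w. f x * entry (row n v g) x w) = (\<Sum>x=u..w. if x = v then (if v \<le> w then f v * g w else 0) else 0)"
      using assms that by (intro sum.cong) (auto simp: entry_row)
    then show ?thesis using assms by (auto simp: sum.delta)
  qed
  then show ?thesis unfolding row_mult[OF row_closed] by (intro row_cong) simp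
qed

lemma lpath_mult_row:
  assumes "1 \<le> v" "v \<le> n" "u \<le> v"
  shows "lpath n u v \<otimes>\<^bsub>lin_algebra n\<^esub> row n v g = row n u (\<lambda>w. if v \<le> w then g w else 0)"
  unfolding lpath_def using assms by (subst row_mult_row) (auto intro: row_cong)

lemma lpath_mult:
  assumes "1 \<le> v" "v \<le> n" "u \<le> v" "v \<le> w"
  shows "lpath n u v \<otimes>\<^bsub>lin_algebra n\<^esub> lpath n v w = lpath n u w"
  unfolding lpath_def[of n v w] lpath_mult_row[OF assms(1-3)] using assms
  by (auto simp: lpath_def intro: row_cong)

lemma lpath_eq_0: "n < w \<Longrightarrow> lpath n u w = \<zero>\<^bsub>lin_algebra n\<^esub>"
  unfolding lpath_def row_zero[symmetric, of n u] by (intro row_cong) auto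

section \<open>Interval modules\<close>

text \<open>The representation that is one-dimensional at the vertices from \<open>a\<close> to \<open>b\<close>, with identity maps;
  the empty interval \<open>b < a\<close> is allowed and gives \<open>0\<close>.\<close>

definition imod :: "nat \<Rightarrow> nat \<Rightarrow> ((nat, nat) path \<Rightarrow> 'k::field, nat \<Rightarrow> 'k) rmodule" where
  "imod a b = \<lparr>
     carrier = {f. \<forall>v. f v \<noteq> 0 \<longrightarrow> a \<le> v \<and> v \<le> b},
     mult = undefined,
     one = undefined,
     zero = (\<lambda>_. 0),
     add = (\<lambda>f g v. f v + g v),
     ract = (\<lambda>f \<alpha> w. if a \<le> w \<and> w \<le> b then \<Sum>v\<le>w. f v * entry \<alpha> v w else 0) \<rparr>"

lemma imod_simps:
  "f \<in> carrier (imod a b) \<longleftrightarrow> (\<forall>v. f v \<noteq> 0 \<longrightarrow> a \<le> v \<and> v \<le> b)"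
  "\<zero>\<^bsub>imod a b\<^esub> = (\<lambda>_. 0)"
  "f \<oplus>\<^bsub>imod a b\<^esub> g = (\<lambda>v. f v + g v)"
  "f \<cdot>\<^bsub>imod a b\<^esub> \<alpha> = (\<lambda>w. if a \<le> w \<and> w \<le> b then \<Sum>v\<le>w. f v * entry \<alpha> v w else 0)"
  by (auto simp: imod_def)

text \<open>The action is row vector times matrix, cut off outside the interval. It stays
  associative because cutting off the intermediate vector loses nothing: below \<open>a\<close> it
  is already 0, and what lies above \<open>b\<close> cannot reach a vertex \<open>w \<le> b\<close>.
  The bounds on \<open>a\<close> and \<open>b\<close> make the unit act as the identity.\<close>

lemma right_module_imod:
  assumes a: "1 \<le> a" and b: "b \<le> n"
  shows "right_module (lin_algebra n) (imod a b :: ((nat, nat) path \<Rightarrow> 'k::field, nat \<Rightarrow> 'k) rmodule)"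
    (is "right_module ?A ?M")
proof (intro right_module.intro right_module_axioms.intro)
  show "ring ?A" by (rule ring_lin_algebra)
  show "abelian_group ?M"
  proof (rule abelian_groupI)
    fix f assume "f \<in> carrier ?M"
    then show "\<exists>g\<in>carrier ?M. g \<oplus>\<^bsub>?M\<^esub> f = \<zero>\<^bsub>?M\<^esub>"
      by (intro bexI[of _ "\<lambda>v. - f v"]) (auto simp: imod_simps)
  next
    fix f g assume "f \<in> carrier ?M" "g \<in> carrier ?M"
    then show "f \<oplus>\<^bsub>?M\<^esub> g \<in> carrier ?M" unfolding imod_simps by (metis add.right_neutral)
  qed (auto simp: imod_simps fun_eq_iff)
next
  fix f :: "nat \<Rightarrow> 'k" and \<alpha> \<beta> :: "(nat, nat) path \<Rightarrow> 'k"
  assume f: "f \<in> carrier ?M" and \<alpha>: "\<alpha> \<in> carrier ?A" and \<beta>: "\<beta> \<in> carrier ?A"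
  have "(\<Sum>v\<le>w. f v * (\<Sum>x\<le>w. entry \<alpha> v x * entry \<beta> x w)) =
      (\<Sum>x\<le>w. (if a \<le> x \<and> x \<le> b then \<Sum>v\<le>x. f v * entry \<alpha> v x else 0) * entry \<beta> x w)"
    if "a \<le> w" "w \<le> b" for w
  proof -
    have "(\<Sum>v\<le>w. f v * (\<Sum>x\<le>w. entry \<alpha> v x * entry \<beta> x w)) =
        (\<Sum>x\<le>w. (\<Sum>v\<le>w. f v * entry \<alpha> v x) * entry \<beta> x w)"
      by (simp add: sum_distrib_left sum_distrib_right mult.assoc) (rule sum.swap)
    also have "\<dots> = (\<Sum>x\<le>w. (if a \<le> x \<and> x \<le> b then \<Sum>v\<le>x. f v * entry \<alpha> v x else 0) * entry \<beta> x w)"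
    proof (rule sum.cong[OF refl])
      fix x assume x: "x \<in> {..w}"
      have "(\<Sum>v\<le>w. f v * entry \<alpha> v x) = (\<Sum>v\<le>x. f v * entry \<alpha> v x)"
        using x by (intro sum.mono_neutral_right) (auto simp: entry_eq_0[OF \<alpha>])
      moreover have "(\<Sum>v\<le>x. f v * entry \<alpha> v x) = 0" if "x < a"
        using f that by (intro sum.neutral) (auto simp: imod_simps)
      ultimately show "(\<Sum>v\<le>w. f v * entry \<alpha> v x) * entry \<beta> x w =
          (if a \<le> x \<and> x \<le> b then \<Sum>v\<le>x. f v * entry \<alpha> v x else 0) * entry \<beta> x w"
        using x that by (auto simp: not_le)
    qed
    finally show ?thesis .
  qed
  then show "f \<cdot>\<^bsub>?M\<^esub> (\<alpha> \<otimes>\<^bsub>?A\<^esub> \<beta>) = f \<cdot>\<^bsub>?M\<^esub> \<alpha> \<cdot>\<^bsub>?M\<^esub> \<beta>"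
    by (simp add: imod_simps entry_mult[OF \<alpha> \<beta>] fun_eq_iff)
next
  fix f assume f: "f \<in> carrier ?M"
  have "(\<Sum>v\<le>w. f v * entry \<one>\<^bsub>?A\<^esub> v w) = f w" if "a \<le> w" "w \<le> b" for w
  proof -
    have "(\<Sum>v\<le>w. f v * entry \<one>\<^bsub>?A\<^esub> v w) = (\<Sum>v\<le>w. if v = w then f w else 0)"
      using a b that by (intro sum.cong) (auto simp: entry_one)
    then show ?thesis by simp
  qed
  then show "f \<cdot>\<^bsub>?M\<^esub> \<one>\<^bsub>?A\<^esub> = f"
    using f by (auto simp: imod_simps fun_eq_iff)
qed (auto simp: imod_simps fun_eq_iff entry_add sum.distrib distrib_left distrib_right split: if_splits)

lemma finitely_generated_imod:
  assumes a: "1 \<le> a" and b: "b \<le> n"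
  shows "finitely_generated (lin_algebra n) (imod a b :: ((nat, nat) path \<Rightarrow> 'k::field, nat \<Rightarrow> 'k) rmodule)"
    (is "finitely_generated ?A ?M")
proof -
  \<comment> \<open>The basis vector at the first vertex generates everything; it is 0 if the
    interval is empty.\<close>
  let ?d = "\<lambda>v. if v = a \<and> a \<le> b then 1 else (0 :: 'k)"
  have "f = ?d \<cdot>\<^bsub>?M\<^esub> row n a f" if f: "f \<in> carrier ?M" for f
  proof
    fix w
    have "(\<Sum>v\<le>w. ?d v * entry (row n a f) v w) = (\<Sum>v\<le>w. if v = a then f w else 0)" if "a \<le> w" "w \<le> b"
      using a b that by (intro sum.cong) (auto simp: entry_row)
    then show "f w = (?d \<cdot>\<^bsub>?M\<^esub> row n a f) w"
      using f by (auto simp: imod_simps)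
  qed
  then have "carrier ?M \<subseteq> T" if "rsubmodule ?A ?M T" "?d \<in> T" for T
    using that row_closed unfolding rsubmodule_def by (metis subsetI)
  then show ?thesis
    unfolding finitely_generated_iff[OF right_module_imod[OF a b]]
    by (intro exI[of _ "{?d}"]) (auto simp: imod_simps)
qed

definition restr :: "nat \<Rightarrow> nat \<Rightarrow> (nat \<Rightarrow> 'k) \<Rightarrow> nat \<Rightarrow> 'k::field" where
  "restr a b f = (\<lambda>v. if a \<le> v \<and> v \<le> b then f v else 0)"

text \<open>The canonical map between intervals: the quotient of \<open>[a, b]\<close> with end
  \<open>d\<close>, followed by its inclusion as an end piece of \<open>[c, d]\<close>. Quotients
  (\<open>c = a\<close>) and inclusions (\<open>d = b\<close>) are special cases.\<close>

lemma restr_hom: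
  assumes "c \<le> a" "d \<le> b"
  shows "restr c d \<in> rmod_hom (lin_algebra n) (imod a b) (imod c d)"
proof (rule rmod_homI)
  fix f \<alpha> assume f: "f \<in> carrier (imod a b)"
  have "(\<Sum>v\<le>w. restr c d f v * entry \<alpha> v w) = (if a \<le> w then \<Sum>v\<le>w. f v * entry \<alpha> v w else 0)"
    if "w \<le> d" for w
  proof -
    have "(\<Sum>v\<le>w. restr c d f v * entry \<alpha> v w) = (\<Sum>v\<le>w. f v * entry \<alpha> v w)"
      using f that assms by (intro sum.cong) (fastforce simp: restr_def imod_simps)+
    moreover have "(\<Sum>v\<le>w. f v * entry \<alpha> v w) = 0" if "w < a"
      using f that by (intro sum.neutral) (auto simp: imod_simps)
    ultimately show ?thesis by auto
  qed
  then show "restr c d (f \<cdot>\<^bsub>imod a b\<^esub> \<alpha>) = restr c d f \<cdot>\<^bsub>imod c d\<^esub> \<alpha>"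
    using assms by (auto simp: imod_simps restr_def fun_eq_iff)
qed (auto simp: imod_simps restr_def split: if_splits)

lemma restr_id: "f \<in> carrier (imod p q) \<Longrightarrow> a \<le> p \<Longrightarrow> q \<le> b \<Longrightarrow> restr a b f = f"
  by (fastforce simp: restr_def imod_simps fun_eq_iff)

text \<open>Arrows push values to larger vertices, so the end piece is the submodule and the initial
  piece the quotient. With \<open>a = Suc c\<close> the quotient is 0, a case needed to start
  inductions.\<close>

lemma short_exact_imod:
  assumes "a \<le> Suc c" "c \<le> b"
  shows "short_exact (lin_algebra n) (imod (Suc c) b) (imod a b) (imod a c)"
proof -
  have i: "restr a b \<in> rmod_hom (lin_algebra n) (imod (Suc c) b) (imod a b)"
    and p: "restr a c \<in> rmod_hom (lin_algebra n) (imod a b) (imod a c)"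
    using assms by (auto intro: restr_hom)
  have "inj_on (restr a b) (carrier (imod (Suc c) b))"
    using assms by (simp add: inj_on_def restr_id)
  moreover have "restr a b ` carrier (imod (Suc c) b) = {x \<in> carrier (imod a b). restr a c x = \<zero>\<^bsub>imod a c\<^esub>}"
  proof (rule equalityI; rule subsetI)
    fix x assume "x \<in> {x \<in> carrier (imod a b). restr a c x = \<zero>\<^bsub>imod a c\<^esub>}"
    then have x: "x \<in> carrier (imod a b)" "\<And>v. a \<le> v \<Longrightarrow> v \<le> c \<Longrightarrow> x v = 0"
      by (auto simp: restr_def imod_simps fun_eq_iff split: if_splits)
    then have "x \<in> carrier (imod (Suc c) b)"
      by (simp add: imod_simps) (metis not_less_eq_eq)
    then show "x \<in> restr a b ` carrier (imod (Suc c) b)"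
      using x restr_id[of x a b a b] by (intro image_eqI[of _ _ x]) auto
  next
    fix x assume "x \<in> restr a b ` carrier (imod (Suc c) b)"
    then obtain y where "x = restr a b y" "y \<in> carrier (imod (Suc c) b)" by blast
    then have x: "x \<in> carrier (imod (Suc c) b)" using assms by (simp add: restr_id)
    then have "restr a c x = (\<lambda>_. 0)"
      by (auto simp: restr_def imod_simps fun_eq_iff)
    then show "x \<in> {x \<in> carrier (imod a b). restr a c x = \<zero>\<^bsub>imod a c\<^esub>}"
      using x assms by (auto simp: imod_simps)
  qed
  moreover have "restr a c ` carrier (imod a b) = carrier (imod a c)"
  proof (rule equalityI; rule subsetI)
    fix x assume "x \<in> carrier (imod a c)"
    then show "x \<in> restr a c ` carrier (imod a b)"
      by (intro image_eqI[of _ _ x]) (use assms in \<open>auto simp: restr_def imod_simps fun_eq_iff\<close>)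
  qed (auto simp: restr_def imod_simps split: if_splits)
  ultimately show ?thesis
    unfolding short_exact_def by (intro bexI[OF _ i] bexI[OF _ p] conjI)
qed

text \<open>The extension of \<open>[g, b] \<oplus> [a, b - 1]\<close> by \<open>[b, d]\<close> with middle term \<open>[a, b] \<oplus> [g, d]\<close>; here
  \<open>b = Suc c\<close>.\<close>

lemma short_exact_imod_pair:
  assumes "g \<le> a" "a \<le> Suc c" "Suc c \<le> d"
  shows "short_exact (lin_algebra n) (imod (Suc c) d)
    (direct_sum [imod a (Suc c), imod g d])
    (direct_sum [imod g (Suc c) :: ((nat, nat) path \<Rightarrow> 'k::field, nat \<Rightarrow> 'k) rmodule, imod a c])"
proof -
  let ?A = "lin_algebra n :: ((nat, nat) path \<Rightarrow> 'k) ring"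
  let ?U = "imod (Suc c) d :: ((nat, nat) path \<Rightarrow> 'k, nat \<Rightarrow> 'k) rmodule"
  let ?E = "direct_sum [imod a (Suc c), imod g d :: ((nat, nat) path \<Rightarrow> 'k, nat \<Rightarrow> 'k) rmodule]"
  let ?V = "direct_sum [imod g (Suc c), imod a c :: ((nat, nat) path \<Rightarrow> 'k, nat \<Rightarrow> 'k) rmodule]"
  \<comment> \<open>\<open>i\<close> is diagonal, and the first component of \<open>p\<close> is the
    difference of the two maps to \<open>[g, b]\<close>, which makes the composite vanish there. The
    second component removes the vertex \<open>b\<close> from \<open>[a, b]\<close>.\<close>
  define i where "i u = [restr a (Suc c) u, restr g d u]" for u :: "nat \<Rightarrow> 'k"
  define p where "p z = [\<lambda>v. restr g (Suc c) (z ! 0) v - restr g (Suc c) (z ! 1) v, restr a c (z ! 0)]"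
    for z :: "(nat \<Rightarrow> 'k) list"
  have i: "i \<in> rmod_hom ?A ?U ?E"
  proof (rule rmod_homI)
    note h = restr_hom[of a "Suc c" "Suc c" d n] restr_hom[of g "Suc c" d d n]
    fix x assume x: "x \<in> carrier ?U"
    show "i x \<in> carrier ?E" using rmod_hom_closed[OF h(1) x] rmod_hom_closed[OF h(2) x] assms
      by (auto simp: i_def direct_sum_Cons direct_sum_Nil)
    fix y assume y: "y \<in> carrier ?U"
    show "i (x \<oplus>\<^bsub>?U\<^esub> y) = i x \<oplus>\<^bsub>?E\<^esub> i y"
      using rmod_hom_add[OF h(1) x y] rmod_hom_add[OF h(2) x y] assms
      by (auto simp: i_def direct_sum_Cons add_direct_sum_Nil)
  next
    note h = restr_hom[of a "Suc c" "Suc c" d n] restr_hom[of g "Suc c" d d n]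
    fix x \<alpha> assume x: "x \<in> carrier ?U" and \<alpha>: "\<alpha> \<in> carrier ?A"
    show "i (x \<cdot>\<^bsub>?U\<^esub> \<alpha>) = i x \<cdot>\<^bsub>?E\<^esub> \<alpha>"
      using rmod_hom_ract[OF h(1) x \<alpha>] rmod_hom_ract[OF h(2) x \<alpha>] assms
      by (auto simp: i_def direct_sum_Cons ract_direct_sum_Nil)
  qed
  have p: "p \<in> rmod_hom ?A ?E ?V"
  proof (rule rmod_homI)
    note h = restr_hom[of g a "Suc c" "Suc c" n] restr_hom[of g g "Suc c" d n]
      restr_hom[of a a c "Suc c" n]
    fix z assume "z \<in> carrier ?E"
    then obtain x y where z': "z = [x, y]" and x: "x \<in> carrier (imod a (Suc c))" and y: "y \<in> carrier (imod g d)"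
      by (auto simp: direct_sum_Cons direct_sum_Nil)
    show "p z \<in> carrier ?V"
      using x y assms by (auto simp: p_def z' direct_sum_Cons direct_sum_Nil imod_simps restr_def split: if_splits)
    fix \<alpha> assume \<alpha>: "\<alpha> \<in> carrier ?A"
    have "restr g (Suc c) x \<cdot>\<^bsub>imod g (Suc c)\<^esub> \<alpha> = restr g (Suc c) (x \<cdot>\<^bsub>imod a (Suc c)\<^esub> \<alpha>)"
      "restr g (Suc c) y \<cdot>\<^bsub>imod g (Suc c)\<^esub> \<alpha> = restr g (Suc c) (y \<cdot>\<^bsub>imod g d\<^esub> \<alpha>)"
      "restr a c x \<cdot>\<^bsub>imod a c\<^esub> \<alpha> = restr a c (x \<cdot>\<^bsub>imod a (Suc c)\<^esub> \<alpha>)"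
      using rmod_hom_ract[OF h(1) x \<alpha>] rmod_hom_ract[OF h(2) y \<alpha>] rmod_hom_ract[OF h(3) x \<alpha>] assms
      by auto
    moreover have "(\<lambda>v. r v - s v) \<cdot>\<^bsub>imod g (Suc c)\<^esub> \<alpha> =
      (\<lambda>v. (r \<cdot>\<^bsub>imod g (Suc c)\<^esub> \<alpha>) v - (s \<cdot>\<^bsub>imod g (Suc c)\<^esub> \<alpha>) v)" for r s :: "nat \<Rightarrow> 'k"
      by (simp add: imod_simps fun_eq_iff left_diff_distrib sum_subtractf)
    ultimately show "p (z \<cdot>\<^bsub>?E\<^esub> \<alpha>) = p z \<cdot>\<^bsub>?V\<^esub> \<alpha>"
      by (simp add: p_def z' ract_direct_sum_Cons ract_direct_sum_Nil)
  next
    fix z z' assume "z \<in> carrier ?E" "z' \<in> carrier ?E"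
    then show "p (z \<oplus>\<^bsub>?E\<^esub> z') = p z \<oplus>\<^bsub>?V\<^esub> p z'"
      by (auto simp: p_def direct_sum_Cons direct_sum_Nil add_direct_sum_Nil imod_simps(3) restr_def fun_eq_iff)
  qed
  have "inj_on i (carrier ?U)"
    using assms by (auto simp: inj_on_def i_def restr_id)
  moreover have "i ` carrier ?U = {z \<in> carrier ?E. p z = \<zero>\<^bsub>?V\<^esub>}"
  proof (rule equalityI; rule subsetI)
    fix z assume "z \<in> i ` carrier ?U"
    then obtain u where u: "u \<in> carrier ?U" "z = i u" by auto
    moreover have "i u \<in> carrier ?E" by (rule rmod_hom_closed[OF i u(1)])
    ultimately show "z \<in> {z \<in> carrier ?E. p z = \<zero>\<^bsub>?V\<^esub>}"
      using assms by (fastforce simp: i_def p_def direct_sum_Cons direct_sum_Nil imod_simps restr_def fun_eq_iff)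
  next
    fix z assume E: "z \<in> {z \<in> carrier ?E. p z = \<zero>\<^bsub>?V\<^esub>}"
    then obtain x y where z: "z = [x, y]" and x: "\<And>v. x v \<noteq> 0 \<Longrightarrow> a \<le> v \<and> v \<le> Suc c"
      and y: "\<And>v. y v \<noteq> 0 \<Longrightarrow> g \<le> v \<and> v \<le> d"
      by (auto simp: direct_sum_Cons direct_sum_Nil imod_simps)
    have "restr g (Suc c) x v = restr g (Suc c) y v" "restr a c x v = 0" for v
      using E by (auto simp: z p_def direct_sum_Cons direct_sum_Nil imod_simps fun_eq_iff)
    then have e: "g \<le> v \<Longrightarrow> v \<le> Suc c \<Longrightarrow> x v = y v"
      and e': "a \<le> v \<Longrightarrow> v \<le> c \<Longrightarrow> x v = 0" for v
      by (metis restr_def)+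
    have yU: "y \<in> carrier ?U"
      unfolding imod_simps
    proof (intro allI impI)
      fix v assume v: "y v \<noteq> 0"
      have "\<not> v \<le> c"
      proof
        assume "v \<le> c"
        then have "x v \<noteq> 0" using e[of v] y[OF v] v by auto
        then show False using e'[of v] x[of v] \<open>v \<le> c\<close> by auto
      qed
      then show "Suc c \<le> v \<and> v \<le> d" using y[OF v] by auto
    qed
    have "restr a (Suc c) y = x"
    proof
      fix v show "restr a (Suc c) y v = x v"
        using e[of v] x[of v] assms by (auto simp: restr_def)
    qed
    moreover have "restr g d y = y" using y by (auto simp: restr_def fun_eq_iff)
    ultimately show "z \<in> i ` carrier ?U" using yU by (auto simp: i_def z image_iff)
  qed
  moreover have "p ` carrier ?E = carrier ?V"
  proof (rule equalityI; rule subsetI)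
    fix z assume "z \<in> p ` carrier ?E" then show "z \<in> carrier ?V" using rmod_hom_closed[OF p] by auto
  next
    fix z assume "z \<in> carrier ?V"
    then obtain s t where z: "z = [s, t]" and s: "\<And>v. s v \<noteq> 0 \<Longrightarrow> g \<le> v \<and> v \<le> Suc c"
      and t: "\<And>v. t v \<noteq> 0 \<Longrightarrow> a \<le> v \<and> v \<le> c"
      by (auto simp: direct_sum_Cons direct_sum_Nil imod_simps)
    \<comment> \<open>With \<open>t\<close> as first entry the second component is right; the second
      entry is then chosen so that the difference is \<open>s\<close>.\<close>
    let ?y = "\<lambda>v. t v - s v"
    have y: "?y v \<noteq> 0 \<Longrightarrow> g \<le> v \<and> v \<le> Suc c" for v
      using s[of v] t[of v] assms by (cases "s v = 0") auto
    have "[t, ?y] \<in> carrier ?E"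
      using t y assms by (fastforce simp: direct_sum_Cons direct_sum_Nil imod_simps)
    moreover have "p [t, ?y] = z"
      using s t assms by (fastforce simp: p_def z restr_def fun_eq_iff)
    ultimately show "z \<in> p ` carrier ?E" by force
  qed
  ultimately show ?thesis
    unfolding short_exact_def by (intro bexI[OF _ i] bexI[OF _ p] conjI)
qed

section \<open>Decomposition into interval modules\<close>

lemma rmod_hom_inj_onI:
  assumes M: "right_module R M" and N: "right_module R N" and f: "f \<in> rmod_hom R M N"
    and ker: "\<And>x. x \<in> carrier M \<Longrightarrow> f x = \<zero>\<^bsub>N\<^esub> \<Longrightarrow> x = \<zero>\<^bsub>M\<^esub>"
  shows "inj_on f (carrier M)"
proof (rule inj_onI)
  interpret M: right_module R M by fact
  interpret N: right_module R N by fact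
  fix x y assume xy: "x \<in> carrier M" "y \<in> carrier M" "f x = f y"
  have "f (x \<ominus>\<^bsub>M\<^esub> y) = \<zero>\<^bsub>N\<^esub>"
    using xy rmod_hom_closed[OF f] by (simp add: rmod_hom_minus[OF M N f]) (simp add: a_minus_def N.M.r_neg)
  then have "x \<ominus>\<^bsub>M\<^esub> y = \<zero>\<^bsub>M\<^esub>" using ker xy by simp
  then show "x = y" using M.M.minus_equality[of x "\<ominus>\<^bsub>M\<^esub> y"] xy by (simp add: a_minus_def)
qed

lemma nth_direct_sum:
  assumes "i < length Ms"
  shows "(xs \<oplus>\<^bsub>direct_sum Ms\<^esub> ys) ! i = xs ! i \<oplus>\<^bsub>Ms ! i\<^esub> ys ! i"
    and "(xs \<cdot>\<^bsub>direct_sum Ms\<^esub> a) ! i = xs ! i \<cdot>\<^bsub>Ms ! i\<^esub> a"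
    and "\<zero>\<^bsub>direct_sum Ms\<^esub> ! i = \<zero>\<^bsub>Ms ! i\<^esub>"
  using assms by (simp_all add: direct_sum_def)

lemma nth_direct_sum_closed:
  "xs \<in> carrier (direct_sum Ms) \<Longrightarrow> i < length Ms \<Longrightarrow> xs ! i \<in> carrier (Ms ! i)"
  by (auto simp: direct_sum_def list_all2_conv_all_nth)

lemma direct_sum_eq_zeroI:
  assumes "xs \<in> carrier (direct_sum Ms)" "\<And>i. i < length Ms \<Longrightarrow> xs ! i = \<zero>\<^bsub>Ms ! i\<^esub>"
  shows "xs = \<zero>\<^bsub>direct_sum Ms\<^esub>"
  using assms by (auto simp: direct_sum_def list_all2_conv_all_nth intro: nth_equalityI)

lemma row_mult_vertex:
  assumes "1 \<le> w" "w \<le> n"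
  shows "row n a f \<otimes>\<^bsub>lin_algebra n\<^esub> lpath n w w = row n a (\<lambda>v. if v = w then f w else 0)"
  unfolding row_mult[OF lpath_closed]
proof (rule row_cong)
  fix v assume v: "a \<le> v"
  have "(\<Sum>x=a..v. f x * entry (lpath n w w) x v) = (\<Sum>x=a..v. if x = w then (if v = w then f w else 0) else 0)"
    using assms by (intro sum.cong) (auto simp: lpath_def entry_row)
  then show "(\<Sum>x=a..v. f x * entry (lpath n w w) x v) = (if v = w then f w else 0)"
    using v by (auto simp: sum.delta)
qed

text \<open>A jointly surjective family of maps from intervals to \<open>M\<close>:
  \<open>x l\<close> is the image of the basis vector at \<open>a l\<close>, and it is killed by all
  paths from \<open>a l\<close> that go beyond \<open>b l\<close>. If \<open>b l < a l\<close>, this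
  forces \<open>x l\<close> to be zero.\<close>

definition interval_generators ::
  "nat \<Rightarrow> ((nat, nat) path \<Rightarrow> 'k::field, 'b) rmodule \<Rightarrow> nat \<Rightarrow> (nat \<Rightarrow> 'b) \<Rightarrow> (nat \<Rightarrow> nat) \<Rightarrow> (nat \<Rightarrow> nat) \<Rightarrow> bool"
  where "interval_generators n M r x a b \<longleftrightarrow>
    (\<forall>l<r. x l \<in> carrier M \<and> 1 \<le> a l \<and> a l \<le> n \<and> b l \<le> n \<and> x l \<cdot>\<^bsub>M\<^esub> lpath n (a l) (a l) = x l \<and>
      (\<forall>f. (\<forall>v \<le> b l. f v = 0) \<longrightarrow> x l \<cdot>\<^bsub>M\<^esub> row n (a l) f = \<zero>\<^bsub>M\<^esub>)) \<and>
    (\<forall>T. rsubmodule (lin_algebra n) M T \<longrightarrow> x ` {..<r} \<subseteq> T \<longrightarrow> carrier M \<subseteq> T)"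

text \<open>Every generator splits into its components at the vertices. Initially all ends are
  \<open>n\<close>, since no path leads further.\<close>

lemma interval_generators_exist:
  fixes M :: "((nat, nat) path \<Rightarrow> 'k::field, 'b) rmodule"
  assumes M: "right_module (lin_algebra n) M" and fg: "finitely_generated (lin_algebra n) M"
  shows "\<exists>r x a b. interval_generators n M r x a b"
proof -
  let ?A = "lin_algebra n :: ((nat, nat) path \<Rightarrow> 'k) ring"
  interpret M: right_module ?A M by fact
  obtain S where S: "finite S" "S \<subseteq> carrier M"
    and gen: "\<And>T. rsubmodule ?A M T \<Longrightarrow> S \<subseteq> T \<Longrightarrow> carrier M \<subseteq> T"
    using fg unfolding finitely_generated_iff[OF M] by blast
  have fin: "finite (S \<times> {1..n})" using S by simp
  obtain e :: "nat \<Rightarrow> 'b \<times> nat" and r where e: "bij_betw e {0..<r} (S \<times> {1..n})"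
    using ex_bij_betw_nat_finite[OF fin] by blast
  define x where "x l = fst (e l) \<cdot>\<^bsub>M\<^esub> lpath n (snd (e l)) (snd (e l))" for l
  have el: "fst (e l) \<in> carrier M" "1 \<le> snd (e l)" "snd (e l) \<le> n" if "l < r" for l
  proof -
    have "e l \<in> S \<times> {1..n}" using bij_betwE[OF e] that by auto
    then show "fst (e l) \<in> carrier M" "1 \<le> snd (e l)" "snd (e l) \<le> n" using S(2) by auto
  qed
  have "carrier M \<subseteq> T" if T: "rsubmodule ?A M T" "x ` {..<r} \<subseteq> T" for T
  proof (rule gen[OF T(1)], rule subsetI)
    fix s assume s: "s \<in> S"
    have sM: "s \<in> carrier M" using s S(2) by blast
    have idem: "s \<cdot>\<^bsub>M\<^esub> lpath n i i \<in> T" if "1 \<le> i" "i \<le> n" for i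
    proof -
      have "(s, i) \<in> e ` {0..<r}" using e s that by (simp add: bij_betw_def)
      then obtain l where "l < r" "e l = (s, i)" by auto
      then show ?thesis using T(2) by (auto simp: x_def)
    qed
    \<comment> \<open>\<open>\<alpha>\<close> is the sum of the idempotents at the vertices up to
      \<open>j\<close>; for \<open>j = n\<close> it is the unit, which recovers \<open>s\<close>
      from its components.\<close>
    have "\<exists>\<alpha> \<in> carrier ?A. s \<cdot>\<^bsub>M\<^esub> \<alpha> \<in> T \<and>
        (\<forall>u w. entry \<alpha> u w = (if 1 \<le> u \<and> u \<le> j \<and> u = w then 1 else 0))" if "j \<le> n" for j
      using that
    proof (induction j)
      case 0
      then show ?case
        using T(1) sM by (intro bexI[of _ "\<zero>\<^bsub>?A\<^esub>"]) (auto simp: M.ract_zero entry_zero rsubmodule_def)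
    next
      case (Suc j)
      then obtain \<alpha> where \<alpha>: "\<alpha> \<in> carrier ?A" "s \<cdot>\<^bsub>M\<^esub> \<alpha> \<in> T"
        "\<And>u w. entry \<alpha> u w = (if 1 \<le> u \<and> u \<le> j \<and> u = w then 1 else 0)" by auto
      have "s \<cdot>\<^bsub>M\<^esub> (\<alpha> \<oplus>\<^bsub>?A\<^esub> lpath n (Suc j) (Suc j)) \<in> T"
        using \<alpha>(1,2) sM idem[of "Suc j"] Suc.prems T(1)
        by (simp add: M.ract_add_right lpath_closed rsubmodule_def)
      then show ?case
        using \<alpha> Suc.prems
        by (intro bexI[of _ "\<alpha> \<oplus>\<^bsub>?A\<^esub> lpath n (Suc j) (Suc j)"])
          (auto simp: entry_add lpath_def entry_row row_closed)
    qed
    from this[OF order_refl] obtain \<alpha> where \<alpha>: "\<alpha> \<in> carrier ?A" "s \<cdot>\<^bsub>M\<^esub> \<alpha> \<in> T"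
        "\<And>u w. entry \<alpha> u w = (if 1 \<le> u \<and> u \<le> n \<and> u = w then 1 else 0)" by auto
    have "\<alpha> = \<one>\<^bsub>?A\<^esub>" by (rule lin_algebra_eqI[OF \<alpha>(1)]) (auto simp: \<alpha>(3) entry_one)
    then show "s \<in> T" using \<alpha>(2) sM by (simp add: M.ract_one)
  qed
  moreover have "x l \<cdot>\<^bsub>M\<^esub> lpath n (snd (e l)) (snd (e l)) = x l" if "l < r" for l
    using el[OF that] by (simp add: x_def M.ract_mult[symmetric] lpath_closed lpath_mult)
  moreover have "x l \<cdot>\<^bsub>M\<^esub> row n (snd (e l)) f = \<zero>\<^bsub>M\<^esub>" if "l < r" "\<forall>v\<le>n. f v = 0" for l f
  proof -
    have "row n (snd (e l)) f = \<zero>\<^bsub>?A\<^esub>" using that(2) by (subst row_zero[symmetric]) (auto intro: row_cong)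
    then show ?thesis using el[OF that(1)] by (simp add: x_def M.ract_zero M.ract_closed lpath_closed)
  qed
  ultimately have "interval_generators n M r x (\<lambda>l. snd (e l)) (\<lambda>_. n)"
    using el unfolding interval_generators_def by (auto simp: x_def M.ract_closed lpath_closed)
  then show ?thesis by blast
qed

section \<open>The map from a sum of intervals given by interval generators\<close>

context
  fixes n :: nat and M :: "((nat, nat) path \<Rightarrow> 'k::field, 'b) rmodule" and r x a b
  assumes M: "right_module (lin_algebra n) M" and gens: "interval_generators n M r x a b"
begin

interpretation M: right_module "lin_algebra n" M by (rule M)

lemma
  assumes "l < r"
  shows gen_closed: "x l \<in> carrier M" and gen_start: "1 \<le> a l" "a l \<le> n" and gen_end: "b l \<le> n"
    and gen_vertex: "x l \<cdot>\<^bsub>M\<^esub> lpath n (a l) (a l) = x l"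
    and gen_kill: "(\<And>v. v \<le> b l \<Longrightarrow> f v = 0) \<Longrightarrow> x l \<cdot>\<^bsub>M\<^esub> row n (a l) f = \<zero>\<^bsub>M\<^esub>"
  using gens assms unfolding interval_generators_def by auto

lemma gen_spans: "rsubmodule (lin_algebra n) M T \<Longrightarrow> x ` {..<r} \<subseteq> T \<Longrightarrow> carrier M \<subseteq> T"
  using gens unfolding interval_generators_def by blast

text \<open>The difference of the two rows is supported beyond \<open>b l\<close> and hence kills
  \<open>x l\<close>. This reconciles the full rows of the algebra with the cut-off action on an
  interval.\<close>

lemma gen_row_cong:
  assumes l: "l < r" and fg: "\<And>v. a l \<le> v \<Longrightarrow> v \<le> b l \<Longrightarrow> f v = g v"
  shows "x l \<cdot>\<^bsub>M\<^esub> row n (a l) f = x l \<cdot>\<^bsub>M\<^esub> row n (a l) g"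
proof -
  let ?d = "\<lambda>v. if v \<le> b l then 0 else f v - g v"
  have "row n (a l) f = row n (a l) g \<oplus>\<^bsub>lin_algebra n\<^esub> row n (a l) ?d"
    unfolding row_add by (rule row_cong) (auto simp: fg)
  then show ?thesis
    using gen_closed[OF l] gen_kill[OF l, of ?d] by (simp add: M.ract_add_right row_closed M.ract_closed)
qed

definition gen_map :: "(nat \<Rightarrow> 'k) list \<Rightarrow> 'b" where
  "gen_map fs = (\<Oplus>\<^bsub>M\<^esub>l\<in>{..<r}. x l \<cdot>\<^bsub>M\<^esub> row n (a l) (fs ! l))"

definition gen_source :: "((nat, nat) path \<Rightarrow> 'k, (nat \<Rightarrow> 'k) list) rmodule" where
  "gen_source = direct_sum (map (\<lambda>l. imod (a l) (b l)) [0..<r])"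

lemma gen_term_closed: "l < r \<Longrightarrow> x l \<cdot>\<^bsub>M\<^esub> row n c f \<in> carrier M"
  by (simp add: M.ract_closed gen_closed row_closed)

lemma right_module_gen_source: "right_module (lin_algebra n) gen_source"
  unfolding gen_source_def
  by (rule right_module_direct_sum) (auto intro!: right_module_imod ring_lin_algebra gen_start gen_end)

lemma gen_source_nth:
  assumes "fs \<in> carrier gen_source" "l < r" "(fs ! l) v \<noteq> 0" shows "a l \<le> v" "v \<le> b l"
  using nth_direct_sum_closed[OF assms(1)[unfolded gen_source_def], of l] assms(2,3)
  by (auto simp: imod_simps)

lemma gen_map_hom: "gen_map \<in> rmod_hom (lin_algebra n) gen_source M"
proof (rule rmod_homI)
  fix fs gs assume "fs \<in> carrier gen_source" "gs \<in> carrier gen_source"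
  have "gen_map (fs \<oplus>\<^bsub>gen_source\<^esub> gs) =
    (\<Oplus>\<^bsub>M\<^esub>l\<in>{..<r}. x l \<cdot>\<^bsub>M\<^esub> row n (a l) (fs ! l) \<oplus>\<^bsub>M\<^esub> x l \<cdot>\<^bsub>M\<^esub> row n (a l) (gs ! l))"
    unfolding gen_map_def
    by (rule M.M.finsum_cong') (auto simp: gen_source_def nth_direct_sum imod_simps gen_term_closed
        M.ract_add_right[symmetric] gen_closed row_closed row_add)
  also have "\<dots> = gen_map fs \<oplus>\<^bsub>M\<^esub> gen_map gs"
    unfolding gen_map_def by (rule M.M.finsum_addf) (auto simp: gen_term_closed)
  finally show "gen_map (fs \<oplus>\<^bsub>gen_source\<^esub> gs) = gen_map fs \<oplus>\<^bsub>M\<^esub> gen_map gs" .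
next
  fix fs \<alpha> assume fs: "fs \<in> carrier gen_source" and \<alpha>: "\<alpha> \<in> carrier (lin_algebra n :: ((nat, nat) path \<Rightarrow> 'k) ring)"
  have "gen_map fs \<cdot>\<^bsub>M\<^esub> \<alpha> = (\<Oplus>\<^bsub>M\<^esub>l\<in>{..<r}. x l \<cdot>\<^bsub>M\<^esub> row n (a l) (fs ! l) \<cdot>\<^bsub>M\<^esub> \<alpha>)"
    unfolding gen_map_def by (rule M.finsum_ract) (auto simp: gen_term_closed \<alpha>)
  also have "\<dots> = gen_map (fs \<cdot>\<^bsub>gen_source\<^esub> \<alpha>)"
    unfolding gen_map_def
  proof (rule M.M.finsum_cong')
    fix l assume "l \<in> {..<r}"
    then have l: "l < r" by simp
    have "x l \<cdot>\<^bsub>M\<^esub> row n (a l) (fs ! l) \<cdot>\<^bsub>M\<^esub> \<alpha> =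
        x l \<cdot>\<^bsub>M\<^esub> row n (a l) (\<lambda>w. \<Sum>v=a l..w. (fs ! l) v * entry \<alpha> v w)"
      by (simp add: M.ract_mult[symmetric] gen_closed l row_closed \<alpha> row_mult)
    \<comment> \<open>The row product has coefficients at all later vertices, whereas the interval
      drops those after \<open>b l\<close>; only the coefficients up to \<open>b l\<close>
      matter.\<close>
    also have "\<dots> = x l \<cdot>\<^bsub>M\<^esub> row n (a l) ((fs \<cdot>\<^bsub>gen_source\<^esub> \<alpha>) ! l)"
    proof (rule gen_row_cong[OF l])
      fix w assume w: "a l \<le> w" "w \<le> b l"
      have "(\<Sum>v=a l..w. (fs ! l) v * entry \<alpha> v w) = (\<Sum>v\<le>w. (fs ! l) v * entry \<alpha> v w)"
        by (rule sum.mono_neutral_left) (auto dest: contrapos_nn[OF _ gen_source_nth(1)[OF fs l]])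
      then show "(\<Sum>v=a l..w. (fs ! l) v * entry \<alpha> v w) = ((fs \<cdot>\<^bsub>gen_source\<^esub> \<alpha>) ! l) w"
        using l w by (simp add: gen_source_def nth_direct_sum imod_simps)
    qed
    finally show "x l \<cdot>\<^bsub>M\<^esub> row n (a l) (fs ! l) \<cdot>\<^bsub>M\<^esub> \<alpha> = x l \<cdot>\<^bsub>M\<^esub> row n (a l) ((fs \<cdot>\<^bsub>gen_source\<^esub> \<alpha>) ! l)" .
  qed (auto simp: gen_term_closed)
  finally show "gen_map (fs \<cdot>\<^bsub>gen_source\<^esub> \<alpha>) = gen_map fs \<cdot>\<^bsub>M\<^esub> \<alpha>" by simp
qed (auto simp: gen_map_def gen_term_closed)

lemma gen_map_surj: "gen_map ` carrier gen_source = carrier M"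
proof
  show "gen_map ` carrier gen_source \<subseteq> carrier M" using rmod_hom_closed[OF gen_map_hom] by blast
  show "carrier M \<subseteq> gen_map ` carrier gen_source"
  proof (rule gen_spans[OF rsubmodule_image[OF right_module_gen_source M gen_map_hom]], rule subsetI)
    fix z assume "z \<in> x ` {..<r}"
    then obtain l where l: "l < r" and z: "z = x l" by auto
    \<comment> \<open>The basis vector at the start of the interval \<open>l\<close>. It is 0 for an
      empty interval, in agreement with \<open>x l\<close> being zero then.\<close>
    define fs where "fs = map (\<lambda>k v. if k = l \<and> v = a l \<and> a l \<le> b l then 1 else (0 :: 'k)) [0..<r]"
    have "fs \<in> carrier gen_source"
      by (auto simp: fs_def gen_source_def direct_sum_def list_all2_conv_all_nth imod_simps)
    moreover have "gen_map fs = x l"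
    proof -
      have "gen_map fs = (\<Oplus>\<^bsub>M\<^esub>k\<in>{..<r}. if l = k then x k else \<zero>\<^bsub>M\<^esub>)"
        unfolding gen_map_def
      proof (rule M.M.finsum_cong')
        fix k assume "k \<in> {..<r}"
        then have k: "k < r" by simp
        show "x k \<cdot>\<^bsub>M\<^esub> row n (a k) (fs ! k) = (if l = k then x k else \<zero>\<^bsub>M\<^esub>)"
        proof (cases "l = k")
          case True
          have "x k \<cdot>\<^bsub>M\<^esub> row n (a k) (fs ! k) = x k \<cdot>\<^bsub>M\<^esub> lpath n (a k) (a k)"
            unfolding lpath_def by (rule gen_row_cong[OF k]) (use True k in \<open>auto simp: fs_def\<close>)
          then show ?thesis using True gen_vertex[OF k] by simp
        next
          case False
          then show ?thesis using k by (simp add: fs_def row_zero M.ract_zero gen_closed)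
        qed
      qed (auto simp: gen_closed)
      also have "\<dots> = x l"
        using M.M.finsum_singleton[of l "{..<r}" x] l gen_closed by auto
      finally show ?thesis .
    qed
    ultimately show "z \<in> gen_map ` carrier gen_source" by (metis imageI z)
  qed
qed

text \<open>A relation at the vertex \<open>w\<close> among the generators lets us correct the one among those involved
  that starts last, so that it is already killed at \<open>w\<close>.\<close>

lemma gen_shrink:
  assumes fs: "fs \<in> carrier gen_source" "gen_map fs = \<zero>\<^bsub>M\<^esub>" "fs \<noteq> \<zero>\<^bsub>gen_source\<^esub>"
  shows "\<exists>x' b'. interval_generators n M r x' a b' \<and> sum b' {..<r} < sum b {..<r}"
proof -
  let ?A = "lin_algebra n :: ((nat, nat) path \<Rightarrow> 'k) ring"
  obtain k0 where k0: "k0 < r" "fs ! k0 \<noteq> (\<lambda>_. 0)"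
    using direct_sum_eq_zeroI[of fs "map (\<lambda>l. imod (a l) (b l)) [0..<r]"] fs(1,3)
    by (auto simp: gen_source_def imod_simps)
  then obtain w where w: "(fs ! k0) w \<noteq> 0" by (auto simp: fun_eq_iff)
  define c where "c k = (fs ! k) w" for k
  define L where "L = {k. k < r \<and> c k \<noteq> 0}"
  have L: "finite L" "L \<noteq> {}" using k0 w by (auto simp: L_def c_def)
  \<comment> \<open>Since every involved generator starts no later than \<open>a l\<close>, and
    \<open>a l \<le> w\<close>, the paths from these generators to \<open>w\<close> all factor
    through \<open>a l\<close>.\<close>
  obtain l where l: "l \<in> L" and max: "\<And>k. k \<in> L \<Longrightarrow> a k \<le> a l"
    using Max_in[of "a ` L"] Max_ge[of "a ` L"] L by fastforce
  have lr: "l < r" and cl: "c l \<noteq> 0" using l by (auto simp: L_def)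
  have Lw: "a k \<le> w" "w \<le> b k" if "k \<in> L" for k
    using gen_source_nth[OF fs(1), of k w] that by (auto simp: L_def c_def)
  have wn: "1 \<le> w" "w \<le> n" using Lw[OF l] gen_start[OF lr] gen_end[OF lr] by auto
  \<comment> \<open>\<open>h k\<close> is the part of the relation at the vertex \<open>w\<close>.
    Removing the common final path from \<open>a l\<close> to \<open>w\<close> and normalising the
    coefficient of \<open>x l\<close> to 1 gives \<open>g k\<close>, so the corrected generator
    \<open>y\<close> is \<open>x l\<close> plus multiples of the others, carried to
    \<open>a l\<close>.\<close>
  define h where "h k = row n (a k) (\<lambda>v. if v = w then c k else 0)" for k
  define g where "g k = row n (a k) (\<lambda>v. if v = a l then c k / c l else 0)" for k
  define y where "y = (\<Oplus>\<^bsub>M\<^esub>k\<in>{..<r}. x k \<cdot>\<^bsub>M\<^esub> g k)"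
  have hA: "h k \<in> carrier ?A" and gA: "g k \<in> carrier ?A" for k
    by (auto simp: h_def g_def row_closed)
  have xh: "x k \<cdot>\<^bsub>M\<^esub> h k \<in> carrier M" and xg: "x k \<cdot>\<^bsub>M\<^esub> g k \<in> carrier M" if "k < r" for k
    using that by (auto simp: M.ract_closed gen_closed hA gA)
  have y: "y \<in> carrier M" unfolding y_def by (auto simp: xg)
  have rel: "(\<Oplus>\<^bsub>M\<^esub>k\<in>{..<r}. x k \<cdot>\<^bsub>M\<^esub> h k) = \<zero>\<^bsub>M\<^esub>"
  proof -
    have "(\<Oplus>\<^bsub>M\<^esub>k\<in>{..<r}. x k \<cdot>\<^bsub>M\<^esub> h k) = (\<Oplus>\<^bsub>M\<^esub>k\<in>{..<r}. x k \<cdot>\<^bsub>M\<^esub> row n (a k) (fs ! k) \<cdot>\<^bsub>M\<^esub> lpath n w w)"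
      unfolding h_def c_def
      by (rule M.M.finsum_cong') (auto simp: M.ract_mult[symmetric] gen_closed row_closed lpath_closed
          row_mult_vertex[OF wn] gen_term_closed M.ract_closed)
    also have "\<dots> = gen_map fs \<cdot>\<^bsub>M\<^esub> lpath n w w"
      unfolding gen_map_def by (rule M.finsum_ract[symmetric]) (auto simp: gen_term_closed lpath_closed)
    finally show ?thesis using fs(2) by (simp add: M.zero_ract lpath_closed)
  qed
  have g_vertex: "g k \<otimes>\<^bsub>?A\<^esub> lpath n (a l) (a l) = g k" for k
    unfolding g_def row_mult_vertex[OF gen_start[OF lr]] by (rule row_cong) simp
  have y_vertex: "y \<cdot>\<^bsub>M\<^esub> lpath n (a l) (a l) = y"
  proof -
    have "y \<cdot>\<^bsub>M\<^esub> lpath n (a l) (a l) = (\<Oplus>\<^bsub>M\<^esub>k\<in>{..<r}. x k \<cdot>\<^bsub>M\<^esub> g k \<cdot>\<^bsub>M\<^esub> lpath n (a l) (a l))"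
      unfolding y_def by (rule M.finsum_ract) (auto simp: xg lpath_closed)
    also have "\<dots> = y"
      unfolding y_def
      by (rule M.M.finsum_cong') (auto simp: M.ract_mult[symmetric] gen_closed gA lpath_closed xg g_vertex)
    finally show ?thesis .
  qed
  have y_kill: "y \<cdot>\<^bsub>M\<^esub> row n (a l) f = \<zero>\<^bsub>M\<^esub>" if f: "\<And>v. v \<le> w - 1 \<Longrightarrow> f v = 0" for f
  proof -
    \<comment> \<open>As \<open>f\<close> vanishes before \<open>w\<close>, only paths from
      \<open>a l\<close> through \<open>w\<close> occur; splitting them at \<open>w\<close> exposes
      the relation, which is zero. The new end is therefore \<open>w - 1\<close>.\<close>
    have gh: "g k \<otimes>\<^bsub>?A\<^esub> row n (a l) f = h k \<otimes>\<^bsub>?A\<^esub> row n w (\<lambda>v. f v / c l)" if k: "k < r" for k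
    proof (cases "k \<in> L")
      case True
      have "f v = 0" if "v < w" for v using f that by simp
      then show ?thesis
        unfolding g_def h_def using True max[OF True] Lw[OF True] Lw[OF l] wn gen_start[OF lr] cl
        by (subst row_mult_row, simp_all, subst row_mult_row) (auto intro!: row_cong simp: not_le)
    next
      case False
      then have "g k = \<zero>\<^bsub>?A\<^esub>" "h k = \<zero>\<^bsub>?A\<^esub>"
        using k unfolding g_def h_def row_zero[symmetric, of n "a k"] by (auto simp: L_def intro: row_cong)
      then show ?thesis by (simp add: row_closed ring.ring_simprules[OF ring_lin_algebra])
    qed
    have "y \<cdot>\<^bsub>M\<^esub> row n (a l) f = (\<Oplus>\<^bsub>M\<^esub>k\<in>{..<r}. x k \<cdot>\<^bsub>M\<^esub> g k \<cdot>\<^bsub>M\<^esub> row n (a l) f)"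
      unfolding y_def by (rule M.finsum_ract) (auto simp: xg row_closed)
    also have "\<dots> = (\<Oplus>\<^bsub>M\<^esub>k\<in>{..<r}. x k \<cdot>\<^bsub>M\<^esub> h k \<cdot>\<^bsub>M\<^esub> row n w (\<lambda>v. f v / c l))"
      by (rule M.M.finsum_cong')
        (auto simp: xh M.ract_closed row_closed M.ract_mult[symmetric] gen_closed gA hA gh)
    also have "\<dots> = (\<Oplus>\<^bsub>M\<^esub>k\<in>{..<r}. x k \<cdot>\<^bsub>M\<^esub> h k) \<cdot>\<^bsub>M\<^esub> row n w (\<lambda>v. f v / c l)"
      by (rule M.finsum_ract[symmetric]) (auto simp: xh row_closed)
    also have "\<dots> = \<zero>\<^bsub>M\<^esub>" unfolding rel by (rule M.zero_ract) (rule row_closed)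
    finally show ?thesis .
  qed
  \<comment> \<open>The coefficient of \<open>x l\<close> in \<open>y\<close> is 1, so the exchange
    of \<open>x l\<close> for \<open>y\<close> loses nothing of the span.\<close>
  have y_eq: "x l = y \<ominus>\<^bsub>M\<^esub> (\<Oplus>\<^bsub>M\<^esub>k\<in>{..<r} - {l}. x k \<cdot>\<^bsub>M\<^esub> g k)"
  proof -
    let ?s = "\<Oplus>\<^bsub>M\<^esub>k\<in>{..<r} - {l}. x k \<cdot>\<^bsub>M\<^esub> g k"
    have s: "?s \<in> carrier M" by (auto simp: xg)
    have "y = (\<Oplus>\<^bsub>M\<^esub>k\<in>insert l ({..<r} - {l}). x k \<cdot>\<^bsub>M\<^esub> g k)"
      unfolding y_def using lr by (simp add: insert_absorb)
    also have "\<dots> = x l \<cdot>\<^bsub>M\<^esub> g l \<oplus>\<^bsub>M\<^esub> ?s"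
      by (rule M.M.finsum_insert) (auto simp: xg lr)
    also have "g l = lpath n (a l) (a l)" unfolding g_def lpath_def using cl by (intro row_cong) simp
    also have "x l \<cdot>\<^bsub>M\<^esub> lpath n (a l) (a l) = x l" by (rule gen_vertex[OF lr])
    finally have "y = x l \<oplus>\<^bsub>M\<^esub> ?s" .
    then show ?thesis using s gen_closed[OF lr] by (simp add: a_minus_def M.M.a_assoc M.M.r_neg)
  qed
  have "carrier M \<subseteq> T" if T: "rsubmodule ?A M T" "(x(l := y)) ` {..<r} \<subseteq> T" for T
  proof (rule gen_spans[OF T(1)], rule subsetI)
    have xT: "x k \<in> T" if "k < r" "k \<noteq> l" for k using T(2) that by (force simp: image_subset_iff)
    have yT: "y \<in> T" using T(2) lr by (force simp: image_subset_iff)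
    have "(\<Oplus>\<^bsub>M\<^esub>k\<in>{..<r} - {l}. x k \<cdot>\<^bsub>M\<^esub> g k) \<in> T"
      by (rule rsubmodule_finsum[OF M T(1)]) (use T(1) xT gA in \<open>auto simp: rsubmodule_def\<close>)
    then have "x l \<in> T" unfolding y_eq by (rule rsubmodule_minus[OF M T(1) yT])
    moreover fix z assume "z \<in> x ` {..<r}"
    ultimately show "z \<in> T" using xT by auto
  qed
  then have "interval_generators n M r (x(l := y)) a (b(l := w - 1))"
    unfolding interval_generators_def
    using gen_closed gen_start gen_end gen_vertex gen_kill y y_vertex y_kill wn by auto
  \<comment> \<open>The decrease is strict because \<open>1 \<le> w\<close> and
    \<open>w \<le> b l\<close>.\<close>
  moreover have "sum (b(l := w - 1)) {..<r} < sum b {..<r}"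
    by (rule sum_strict_mono_ex1) (use Lw[OF l] lr wn in auto)
  ultimately show ?thesis by blast
qed

end

theorem interval_decomposition:
  fixes M :: "((nat, nat) path \<Rightarrow> 'k::field, 'b) rmodule"
  assumes M: "right_module (lin_algebra n) M" and fg: "finitely_generated (lin_algebra n) M"
  obtains js where "\<And>a b. (a, b) \<in> set js \<Longrightarrow> 1 \<le> a \<and> b \<le> n"
    and "rmod_isomorphic (lin_algebra n) (direct_sum (map (\<lambda>(a, b). imod a b) js)) M"
proof -
  obtain r x0 a b0 where g0: "interval_generators n M r x0 a b0"
    using interval_generators_exist[OF M fg] by blast
  \<comment> \<open>The number of generators and their starts stay fixed; only the generators and
    the ends vary in the minimisation. A nonzero kernel would contradict minimality by
    \<open>gen_shrink\<close>.\<close>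
  define P where "P k \<longleftrightarrow> (\<exists>x b. interval_generators n M r x a b \<and> sum b {..<r} = k)" for k
  have "P (sum b0 {..<r})" using g0 by (auto simp: P_def)
  then have "P (LEAST k. P k)" by (rule LeastI)
  then obtain x b where g: "interval_generators n M r x a b" and least: "sum b {..<r} = (LEAST k. P k)"
    by (auto simp: P_def)
  have min: "\<not> (\<exists>x' b'. interval_generators n M r x' a b' \<and> sum b' {..<r} < sum b {..<r})"
  proof
    assume "\<exists>x' b'. interval_generators n M r x' a b' \<and> sum b' {..<r} < sum b {..<r}"
    then obtain x' b' where *: "interval_generators n M r x' a b'" "sum b' {..<r} < (LEAST k. P k)"
      unfolding least by blast
    from *(1) have "P (sum b' {..<r})" by (auto simp: P_def)
    with *(2) show False using not_less_Least by blast
  qed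
  let ?D = "gen_source r a b :: ((nat, nat) path \<Rightarrow> 'k, (nat \<Rightarrow> 'k) list) rmodule"
  have "inj_on (gen_map n M r x a) (carrier ?D)"
    by (rule rmod_hom_inj_onI[OF right_module_gen_source[OF M g] M gen_map_hom[OF M g]])
      (use gen_shrink[OF M g] min in blast)
  then have "rmod_isomorphic (lin_algebra n) ?D M"
    using gen_map_hom[OF M g] gen_map_surj[OF M g] by (auto simp: rmod_isomorphic_def bij_betw_def)
  moreover have "?D = direct_sum (map (\<lambda>(a, b). imod a b) (map (\<lambda>l. (a l, b l)) [0..<r]))"
    unfolding gen_source_def[OF M g] by (simp add: comp_def)
  ultimately show ?thesis
    using gen_start[OF M g] gen_end[OF M g]
    by (intro that[of "map (\<lambda>l. (a l, b l)) [0..<r]"]) auto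
qed

section \<open>Invariants of the layers\<close>

lemma (in right_module) minus_ract:
  assumes "x \<in> carrier M" "y \<in> carrier M" "a \<in> carrier R"
  shows "(x \<ominus>\<^bsub>M\<^esub> y) \<cdot>\<^bsub>M\<^esub> a = x \<cdot>\<^bsub>M\<^esub> a \<ominus>\<^bsub>M\<^esub> y \<cdot>\<^bsub>M\<^esub> a"
  using assms by (simp add: a_minus_def minus_eq_ract ract_add_left ract_closed ract_mult[symmetric]
      R.l_minus R.r_minus)

lemma ract_zero_retract:
  assumes M: "right_module R M" and Us: "\<And>U. U \<in> set Us \<Longrightarrow> right_module R U"
    and ret: "rmod_retract R M (direct_sum Us)" and e: "e \<in> carrier R"
    and kill: "\<And>U x. U \<in> set Us \<Longrightarrow> x \<in> carrier U \<Longrightarrow> x \<cdot>\<^bsub>U\<^esub> e = \<zero>\<^bsub>U\<^esub>" and x: "x \<in> carrier M"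
  shows "x \<cdot>\<^bsub>M\<^esub> e = \<zero>\<^bsub>M\<^esub>"
proof -
  interpret M: right_module R M by fact
  have D: "right_module R (direct_sum Us)" by (rule right_module_direct_sum) (use Us M.R.ring_axioms in auto)
  interpret D: right_module R "direct_sum Us" by fact
  obtain i p where i: "i \<in> rmod_hom R M (direct_sum Us)" and p: "p \<in> rmod_hom R (direct_sum Us) M"
    and pi: "\<And>x. x \<in> carrier M \<Longrightarrow> p (i x) = x" using ret by (auto simp: rmod_retract_def)
  have ix: "i x \<in> carrier (direct_sum Us)" by (rule rmod_hom_closed[OF i x])
  have "i x \<cdot>\<^bsub>direct_sum Us\<^esub> e = \<zero>\<^bsub>direct_sum Us\<^esub>"
    by (rule direct_sum_eq_zeroI)
      (use ix e in \<open>auto simp: D.ract_closed nth_direct_sum intro!: kill nth_direct_sum_closed\<close>)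
  then have "p (i (x \<cdot>\<^bsub>M\<^esub> e)) = \<zero>\<^bsub>M\<^esub>"
    by (simp add: rmod_hom_ract[OF i x e] rmod_hom_zero[OF D M p])
  then show ?thesis using pi x e by (simp add: M.ract_closed)
qed

text \<open>If \<open>e\<close> is the idempotent at a vertex and \<open>a\<close> is the arrow out of it (into it), \<open>soc_free\<close>
  (\<open>top_free\<close>) says that the simple module at the vertex does not occur in the socle (top) of \<open>M\<close>.\<close>

definition soc_free :: "('a, 'b) rmodule \<Rightarrow> 'a \<Rightarrow> 'a \<Rightarrow> bool" where
  "soc_free M e a \<longleftrightarrow> (\<forall>x \<in> carrier M. x \<cdot>\<^bsub>M\<^esub> e = x \<longrightarrow> x \<cdot>\<^bsub>M\<^esub> a = \<zero>\<^bsub>M\<^esub> \<longrightarrow> x = \<zero>\<^bsub>M\<^esub>)"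

definition top_free :: "('a, 'b) rmodule \<Rightarrow> 'a \<Rightarrow> 'a \<Rightarrow> bool" where
  "top_free M e a \<longleftrightarrow> (\<forall>x \<in> carrier M. \<exists>y \<in> carrier M. x \<cdot>\<^bsub>M\<^esub> e = y \<cdot>\<^bsub>M\<^esub> a)"

lemma soc_free_retract:
  assumes M: "right_module R M" and Us: "\<And>U. U \<in> set Us \<Longrightarrow> right_module R U \<and> soc_free U e a"
    and ret: "rmod_retract R M (direct_sum Us)" and ea: "e \<in> carrier R" "a \<in> carrier R"
  shows "soc_free M e a"
  unfolding soc_free_def
proof (intro ballI impI)
  fix x assume x: "x \<in> carrier M" "x \<cdot>\<^bsub>M\<^esub> e = x" "x \<cdot>\<^bsub>M\<^esub> a = \<zero>\<^bsub>M\<^esub>"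
  interpret M: right_module R M by fact
  have D: "right_module R (direct_sum Us)" by (rule right_module_direct_sum) (use Us M.R.ring_axioms in auto)
  obtain i p where i: "i \<in> rmod_hom R M (direct_sum Us)" and p: "p \<in> rmod_hom R (direct_sum Us) M"
    and pi: "\<And>x. x \<in> carrier M \<Longrightarrow> p (i x) = x" using ret by (auto simp: rmod_retract_def)
  have ix: "i x \<in> carrier (direct_sum Us)" by (rule rmod_hom_closed[OF i x(1)])
  have ie: "i x \<cdot>\<^bsub>direct_sum Us\<^esub> e = i x" "i x \<cdot>\<^bsub>direct_sum Us\<^esub> a = \<zero>\<^bsub>direct_sum Us\<^esub>"
    using rmod_hom_ract[OF i x(1) ea(1)] rmod_hom_ract[OF i x(1) ea(2)] x rmod_hom_zero[OF M D i] by simp_all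
  have "i x = \<zero>\<^bsub>direct_sum Us\<^esub>"
  proof (rule direct_sum_eq_zeroI[OF ix])
    fix j assume j: "j < length Us"
    have "soc_free (Us ! j) e a" using Us j by simp
    moreover have "i x ! j \<cdot>\<^bsub>Us ! j\<^esub> e = i x ! j" using ie(1) nth_direct_sum(2)[OF j] by metis
    moreover have "i x ! j \<cdot>\<^bsub>Us ! j\<^esub> a = \<zero>\<^bsub>Us ! j\<^esub>" using ie(2) nth_direct_sum(2,3)[OF j] by metis
    ultimately show "i x ! j = \<zero>\<^bsub>Us ! j\<^esub>"
      using nth_direct_sum_closed[OF ix j] by (auto simp: soc_free_def)
  qed
  then have "p (i x) = \<zero>\<^bsub>M\<^esub>" by (simp add: rmod_hom_zero[OF D M p])
  then show "x = \<zero>\<^bsub>M\<^esub>" using pi x(1) by simp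
qed

text \<open>The elements fixed by \<open>e\<close> and killed by \<open>a\<close> depend on the
  module in a left exact way: if there are none but 0 in \<open>V\<close>, those of \<open>E\<close>
  come from \<open>U\<close>.\<close>

lemma soc_free_ext:
  assumes U: "right_module R U" "soc_free U e a" and E: "right_module R E"
    and V: "right_module R V" "soc_free V e a"
    and ex: "short_exact R U E V" and ea: "e \<in> carrier R" "a \<in> carrier R"
  shows "soc_free E e a"
  unfolding soc_free_def
proof (intro ballI impI)
  fix x assume x: "x \<in> carrier E" "x \<cdot>\<^bsub>E\<^esub> e = x" "x \<cdot>\<^bsub>E\<^esub> a = \<zero>\<^bsub>E\<^esub>"
  interpret U: right_module R U by (rule U)
  obtain f g where f: "f \<in> rmod_hom R U E" and g: "g \<in> rmod_hom R E V" and inj: "inj_on f (carrier U)"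
    and im: "f ` carrier U = {x \<in> carrier E. g x = \<zero>\<^bsub>V\<^esub>}"
    using ex by (auto simp: short_exact_def)
  note f0 = rmod_hom_zero[OF U(1) E f] and g0 = rmod_hom_zero[OF E V(1) g]
  have "g x \<cdot>\<^bsub>V\<^esub> e = g x" "g x \<cdot>\<^bsub>V\<^esub> a = \<zero>\<^bsub>V\<^esub>"
    using x by (simp_all add: rmod_hom_ract[OF g, symmetric] ea g0)
  then have "g x = \<zero>\<^bsub>V\<^esub>" using V(2) rmod_hom_closed[OF g x(1)] by (simp add: soc_free_def)
  then have "x \<in> f ` carrier U" unfolding im using x by simp
  then obtain u where u: "u \<in> carrier U" "x = f u" by auto
  have "f (u \<cdot>\<^bsub>U\<^esub> e) = f u" "f (u \<cdot>\<^bsub>U\<^esub> a) = f \<zero>\<^bsub>U\<^esub>"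
    using x u by (simp_all add: rmod_hom_ract[OF f] ea f0)
  then have "u \<cdot>\<^bsub>U\<^esub> e = u" "u \<cdot>\<^bsub>U\<^esub> a = \<zero>\<^bsub>U\<^esub>"
    using u ea by (auto intro!: inj_onD[OF inj] U.ract_closed)
  then have "u = \<zero>\<^bsub>U\<^esub>" using U(2) u(1) by (simp add: soc_free_def)
  then show "x = \<zero>\<^bsub>E\<^esub>" using u f0 by simp
qed

lemma top_free_retract:
  assumes M: "right_module R M" and Us: "\<And>U. U \<in> set Us \<Longrightarrow> right_module R U \<and> top_free U e a"
    and ret: "rmod_retract R M (direct_sum Us)" and ea: "e \<in> carrier R" "a \<in> carrier R"
  shows "top_free M e a"
  unfolding top_free_def
proof (intro ballI)
  fix x assume x: "x \<in> carrier M"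
  obtain i p where i: "i \<in> rmod_hom R M (direct_sum Us)" and p: "p \<in> rmod_hom R (direct_sum Us) M"
    and pi: "\<And>x. x \<in> carrier M \<Longrightarrow> p (i x) = x" using ret by (auto simp: rmod_retract_def)
  have ix: "i x \<in> carrier (direct_sum Us)" by (rule rmod_hom_closed[OF i x])
  have "\<exists>y \<in> carrier (Us ! j). (i x ! j) \<cdot>\<^bsub>Us ! j\<^esub> e = y \<cdot>\<^bsub>Us ! j\<^esub> a" if "j < length Us" for j
    using Us[of "Us ! j"] nth_direct_sum_closed[OF ix that] that by (auto simp: top_free_def)
  then obtain y where y: "\<And>j. j < length Us \<Longrightarrow> y j \<in> carrier (Us ! j)"
    "\<And>j. j < length Us \<Longrightarrow> (i x ! j) \<cdot>\<^bsub>Us ! j\<^esub> e = y j \<cdot>\<^bsub>Us ! j\<^esub> a" by metis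
  let ?y = "map y [0..<length Us]"
  have yD: "?y \<in> carrier (direct_sum Us)"
    using y(1) by (auto simp: direct_sum_def list_all2_conv_all_nth)
  have "i x \<cdot>\<^bsub>direct_sum Us\<^esub> e = ?y \<cdot>\<^bsub>direct_sum Us\<^esub> a"
    using y(2) by (auto simp: direct_sum_def)
  then have "p (i (x \<cdot>\<^bsub>M\<^esub> e)) = p ?y \<cdot>\<^bsub>M\<^esub> a"
    by (simp add: rmod_hom_ract[OF i x ea(1)] rmod_hom_ract[OF p yD ea(2)])
  moreover have "x \<cdot>\<^bsub>M\<^esub> e \<in> carrier M" using M ea x by (simp add: right_module.ract_closed)
  ultimately have "x \<cdot>\<^bsub>M\<^esub> e = p ?y \<cdot>\<^bsub>M\<^esub> a" using pi by simp
  then show "\<exists>y \<in> carrier M. x \<cdot>\<^bsub>M\<^esub> e = y \<cdot>\<^bsub>M\<^esub> a" using rmod_hom_closed[OF p yD] by blast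
qed

text \<open>Dual to the socle: solve the equation in \<open>V\<close>, lift the solution to
  \<open>y\<close>, and the error \<open>x e - y a\<close> lies in \<open>U\<close>. Because
  \<open>e\<close> is idempotent and \<open>a e = a\<close>, the error is fixed by \<open>e\<close>,
  so it can be solved for in \<open>U\<close>.\<close>

lemma top_free_ext:
  assumes U: "right_module R U" "top_free U e a" and E: "right_module R E"
    and V: "right_module R V" "top_free V e a"
    and ex: "short_exact R U E V" and ea: "e \<in> carrier R" "a \<in> carrier R"
    and ee: "e \<otimes>\<^bsub>R\<^esub> e = e" and ae: "a \<otimes>\<^bsub>R\<^esub> e = a"
  shows "top_free E e a"
  unfolding top_free_def
proof (intro ballI)
  fix x assume x: "x \<in> carrier E"
  interpret E: right_module R E by (rule E)
  interpret V: right_module R V by (rule V)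
  obtain f g where f: "f \<in> rmod_hom R U E" and g: "g \<in> rmod_hom R E V"
    and im: "f ` carrier U = {x \<in> carrier E. g x = \<zero>\<^bsub>V\<^esub>}" and surj: "g ` carrier E = carrier V"
    using ex by (auto simp: short_exact_def)
  obtain y' where "y' \<in> carrier V" "g x \<cdot>\<^bsub>V\<^esub> e = y' \<cdot>\<^bsub>V\<^esub> a"
    using V(2) rmod_hom_closed[OF g x] by (auto simp: top_free_def)
  then obtain y where y: "y \<in> carrier E" "g x \<cdot>\<^bsub>V\<^esub> e = g y \<cdot>\<^bsub>V\<^esub> a" using surj by (metis imageE)
  define z where "z = x \<cdot>\<^bsub>E\<^esub> e \<ominus>\<^bsub>E\<^esub> y \<cdot>\<^bsub>E\<^esub> a"
  have xe: "x \<cdot>\<^bsub>E\<^esub> e \<in> carrier E" and ya: "y \<cdot>\<^bsub>E\<^esub> a \<in> carrier E"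
    using x y ea by (simp_all add: E.ract_closed)
  have z: "z \<in> carrier E" using xe ya by (simp add: z_def)
  have "g z = \<zero>\<^bsub>V\<^esub>"
    unfolding z_def rmod_hom_minus[OF E V(1) g xe ya]
    by (simp add: rmod_hom_ract[OF g] x y ea a_minus_def V.M.r_neg V.ract_closed rmod_hom_closed[OF g])
  then have "z \<in> f ` carrier U" unfolding im using z by simp
  then obtain u where u: "u \<in> carrier U" "z = f u" by auto
  obtain t where t: "t \<in> carrier U" "u \<cdot>\<^bsub>U\<^esub> e = t \<cdot>\<^bsub>U\<^esub> a" using U(2) u(1) by (auto simp: top_free_def)
  have "z \<cdot>\<^bsub>E\<^esub> e = z"
    unfolding z_def E.minus_ract[OF xe ya ea(1)]
    using x y ea by (simp add: E.ract_mult[symmetric] ee ae)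
  then have "z = f t \<cdot>\<^bsub>E\<^esub> a"
    using u t ea by (metis rmod_hom_ract[OF f])
  have "x \<cdot>\<^bsub>E\<^esub> e = (f t \<oplus>\<^bsub>E\<^esub> y) \<cdot>\<^bsub>E\<^esub> a"
  proof -
    have "x \<cdot>\<^bsub>E\<^esub> e = z \<oplus>\<^bsub>E\<^esub> y \<cdot>\<^bsub>E\<^esub> a"
      using xe ya by (simp add: z_def a_minus_def E.M.a_assoc E.M.l_neg)
    then show ?thesis
      using \<open>z = f t \<cdot>\<^bsub>E\<^esub> a\<close> y ea rmod_hom_closed[OF f t(1)] by (simp add: E.ract_add_left)
  qed
  then show "\<exists>y \<in> carrier E. x \<cdot>\<^bsub>E\<^esub> e = y \<cdot>\<^bsub>E\<^esub> a"
    using rmod_hom_closed[OF f t(1)] y(1) by blast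
qed

section \<open>Strong generators\<close>

text \<open>A path carries the value at its start to its end. The end may exceed \<open>n\<close>,
  where \<open>w \<le> b\<close> fails; so the last vertex needs no special treatment.\<close>

lemma imod_ract_lpath:
  assumes "1 \<le> u" "u \<le> w" "b \<le> n"
  shows "f \<cdot>\<^bsub>imod a b\<^esub> lpath n u w = (\<lambda>v. if v = w \<and> a \<le> w \<and> w \<le> b then f u else 0)"
proof
  fix v
  have "(\<Sum>x\<le>v. f x * entry (lpath n u w) x v) = (\<Sum>x\<le>v. if x = u then (if v = w then f u else 0) else 0)"
    if "v \<le> b"
    using assms that by (intro sum.cong) (auto simp: lpath_def entry_row)
  then show "(f \<cdot>\<^bsub>imod a b\<^esub> lpath n u w) v = (if v = w \<and> a \<le> w \<and> w \<le> b then f u else 0)"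
    using assms by (auto simp: imod_simps)
qed

context
  fixes n :: nat and X :: "((nat, nat) path \<Rightarrow> 'k::field, ((nat, nat) path \<Rightarrow> 'k) list) rmodule"
  assumes X: "X \<in> mod_cat (lin_algebra n)"
begin

private abbreviation "A \<equiv> lin_algebra n :: ((nat, nat) path \<Rightarrow> 'k) ring"
private abbreviation "I \<equiv> imod :: nat \<Rightarrow> nat \<Rightarrow> ((nat, nat) path \<Rightarrow> 'k, nat \<Rightarrow> 'k) rmodule"

text \<open>Empty intervals may occur in \<open>interval_decomposition\<close> and at the start of
  the inductions over intervals.\<close>

lemma in_layer_imod_empty:
  assumes "b < a" "1 \<le> a" "b \<le> n"
  shows "in_layer A X t (I a b)"
proof (rule in_layer_retract[OF in_layer_direct_sum[OF ring_lin_algebra X] right_module_imod])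
  have c: "f = (\<lambda>_. 0)" if "f \<in> carrier (I a b)" for f
  proof
    fix v show "f v = 0" using that assms unfolding imod_simps by (meson le_trans not_le)
  qed
  let ?D = "direct_sum [] :: (_, (nat \<Rightarrow> 'k) list) rmodule"
  have "(\<lambda>_. []) \<in> rmod_hom A (I a b) ?D"
    by (rule rmod_homI) (auto simp: direct_sum_Nil add_direct_sum_Nil ract_direct_sum_Nil)
  moreover have "(\<lambda>_ _. 0) \<in> rmod_hom A ?D (I a b)"
    by (rule rmod_homI) (auto simp: imod_simps)
  ultimately show "rmod_retract A (I a b) ?D"
    unfolding rmod_retract_def using c by (intro bexI[of _ "\<lambda>_. []"] bexI[of _ "\<lambda>_ _. 0"]) auto
qed (use assms in auto)

lemma gen_layer_eq_mod_catI:
  assumes "\<And>a b. 1 \<le> a \<Longrightarrow> a \<le> b \<Longrightarrow> b \<le> n \<Longrightarrow> in_layer A X t (I a b)"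
  shows "gen_layer A X (Suc t) = mod_cat A"
proof (rule equalityI[OF gen_layer_subset], rule subsetI)
  fix M assume M: "M \<in> mod_cat A"
  then have M': "right_module A M" "finitely_generated A M" by (auto simp: mod_cat_def)
  obtain js where js: "\<And>a b. (a, b) \<in> set js \<Longrightarrow> 1 \<le> a \<and> b \<le> n"
    and iso: "rmod_isomorphic A (direct_sum (map (\<lambda>(a, b). I a b) js)) M"
    using interval_decomposition[OF M'] by blast
  have "in_layer A X t (direct_sum (map (\<lambda>(a, b). I a b) js))"
  proof (rule in_layer_direct_sum[OF ring_lin_algebra X])
    fix N assume "N \<in> set (map (\<lambda>(a, b). I a b) js)"
    then obtain a b where "(a, b) \<in> set js" "N = I a b" by auto
    then show "in_layer A X t N"
      using assms[of a b] in_layer_imod_empty[of b a t] js[of a b] by (cases "a \<le> b") auto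
  qed
  then have "in_layer A X t M"
    using in_layer_retract M'(1) rmod_isomorphic_imp_retract(2)[OF _ iso]
      in_layer_finitely_generated(1) by blast
  then show "M \<in> gen_layer A X (Suc t)" by (rule in_layer_mod_cat[OF ring_lin_algebra X M])
qed

lemma in_layer_imod_ext:
  assumes "in_layer A X 0 (I (Suc c) b)" "in_layer A X t (I a c)" "1 \<le> a" "a \<le> Suc c" "c \<le> b" "b \<le> n"
  shows "in_layer A X (Suc t) (I a b)"
  by (rule in_layer_ext[OF ring_lin_algebra X assms(1,2)])
    (use assms in \<open>auto intro!: right_module_imod finitely_generated_imod short_exact_imod\<close>)

text \<open>The one-element sum has the shape expected by the retract lemmas for annihilation, socle
  and top, which then pass from the layer to the interval.\<close>

lemma gen_layer_imod_retract:
  assumes "gen_layer A X t = mod_cat A" "1 \<le> a" "b \<le> n"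
  obtains S where "S \<in> gen_layer A X t" "rmod_retract A (I a b) (direct_sum [S])" "right_module A S"
proof -
  obtain S where S: "S \<in> mod_cat A" "rmod_isomorphic A (I a b) S"
    using fg_right_module_isomorphic_mod[OF right_module_imod finitely_generated_imod] assms by blast
  then have S': "right_module A S" by (simp add: mod_cat_def)
  have "rmod_retract A S (direct_sum [S])"
    by (rule rmod_retract_direct_sum_member) (use ring_lin_algebra S' in auto)
  then have "rmod_retract A (I a b) (direct_sum [S])"
    using rmod_isomorphic_imp_retract(1)[OF right_module_imod S(2)] assms rmod_retract_trans by blast
  then show ?thesis using that S S' assms by blast
qed

section \<open>What a generator must contain, and how fast it then generates\<close>

lemma generator_nonzero:
  assumes "1 \<le> n" "gen_layer A X t = mod_cat A" shows "t \<noteq> 0"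
proof
  assume t: "t = 0"
  obtain S where S: "S \<in> gen_layer A X 0" "rmod_retract A (I 1 1) (direct_sum [S])" "right_module A S"
    using gen_layer_imod_retract[OF assms(2), of 1 1] assms(1) t by auto
  then have c: "carrier S = {\<zero>\<^bsub>S\<^esub>}" by auto
  let ?d = "\<lambda>v. if v = 1 then 1 else (0 :: 'k)"
  \<comment> \<open>Vanishing is expressed as annihilation by the unit, a property inherited by
    retracts of sums; the nonzero simple module at 1 violates it.\<close>
  have kill: "x \<cdot>\<^bsub>S\<^esub> \<one>\<^bsub>A\<^esub> = \<zero>\<^bsub>S\<^esub>" if "x \<in> carrier S" for x
    using that c right_module.ract_one[OF S(3)] by auto
  interpret I: right_module A "I 1 1" by (rule right_module_imod) (use assms in auto)
  have d: "?d \<in> carrier (I 1 1)" by (auto simp: imod_simps)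
  have "?d \<cdot>\<^bsub>I 1 1\<^esub> \<one>\<^bsub>A\<^esub> = \<zero>\<^bsub>I 1 1\<^esub>"
    by (rule ract_zero_retract[OF I.right_module_axioms _ S(2) _ _ d]) (use S(3) kill in auto)
  then have "?d = \<zero>\<^bsub>I 1 1\<^esub>" using I.ract_one[OF d] by simp
  from fun_cong[OF this, of 1] show False by (simp add: imod_simps)
qed

lemma in_layer_summand:
  assumes js: "\<And>a b. (a, b) \<in> set js \<Longrightarrow> 1 \<le> a \<and> b \<le> n"
    and iso: "rmod_isomorphic A (direct_sum (map (\<lambda>(a, b). I a b) js)) X"
    and ab: "(a, b) \<in> set js"
  shows "in_layer A X 0 (I a b)"
proof -
  have r: "right_module A N" if "N \<in> set (map (\<lambda>(a, b). I a b) js)" for N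
    using that js by (auto intro!: right_module_imod)
  have D: "right_module A (direct_sum (map (\<lambda>(a, b). I a b) js))"
    by (rule right_module_direct_sum[OF ring_lin_algebra r])
  have "rmod_retract A (I a b) (direct_sum (map (\<lambda>(a, b). I a b) js))"
    by (rule rmod_retract_direct_sum_member[OF ring_lin_algebra r]) (use ab in force)+
  then show ?thesis
    using in_layer_retract[OF in_layer_self[OF ring_lin_algebra X]] r[of "I a b"] ab
      rmod_retract_trans rmod_isomorphic_imp_retract(1)[OF D iso] by force
qed

context
  fixes js t
  assumes js: "\<And>a b. (a, b) \<in> set js \<Longrightarrow> 1 \<le> a \<and> b \<le> n"
    and iso: "rmod_isomorphic A (direct_sum (map (\<lambda>(a, b). I a b) js)) X"
    and gen: "gen_layer A X (Suc t) = mod_cat A"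
begin

lemma generator_soc:
  assumes i: "1 \<le> i" "i \<le> n"
  shows "\<exists>a \<le> i. (a, i) \<in> set js"
proof (rule ccontr)
  assume contra: "\<not> ?thesis"
  \<comment> \<open>For \<open>i = n\<close> the path \<open>?a\<close> is 0, and the condition then
    forbids any nonzero vector at \<open>n\<close>.\<close>
  let ?e = "lpath n i i :: (nat, nat) path \<Rightarrow> 'k" and ?a = "lpath n i (Suc i) :: (nat, nat) path \<Rightarrow> 'k"
  have I: "right_module A N \<and> soc_free N ?e ?a" if N: "N \<in> set (map (\<lambda>(a, b). I a b) js)" for N
  proof -
    obtain a b where ab: "(a, b) \<in> set js" "N = I a b" using N by auto
    have "soc_free (I a b) ?e ?a"
      unfolding soc_free_def
    proof (intro ballI impI)
      fix f assume f: "f \<in> carrier (I a b)" "f \<cdot>\<^bsub>I a b\<^esub> ?e = f" "f \<cdot>\<^bsub>I a b\<^esub> ?a = \<zero>\<^bsub>I a b\<^esub>"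
      have e: "f v = (if v = i \<and> a \<le> i \<and> i \<le> b then f i else 0)" for v
        using fun_cong[OF f(2), of v] i js[OF ab(1)] by (simp add: imod_ract_lpath)
      have s: "(if a \<le> Suc i \<and> Suc i \<le> b then f i else 0) = 0"
        using fun_cong[OF f(3), of "Suc i"] i js[OF ab(1)] by (simp add: imod_ract_lpath imod_simps(2))
      \<comment> \<open>An interval has only its last vertex in the socle; if it contains
        \<open>i\<close> and does not end there, the arrow to \<open>Suc i\<close> detects the value
        at \<open>i\<close>.\<close>
      have "i \<noteq> b \<or> \<not> a \<le> i" using contra ab(1) by auto
      then have "f i = 0" using e[of i] s by (cases "a \<le> i \<and> i \<le> b") auto
      then show "f = \<zero>\<^bsub>I a b\<^esub>" unfolding imod_simps using e by (metis (full_types))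
    qed
    then show ?thesis using js[OF ab(1)] ab(2) by (simp add: right_module_imod)
  qed
  have D: "right_module A (direct_sum (map (\<lambda>(a, b). I a b) js))"
    by (rule right_module_direct_sum[OF ring_lin_algebra]) (use I in blast)
  have X_free: "soc_free X ?e ?a"
    by (rule soc_free_retract[OF _ I rmod_isomorphic_imp_retract(2)[OF D iso]])
      (use X in \<open>auto simp: mod_cat_def lpath_closed\<close>)
  have all: "soc_free M ?e ?a" if "M \<in> gen_layer A X (Suc t)" for M
    using that
  proof (rule gen_layer_invariant[OF ring_lin_algebra X, where P = "\<lambda>_ M. soc_free M ?e ?a", rotated 3])
    show "soc_free X ?e ?a" by (rule X_free)
    show "soc_free M ?e ?a"
      if M: "M \<in> mod_cat A" and Us: "\<And>U. U \<in> set Us \<Longrightarrow> U \<in> mod_cat A \<and> soc_free U ?e ?a"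
        and ret: "rmod_retract A M (direct_sum Us)" for M Us
      by (rule soc_free_retract[OF _ _ ret]) (use M Us in \<open>auto simp: mod_cat_def lpath_closed\<close>)
    show "soc_free E ?e ?a"
      if "U \<in> mod_cat A" "E \<in> mod_cat A" "V \<in> mod_cat A" "soc_free U ?e ?a" "soc_free V ?e ?a"
        and ex: "short_exact A U E V" for U E V
      by (rule soc_free_ext[OF _ _ _ _ _ ex]) (use that in \<open>auto simp: mod_cat_def lpath_closed\<close>)
  qed
  obtain S where S: "S \<in> gen_layer A X (Suc t)" "rmod_retract A (I i i) (direct_sum [S])" "right_module A S"
    using gen_layer_imod_retract[OF gen i] by blast
  have "soc_free (I i i) ?e ?a"
    by (rule soc_free_retract[OF right_module_imod _ S(2)]) (use S all i in \<open>auto simp: lpath_closed\<close>)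
  moreover let ?d = "\<lambda>v. if v = i then 1 else (0 :: 'k)"
  have "?d \<in> carrier (I i i)" "?d \<cdot>\<^bsub>I i i\<^esub> ?e = ?d" "?d \<cdot>\<^bsub>I i i\<^esub> ?a = \<zero>\<^bsub>I i i\<^esub>"
    using i by (auto simp: imod_ract_lpath) (auto simp: imod_simps)
  ultimately have "?d = \<zero>\<^bsub>I i i\<^esub>" unfolding soc_free_def by blast
  from fun_cong[OF this, of i] show False by (simp add: imod_simps)
qed

lemma generator_top:
  assumes i: "1 \<le> i" "i \<le> n"
  shows "\<exists>b \<ge> i. (i, b) \<in> set js"
proof (rule ccontr)
  assume contra: "\<not> ?thesis"
  \<comment> \<open>For \<open>i = 1\<close> the path \<open>?a\<close> would start at 0 and is
    therefore 0, so the condition says that \<open>M\<close> vanishes at vertex 1.\<close>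
  let ?e = "lpath n i i :: (nat, nat) path \<Rightarrow> 'k" and ?a = "lpath n (i - 1) i :: (nat, nat) path \<Rightarrow> 'k"
  have I: "right_module A N \<and> top_free N ?e ?a" if N: "N \<in> set (map (\<lambda>(a, b). I a b) js)" for N
  proof -
    obtain a b where ab: "(a, b) \<in> set js" "N = I a b" using N by auto
    interpret N: right_module A "I a b" by (rule right_module_imod) (use js[OF ab(1)] in auto)
    have "top_free (I a b) ?e ?a"
      unfolding top_free_def
    proof
      fix f assume f: "f \<in> carrier (I a b)"
      show "\<exists>y \<in> carrier (I a b). f \<cdot>\<^bsub>I a b\<^esub> ?e = y \<cdot>\<^bsub>I a b\<^esub> ?a"
      proof (cases "a \<le> i \<and> i \<le> b")
        case True
        then have "a \<noteq> i" using contra ab(1) by auto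
        then have ai: "a \<le> i - 1" "1 \<le> i - 1" using True js[OF ab(1)] by auto
        \<comment> \<open>The interval contains \<open>i - 1\<close> as well, so the value at
          \<open>i\<close> arrives along the arrow from there.\<close>
        let ?y = "\<lambda>v. if v = i - 1 then f i else 0"
        have "?y \<in> carrier (I a b)" using ai True by (auto simp: imod_simps)
        moreover have "f \<cdot>\<^bsub>I a b\<^esub> ?e = ?y \<cdot>\<^bsub>I a b\<^esub> ?a"
          using i js[OF ab(1)] ai by (simp add: imod_ract_lpath)
        ultimately show ?thesis by blast
      next
        case False
        then have "f \<cdot>\<^bsub>I a b\<^esub> ?e = \<zero>\<^bsub>I a b\<^esub>"
          using i js[OF ab(1)] by (auto simp: imod_ract_lpath imod_simps(2))
        then show ?thesis using N.zero_ract[OF lpath_closed] by (metis N.M.zero_closed)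
      qed
    qed
    then show ?thesis using N.right_module_axioms ab(2) by simp
  qed
  have D: "right_module A (direct_sum (map (\<lambda>(a, b). I a b) js))"
    by (rule right_module_direct_sum[OF ring_lin_algebra]) (use I in blast)
  have X_free: "top_free X ?e ?a"
    by (rule top_free_retract[OF _ I rmod_isomorphic_imp_retract(2)[OF D iso]])
      (use X in \<open>auto simp: mod_cat_def lpath_closed\<close>)
  have idem: "?e \<otimes>\<^bsub>A\<^esub> ?e = ?e" "?a \<otimes>\<^bsub>A\<^esub> ?e = ?a"
    using i by (auto simp: lpath_mult)
  have all: "top_free M ?e ?a" if "M \<in> gen_layer A X (Suc t)" for M
    using that
  proof (rule gen_layer_invariant[OF ring_lin_algebra X, where P = "\<lambda>_ M. top_free M ?e ?a", rotated 3])
    show "top_free X ?e ?a" by (rule X_free)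
    show "top_free M ?e ?a"
      if M: "M \<in> mod_cat A" and Us: "\<And>U. U \<in> set Us \<Longrightarrow> U \<in> mod_cat A \<and> top_free U ?e ?a"
        and ret: "rmod_retract A M (direct_sum Us)" for M Us
      by (rule top_free_retract[OF _ _ ret]) (use M Us in \<open>auto simp: mod_cat_def lpath_closed\<close>)
    show "top_free E ?e ?a"
      if "U \<in> mod_cat A" "E \<in> mod_cat A" "V \<in> mod_cat A" "top_free U ?e ?a" "top_free V ?e ?a"
        and ex: "short_exact A U E V" for U E V
      by (rule top_free_ext[OF _ _ _ _ _ ex]) (use that idem in \<open>auto simp: mod_cat_def lpath_closed\<close>)
  qed
  obtain S where S: "S \<in> gen_layer A X (Suc t)" "rmod_retract A (I i i) (direct_sum [S])" "right_module A S"
    using gen_layer_imod_retract[OF gen i] by blast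
  have "top_free (I i i) ?e ?a"
    by (rule top_free_retract[OF right_module_imod _ S(2)]) (use S all i in \<open>auto simp: lpath_closed\<close>)
  moreover let ?d = "\<lambda>v. if v = i then 1 else (0 :: 'k)"
  have "?d \<in> carrier (I i i)" by (auto simp: imod_simps)
  ultimately obtain y where y: "y \<in> carrier (I i i)" "?d \<cdot>\<^bsub>I i i\<^esub> ?e = y \<cdot>\<^bsub>I i i\<^esub> ?a"
    unfolding top_free_def by blast
  have "(?d \<cdot>\<^bsub>I i i\<^esub> ?e) i = 1" using i by (simp add: imod_ract_lpath)
  moreover have y0: "y (i - 1) = 0"
    using y(1)[unfolded imod_simps, THEN spec, of "i - 1"] i by (cases "y (i - 1) = 0") auto
  have "(y \<cdot>\<^bsub>I i i\<^esub> ?a) i = 0"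
    using y0 i by (auto simp: imod_simps lpath_def entry_row intro!: sum.neutral)
  ultimately show False using y(2) by simp
qed

text \<open>Levels are shifted as in \<open>in_layer\<close>. If \<open>a = 1\<close>, a summand
  ending at \<open>b\<close> cannot start before \<open>a\<close>, so one extension per recursion
  step suffices. Otherwise the detour may be needed even for \<open>a = b\<close>, which explains
  the additional \<open>Suc\<close>; as \<open>a \<ge> 2\<close> then, both bounds stay below
  \<open>n\<close>.\<close>

lemma generator_in_layer:
  assumes "1 \<le> a" "a \<le> b" "b \<le> n"
  shows "in_layer A X (if a = 1 then b - 1 else Suc (b - a)) (I a b)"
  using assms
proof (induction b arbitrary: a rule: less_induct)
  case (less b)
  note mono = in_layer_mono[OF ring_lin_algebra X]
  have layer0: "in_layer A X 0 (I c d)" if "(c, d) \<in> set js" for c d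
    by (rule in_layer_summand[OF _ iso that]) (rule js)
  obtain g where g: "g \<le> b" "(g, b) \<in> set js" using generator_soc[of b] less.prems by auto
  consider "g = a" | "a < g" | "g < a" by linarith
  then show ?case
  proof cases
    case 1
    then show ?thesis using mono[OF _ layer0[OF g(2)]] by simp
  next
    case 2
    then obtain c where c: "g = Suc c" "a \<le> c" by (cases g) auto
    have "in_layer A X (Suc (if a = 1 then c - 1 else Suc (c - a))) (I a b)"
      by (rule in_layer_imod_ext[of c]) (use layer0[OF g(2)] less c g in auto)
    then show ?thesis
      by (rule mono[rotated]) (use c g less.prems in auto)
  next
    case 3
    obtain d where d: "b \<le> d" "(b, d) \<in> set js" using generator_top[of b] less.prems by auto
    obtain c where c: "b = Suc c" using less.prems by (cases b) auto
    have dn: "d \<le> n" and g1: "1 \<le> g" using js[OF d(2)] js[OF g(2)] by auto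
    let ?E = "direct_sum [I a (Suc c), I g d]" and ?V = "direct_sum [I g (Suc c), I a c]"
    \<comment> \<open>The hypothesis for the end \<open>b - 1\<close> gives exactly the level
      \<open>b - a\<close>, and for \<open>a = b\<close> the interval is empty; the pair extension
      then adds one.\<close>
    have "in_layer A X (b - a) (I a c)"
    proof (cases "a \<le> c")
      case True
      then have "in_layer A X (Suc (c - a)) (I a c)" using less.IH[of c a] less.prems 3 g1 c by auto
      then show ?thesis using True c by (simp add: Suc_diff_le)
    next
      case False
      then show ?thesis using less.prems c by (intro in_layer_imod_empty) auto
    qed
    moreover have "in_layer A X (b - a) (I g (Suc c))" using mono[OF _ layer0[OF g(2)]] c by simp
    ultimately have V: "in_layer A X (b - a) ?V"
      by (intro in_layer_direct_sum[OF ring_lin_algebra X]) auto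
    have r: "right_module A N \<and> finitely_generated A N" if "N \<in> set [I a (Suc c), I g d]" for N
      using that less.prems c dn g1 by (auto intro: right_module_imod finitely_generated_imod)
    have "in_layer A X (Suc (b - a)) ?E"
    proof (rule in_layer_ext[OF ring_lin_algebra X _ V])
      show "in_layer A X 0 (I (Suc c) d)" using layer0[OF d(2)] c by simp
      show "right_module A ?E" by (rule right_module_direct_sum[OF ring_lin_algebra]) (use r in blast)
      show "finitely_generated A ?E" by (rule finitely_generated_direct_sum[OF ring_lin_algebra r])
      show "short_exact A (I (Suc c) d) ?E ?V"
        by (rule short_exact_imod_pair) (use 3 less.prems c d in auto)
    qed
    moreover have "rmod_retract A (I a (Suc c)) ?E"
      by (rule rmod_retract_direct_sum_member[OF ring_lin_algebra]) (use r in auto)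
    ultimately have "in_layer A X (Suc (b - a)) (I a b)"
      using in_layer_retract r[of "I a (Suc c)"] c by auto
    then show ?thesis using 3 g1 by simp
  qed
qed

end

text \<open>The given \<open>t\<close> serves to force the summands found by
  \<open>generator_soc\<close> and \<open>generator_top\<close>; from these, \<open>n\<close> layers
  suffice however large \<open>t\<close> was.\<close>

lemma strong_generator_layer:
  assumes n: "1 \<le> n" and gen: "gen_layer A X t = mod_cat A"
  shows "gen_layer A X n = mod_cat A"
proof -
  obtain s where s: "t = Suc s" using generator_nonzero[OF n gen] by (cases t) auto
  have X': "right_module A X" "finitely_generated A X" using X by (auto simp: mod_cat_def)
  obtain js where js: "\<And>a b. (a, b) \<in> set js \<Longrightarrow> 1 \<le> a \<and> b \<le> n"
    and iso: "rmod_isomorphic A (direct_sum (map (\<lambda>(a, b). I a b) js)) X"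
    using interval_decomposition[OF X'] by blast
  have "gen_layer A X (Suc (n - 1)) = mod_cat A"
  proof (rule gen_layer_eq_mod_catI)
    fix a b assume ab: "1 \<le> a" "a \<le> b" "b \<le> n"
    show "in_layer A X (n - 1) (I a b)"
      by (rule in_layer_mono[OF ring_lin_algebra X _ generator_in_layer[OF js iso gen[unfolded s] ab]])
        (use ab in auto)
  qed
  then show ?thesis using n by simp
qed

end

section \<open>Attaining the times from 0 to n - 1\<close>

lemma generation_time_bound:
  assumes "gen_layer R X (Suc k) = mod_cat R"
  shows "generation_time R X \<le> enat k"
  using assms by (auto simp: generation_time_def intro!: Inf_lower)

lemma generation_time_realised:
  assumes m: "1 \<le> m" "m \<le> n"
  shows "\<exists>X \<in> mod_cat (lin_algebra n :: ((nat, nat) path \<Rightarrow> 'k::field) ring).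
    generation_time (lin_algebra n) X = enat (n - m)"
proof -
  let ?A = "lin_algebra n :: ((nat, nat) path \<Rightarrow> 'k) ring"
  let ?I = "imod :: nat \<Rightarrow> nat \<Rightarrow> ((nat, nat) path \<Rightarrow> 'k, nat \<Rightarrow> 'k) rmodule"
  \<comment> \<open>The simple modules beyond \<open>m\<close> permit extending an interval by one
    vertex per layer; everything up to \<open>m\<close> is available at once.\<close>
  let ?J = "{(a, b). 1 \<le> a \<and> a \<le> b \<and> b \<le> n \<and> (b \<le> m \<or> a = b)}"
  have "finite ?J" by (rule finite_subset[of _ "{..n} \<times> {..n}"]) auto
  then obtain js where js: "set js = ?J" using finite_list by blast
  let ?D = "direct_sum (map (\<lambda>(a, b). ?I a b) js)"
  have r: "right_module ?A N \<and> finitely_generated ?A N" if "N \<in> set (map (\<lambda>(a, b). ?I a b) js)" for N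
    using that js by (auto intro!: right_module_imod finitely_generated_imod)
  have D: "right_module ?A ?D" by (rule right_module_direct_sum[OF ring_lin_algebra]) (use r in blast)
  have "finitely_generated ?A ?D" by (rule finitely_generated_direct_sum[OF ring_lin_algebra r])
  from fg_right_module_isomorphic_mod[OF D this] obtain X where X: "X \<in> mod_cat ?A"
    and iso: "rmod_isomorphic ?A ?D X" by blast
  have layer0: "in_layer ?A X 0 (?I a b)" if "(a, b) \<in> ?J" for a b
    by (rule in_layer_summand[OF X _ iso]) (use js that in auto)
  \<comment> \<open>Truncated subtraction gives level 0 for \<open>b \<le> m\<close>. Including the
    empty interval \<open>a = Suc b\<close> lets a simple module be treated as an extension like the
    others.\<close>
  have layer: "in_layer ?A X (b - m) (?I a b)" if "1 \<le> a" "a \<le> Suc b" "b \<le> n" for a b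
    using that
  proof (induction b)
    case 0
    then show ?case by (intro in_layer_imod_empty[OF X]) auto
  next
    case (Suc b)
    consider "a = Suc (Suc b)" | "a \<le> Suc b" "Suc b \<le> m" | "a \<le> Suc b" "m \<le> b" using Suc.prems by linarith
    then show ?case
    proof cases
      case 1
      then show ?thesis using Suc.prems by (intro in_layer_imod_empty[OF X]) auto
    next
      case 2
      then show ?thesis using layer0[of a "Suc b"] Suc.prems by simp
    next
      case 3
      have "in_layer ?A X (Suc (b - m)) (?I a (Suc b))"
        by (rule in_layer_imod_ext[OF X, of b]) (use 3 Suc layer0 in auto)
      then show ?thesis using 3 by (simp add: Suc_diff_le)
    qed
  qed
  have "in_layer ?A X (n - m) (?I a b)" if "1 \<le> a" "a \<le> b" "b \<le> n" for a b
    by (rule in_layer_mono[OF ring_lin_algebra X _ layer]) (use that in auto)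
  then have eq: "gen_layer ?A X (Suc (n - m)) = mod_cat ?A" by (rule gen_layer_eq_mod_catI[OF X])
  have low: "n - m \<le> t" if gen: "gen_layer ?A X (Suc t) = mod_cat ?A" for t
  proof (rule ccontr)
    assume t: "\<not> n - m \<le> t"
    \<comment> \<open>Index \<open>t\<close> stands for layer \<open>t + 1\<close>, hence length
      \<open>Suc t\<close>. All starts from \<open>m\<close> on are included because, in an
      extension, the last arrow of the path starts later than the path itself.\<close>
    define P where "P t M \<longleftrightarrow> (\<forall>v \<ge> m. \<forall>x \<in> carrier M. x \<cdot>\<^bsub>M\<^esub> lpath n v (v + Suc t) = \<zero>\<^bsub>M\<^esub>)"
      for t and M :: "((nat, nat) path \<Rightarrow> 'k, ((nat, nat) path \<Rightarrow> 'k) list) rmodule"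
    have "P t M" if "M \<in> gen_layer ?A X (Suc t)" for M t
      using that
    proof (rule gen_layer_invariant[OF ring_lin_algebra X, rotated 3])
      show "P 0 X"
        unfolding P_def
      proof (intro allI ballI impI)
        fix v x assume v: "m \<le> v" and x: "x \<in> carrier X"
        show "x \<cdot>\<^bsub>X\<^esub> lpath n v (v + Suc 0) = \<zero>\<^bsub>X\<^esub>"
        proof (rule ract_zero_retract[OF _ _ rmod_isomorphic_imp_retract(2)[OF D iso] lpath_closed _ x])
          fix U f assume "U \<in> set (map (\<lambda>(a, b). ?I a b) js)" and f: "f \<in> carrier U"
          then obtain a b where ab: "(a, b) \<in> ?J" and U: "U = ?I a b" using js by auto
          \<comment> \<open>An arrow starting at or after \<open>m\<close> leaves every interval
            that ends by \<open>m\<close>, and it leaves every simple module.\<close>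
          show "f \<cdot>\<^bsub>U\<^esub> lpath n v (v + Suc 0) = \<zero>\<^bsub>U\<^esub>"
            using f ab v m unfolding U by (subst imod_ract_lpath) (auto simp: imod_simps fun_eq_iff)
        qed (use X r in \<open>auto simp: mod_cat_def\<close>)
      qed
    next
      fix s M Us assume M: "M \<in> mod_cat ?A" and Us: "\<And>U. U \<in> set Us \<Longrightarrow> U \<in> mod_cat ?A \<and> P s U"
        and ret: "rmod_retract ?A M (direct_sum Us)"
      show "P s M"
        unfolding P_def
        by (intro allI ballI impI, rule ract_zero_retract[OF _ _ ret lpath_closed])
          (use M Us in \<open>auto simp: mod_cat_def P_def\<close>)
    next
      fix s U E V assume mods: "U \<in> mod_cat ?A" "E \<in> mod_cat ?A" "V \<in> mod_cat ?A"
        and P: "P 0 U" "P s V" and ex: "short_exact ?A U E V"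
      then have U: "right_module ?A U" and E: "right_module ?A E" by (auto simp: mod_cat_def)
      interpret E: right_module ?A E by (rule E)
      obtain f g where f: "f \<in> rmod_hom ?A U E" and g: "g \<in> rmod_hom ?A E V"
        and im: "f ` carrier U = {x \<in> carrier E. g x = \<zero>\<^bsub>V\<^esub>}"
        using ex by (auto simp: short_exact_def)
      show "P (Suc s) E"
        unfolding P_def
      proof (intro allI ballI impI)
        fix v x assume v: "m \<le> v" and x: "x \<in> carrier E"
        show "x \<cdot>\<^bsub>E\<^esub> lpath n v (v + Suc (Suc s)) = \<zero>\<^bsub>E\<^esub>"
        proof (cases "v + Suc s \<le> n")
          case True
          \<comment> \<open>The first \<open>Suc s\<close> arrows kill the quotient and so move
            \<open>x\<close> into the submodule, which the remaining arrow kills. Splitting the path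
            needs \<open>?w\<close> to be a vertex; beyond \<open>n\<close> the whole path is
            0.\<close>
          let ?w = "v + Suc s"
          have "g (x \<cdot>\<^bsub>E\<^esub> lpath n v ?w) = \<zero>\<^bsub>V\<^esub>"
            using P(2) v rmod_hom_closed[OF g x] by (simp add: rmod_hom_ract[OF g x lpath_closed] P_def)
          then have "x \<cdot>\<^bsub>E\<^esub> lpath n v ?w \<in> f ` carrier U"
            unfolding im using x by (simp add: E.ract_closed lpath_closed)
          then obtain u where u: "u \<in> carrier U" "x \<cdot>\<^bsub>E\<^esub> lpath n v ?w = f u" by auto
          have "lpath n v (v + Suc (Suc s)) = lpath n v ?w \<otimes>\<^bsub>?A\<^esub> lpath n ?w (?w + Suc 0)"
            using True v m by (subst lpath_mult) auto
          then have "x \<cdot>\<^bsub>E\<^esub> lpath n v (v + Suc (Suc s)) = f u \<cdot>\<^bsub>E\<^esub> lpath n ?w (?w + Suc 0)"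
            using x u(2) by (simp add: E.ract_mult lpath_closed)
          also have "\<dots> = f (u \<cdot>\<^bsub>U\<^esub> lpath n ?w (?w + Suc 0))"
            using rmod_hom_ract[OF f u(1) lpath_closed] by simp
          also have "u \<cdot>\<^bsub>U\<^esub> lpath n ?w (?w + Suc 0) = \<zero>\<^bsub>U\<^esub>"
            using P(1) u(1) v unfolding P_def by (meson trans_le_add1)
          finally show ?thesis by (simp add: rmod_hom_zero[OF U E f])
        next
          case False
          then show ?thesis using x by (simp add: lpath_eq_0 E.ract_zero)
        qed
      qed
    qed
    moreover obtain S where S: "S \<in> gen_layer ?A X (Suc t)" "rmod_retract ?A (?I 1 n) (direct_sum [S])"
      "right_module ?A S"
      using gen_layer_imod_retract[OF X gen, of 1 n] by auto
    ultimately have "P t S" by blast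
    \<comment> \<open>As \<open>t < n - m\<close>, the path of length \<open>Suc t\<close> from
      \<open>m\<close> stays within the quiver and moves this vector to a nonzero one in
      \<open>[1, n]\<close>.\<close>
    let ?d = "\<lambda>v. if v = m then 1 else (0 :: 'k)"
    have "?d \<cdot>\<^bsub>?I 1 n\<^esub> lpath n m (m + Suc t) = \<zero>\<^bsub>?I 1 n\<^esub>"
      by (rule ract_zero_retract[OF right_module_imod _ S(2) lpath_closed])
        (use S(3) \<open>P t S\<close> m in \<open>auto simp: P_def imod_simps\<close>)
    then have "(?d \<cdot>\<^bsub>?I 1 n\<^esub> lpath n m (m + Suc t)) (m + Suc t) = 0" by (simp add: imod_simps)
    then show False using m t by (simp add: imod_ract_lpath split: if_splits)
  qed
  have "generation_time ?A X = enat (n - m)"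
  proof (rule antisym)
    show "generation_time ?A X \<le> enat (n - m)" by (rule generation_time_bound[OF eq])
    show "enat (n - m) \<le> generation_time ?A X"
      unfolding generation_time_def by (auto intro!: Inf_greatest low)
  qed
  then show ?thesis using X by blast
qed

theorem theorem1p2:
  fixes n :: nat
  assumes "n \<ge> 1"
  shows "OSpec (path_algebra (linear_quiver n) :: ((nat, nat) path \<Rightarrow> 'k::field) ring)
    = enat ` {0..n - 1}"
proof (rule equalityI; rule subsetI)
  let ?A = "lin_algebra n :: ((nat, nat) path \<Rightarrow> 'k) ring"
  fix d assume "d \<in> OSpec ?A"
  then obtain X where X: "X \<in> mod_cat ?A" "generation_time ?A X < \<infinity>" and d: "d = generation_time ?A X"
    by (auto simp: OSpec_def strong_generator_def)
  then obtain t where "gen_layer ?A X t = mod_cat ?A"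
    by (auto simp: generation_time_def split: if_splits)
  then have "gen_layer ?A X n = mod_cat ?A" by (rule strong_generator_layer[OF X(1) assms])
  then have "gen_layer ?A X (Suc (n - 1)) = mod_cat ?A" using assms by simp
  then have le: "d \<le> enat (n - 1)" unfolding d by (rule generation_time_bound)
  then obtain k where "d = enat k" by (cases d) auto
  with le show "d \<in> enat ` {0..n - 1}" by auto
next
  let ?A = "lin_algebra n :: ((nat, nat) path \<Rightarrow> 'k) ring"
  fix d assume "d \<in> enat ` {0..n - 1}"
  then obtain k where k: "d = enat k" "k \<le> n - 1" by auto
  \<comment> \<open>The time \<open>k\<close> is realised with \<open>m = n - k\<close>, which is at
    least 1 because \<open>k \<le> n - 1\<close>.\<close>
  have nk: "1 \<le> n - k" "n - k \<le> n" "n - (n - k) = k" using k assms by auto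
  obtain X where "X \<in> mod_cat ?A" "generation_time ?A X = enat k"
    using generation_time_realised[OF nk(1,2)] unfolding nk(3) by blast
  then show "d \<in> OSpec ?A"
    using k assms by (auto simp: OSpec_def strong_generator_def intro!: exI[of _ X])
qed

end
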